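(* For all integers $a\ge 1$, we have $$\mathrm{grFrob}(R(\Pi_{(a^2)});q)=\sum_{d=0}^{\lfloor a/2\rfloor}q^d\cdot s_{(2a-2d,2d)}.$$
   Context: Let $[n]=\{1,\dots,n\}$ and let $\binom{[n]}{2}$ be the set of 2-element subsets of $[n]$. Let $\mathbb{C}\big[\mathbf{x}_{\binom{[n]}{2}}\big]$ be the polynomial ring in the variables $x_{\{i,j\}}=x_{\{j,i\}}$ indexed by $\binom{[n]}{2}$; it is the coordinate ring of $\mathbb{C}^{\binom{[n]}{2}}$. The symmetric group $\mathfrak{S}_n$ acts on it by the graded algebra automorphisms determined by $w\cdot x_{\{i,j\}}=x_{\{w(i),w(j)\}}$. An unordered set partition $\pi$ of $[n]$ is identified with the point $\mathbf{z}\in\mathbb{C}^{\binom{[n]}{2}}$ with $z_{\{i,j\}}=1$ if $i,j$ lie in the same block of $\pi$, and $z_{\{i,j\}}=0$ otherwise. $\Pi_{(a^2)}\subseteq\mathbb{C}^{\binom{[2a]}{2}}$ is the finite set of (points identified with) unordered set partitions of $[2a]$ into $2$ blocks of size $a$. Orbit harmonics: for a finite set $\mathcal{Z}\subseteq\mathbb{C}^{\binom{[n]}{2}}$, $\mathbf{I}(\mathcal{Z})$ is the ideal of polynomials vanishing on $\mathcal{Z}$; for a nonzero polynomial $f$, $\tau(f)$ is its top-degree homogeneous component; $\mathrm{gr}\,\mathbf{I}(\mathcal{Z})=\langle\tau(f): 0\ne f\in\mathbf{I}(\mathcal{Z})\rangle$; and $R(\mathcal{Z})=\mathbb{C}\big[\mathbf{x}_{\binom{[n]}{2}}\big]/\mathrm{gr}\,\mathbf{I}(\mathcal{Z})$.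 If $\mathcal{Z}$ is $\mathfrak{S}_n$-stable, $R(\mathcal{Z})$ is a graded $\mathfrak{S}_n$-module. If an $\mathfrak{S}_n$-module $V\cong\bigoplus_{\lambda\vdash n}(V^\lambda)^{\oplus c_\lambda}$, with $V^\lambda$ the Specht modules (irreducibles), then $\mathrm{Frob}(V)=\sum_\lambda c_\lambda s_\lambda$ ($s_\lambda$ the Schur function). For graded $V=\bigoplus_d V_d$, $\mathrm{grFrob}(V;q)=\sum_d q^d\,\mathrm{Frob}(V_d)$. Trailing zeros in partitions are ignored. *)

theory Defs
  imports
    Complex_Main
    "HOL-Library.FuncSet"
    "HOL-Library.Disjoint_Sets"
    "HOL-Library.Function_Algebras"
    "HOL-Library.Poly_Mapping"
    "HOL-Library.Ramsey"
    "HOL-Combinatorics.Permutations"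
    "HOL-Computational_Algebra.Polynomial"
    "HOL-Algebra.QuotRing"
begin

text \<open>Linear extension of a map of basis elements to finite formal linear combinations.\<close>

definition push :: "('a \<Rightarrow> 'b) \<Rightarrow> ('a \<Rightarrow>\<^sub>0 'c::comm_monoid_add) \<Rightarrow> ('b \<Rightarrow>\<^sub>0 'c)" where
  "push f p = (\<Sum>k\<in>Poly_Mapping.keys p. Poly_Mapping.single (f k) (Poly_Mapping.lookup p k))"


section \<open>Modules over the symmetric group\<close>

text \<open>
  A complex representation of the group of permutations of \<open>{1..n}\<close>, given by its operations.
  Only arguments of \<open>act\<close> that permute \<open>{1..n}\<close>, and only vectors in the carrier, matter.
\<close>

record 'v sn_module = "'v partial_object" +
  vadd :: "'v \<Rightarrow> 'v \<Rightarrow> 'v"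
  vscale :: "complex \<Rightarrow> 'v \<Rightarrow> 'v"
  act :: "(nat \<Rightarrow> nat) \<Rightarrow> 'v \<Rightarrow> 'v"

definition sn_iso :: "nat \<Rightarrow> 'v sn_module \<Rightarrow> 'w sn_module \<Rightarrow> bool" where
  "sn_iso n V W \<longleftrightarrow> (\<exists>\<phi>. bij_betw \<phi> (carrier V) (carrier W)
     \<and> (\<forall>x\<in>carrier V. \<forall>y\<in>carrier V. \<phi> (vadd V x y) = vadd W (\<phi> x) (\<phi> y))
     \<and> (\<forall>c. \<forall>x\<in>carrier V. \<phi> (vscale V c x) = vscale W c (\<phi> x))
     \<and> (\<forall>w. w permutes {1..n} \<longrightarrow> (\<forall>x\<in>carrier V. \<phi> (act V w x) = act W w (\<phi> x))))"

text \<open>External direct sum over a finite index set.\<close>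

definition direct_sum :: "'i set \<Rightarrow> ('i \<Rightarrow> 'v sn_module) \<Rightarrow> ('i \<Rightarrow> 'v) sn_module" where
  "direct_sum I V =
    \<lparr>carrier = (\<Pi>\<^sub>E i\<in>I. carrier (V i)),
     vadd = (\<lambda>x y. \<lambda>i\<in>I. vadd (V i) (x i) (y i)),
     vscale = (\<lambda>c x. \<lambda>i\<in>I. vscale (V i) c (x i)),
     act = (\<lambda>w x. \<lambda>i\<in>I. act (V i) w (x i))\<rparr>"


section \<open>Partitions, Specht modules and Schur functions\<close>

definition partitions :: "nat \<Rightarrow> nat list set" where
  "partitions n = {\<mu>. sorted_wrt (\<ge>) \<mu> \<and> (\<forall>k\<in>set \<mu>. k > 0) \<and> sum_list \<mu> = n}"

text \<open>Rows and columns are counted from 0. Trailing zeros of the list contribute no cells.\<close>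

definition cells :: "nat list \<Rightarrow> (nat \<times> nat) set" where
  "cells \<mu> = {(i, j). i < length \<mu> \<and> j < \<mu> ! i}"

definition tableaux :: "nat \<Rightarrow> nat list \<Rightarrow> (nat \<times> nat \<Rightarrow> nat) set" where
  "tableaux n \<mu> = {t \<in> cells \<mu> \<rightarrow>\<^sub>E {1..n}. bij_betw t (cells \<mu>) {1..n}}"

text \<open>A tabloid (a tableau up to reordering the entries of each row) is the list of its row sets.\<close>

definition tabloid :: "nat list \<Rightarrow> (nat \<times> nat \<Rightarrow> nat) \<Rightarrow> nat set list" where
  "tabloid \<mu> t = map (\<lambda>i. t ` {c \<in> cells \<mu>. fst c = i}) [0..<length \<mu>]"

definition column_group :: "nat \<Rightarrow> nat list \<Rightarrow> (nat \<times> nat \<Rightarrow> nat) \<Rightarrow> (nat \<Rightarrow> nat) set" where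
  "column_group n \<mu> t = {\<sigma>. \<sigma> permutes {1..n} \<and>
     (\<forall>j. \<sigma> ` t ` {c \<in> cells \<mu>. snd c = j} = t ` {c \<in> cells \<mu>. snd c = j})}"

definition polytabloid :: "nat \<Rightarrow> nat list \<Rightarrow> (nat \<times> nat \<Rightarrow> nat) \<Rightarrow> (nat set list \<Rightarrow>\<^sub>0 complex)" where
  "polytabloid n \<mu> t =
     (\<Sum>\<sigma>\<in>column_group n \<mu> t. Poly_Mapping.single (tabloid \<mu> (\<sigma> \<circ> t)) (of_int (sign \<sigma>)))"

text \<open>
  The Specht module: the span of the polytabloids inside the permutation module on tabloids,
  on which \<open>w\<close> acts by applying \<open>w\<close> to all entries.
\<close>

definition Specht :: "nat \<Rightarrow> nat list \<Rightarrow> (nat set list \<Rightarrow>\<^sub>0 complex) sn_module" where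
  "Specht n \<mu> =
    \<lparr>carrier = {\<Sum>t\<in>tableaux n \<mu>. Poly_Mapping.map ((*) (c t)) (polytabloid n \<mu> t) | c. True},
     vadd = (+),
     vscale = (\<lambda>c. Poly_Mapping.map ((*) c)),
     act = (\<lambda>w. push (map ((`) w)))\<rparr>"

text \<open>
  Symmetric functions are formal power series of bounded degree in countably many variables,
  here given by their coefficient functions on monomials. Only addition, which is pointwise, is
  used; the pointwise product of functions is not the product of power series.
\<close>

type_synonym symfun = "(nat \<Rightarrow>\<^sub>0 nat) \<Rightarrow> int"

definition ssyt :: "nat list \<Rightarrow> (nat \<times> nat \<Rightarrow> nat) set" where
  "ssyt \<mu> = {T \<in> cells \<mu> \<rightarrow>\<^sub>E UNIV.
     (\<forall>i j j'. (i, j) \<in> cells \<mu> \<and> (i, j') \<in> cells \<mu> \<and> j < j' \<longrightarrow> T (i, j) \<le> T (i, j')) \<and>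
     (\<forall>i i' j. (i, j) \<in> cells \<mu> \<and> (i', j) \<in> cells \<mu> \<and> i < i' \<longrightarrow> T (i, j) < T (i', j))}"

definition schur :: "nat list \<Rightarrow> symfun" where
  "schur \<mu> = (\<lambda>\<alpha>. int (card {T \<in> ssyt \<mu>.
     \<forall>k. card {c \<in> cells \<mu>. T c = k} = Poly_Mapping.lookup \<alpha> k}))"


section \<open>Frobenius characteristic\<close>

text \<open>The direct sum over all partitions \<open>\<mu>\<close> of \<open>n\<close> of \<open>c \<mu>\<close> copies of the Specht module.\<close>

definition Specht_sum ::
    "nat \<Rightarrow> (nat list \<Rightarrow> nat) \<Rightarrow> (nat list \<times> nat \<Rightarrow> (nat set list \<Rightarrow>\<^sub>0 complex)) sn_module" where
  "Specht_sum n c = direct_sum (SIGMA \<mu>:partitions n. {..<c \<mu>}) (\<lambda>(\<mu>, k). Specht n \<mu>)"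

definition Frob :: "nat \<Rightarrow> 'v sn_module \<Rightarrow> symfun" where
  "Frob n V = (THE F. \<exists>c. sn_iso n V (Specht_sum n c) \<and>
                        F = (\<Sum>\<mu>\<in>partitions n. (\<lambda>\<alpha>. int (c \<mu>) * schur \<mu> \<alpha>)))"

text \<open>
  A graded module is the family of its homogeneous components; all but finitely many of them
  must be zero for the following polynomial in \<open>q\<close> to be meaningful.
\<close>

definition grFrob :: "nat \<Rightarrow> (nat \<Rightarrow> 'v sn_module) \<Rightarrow> symfun poly" where
  "grFrob n V = Sum_any (\<lambda>d. Polynomial.monom (Frob n (V d)) d)"


section \<open>Polynomials in the variables indexed by 2-element subsets\<close>

type_synonym monomial = "nat set \<Rightarrow>\<^sub>0 nat"
type_synonym mpoly = "monomial \<Rightarrow>\<^sub>0 complex"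

definition edge_ring :: "nat \<Rightarrow> mpoly ring" where
  "edge_ring n =
    \<lparr>carrier = {f. \<forall>m\<in>Poly_Mapping.keys f. Poly_Mapping.keys m \<subseteq> nsets {1..n} 2},
     mult = (*), one = 1, zero = 0, add = (+)\<rparr>"

definition const_poly :: "complex \<Rightarrow> mpoly" where
  "const_poly c = Poly_Mapping.single 0 c"

text \<open>The algebra automorphism sending the variable indexed by \<open>e\<close> to that indexed by \<open>w ` e\<close>.\<close>

definition act_poly :: "(nat \<Rightarrow> nat) \<Rightarrow> mpoly \<Rightarrow> mpoly" where
  "act_poly w = push (push ((`) w))"

definition eval_poly :: "(nat set \<Rightarrow> complex) \<Rightarrow> mpoly \<Rightarrow> complex" where
  "eval_poly z f = (\<Sum>m\<in>Poly_Mapping.keys f.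
     Poly_Mapping.lookup f m * (\<Prod>e\<in>Poly_Mapping.keys m. z e ^ Poly_Mapping.lookup m e))"

definition mono_deg :: "monomial \<Rightarrow> nat" where
  "mono_deg m = (\<Sum>e\<in>Poly_Mapping.keys m. Poly_Mapping.lookup m e)"

definition homogeneous :: "nat \<Rightarrow> mpoly \<Rightarrow> bool" where
  "homogeneous d f \<longleftrightarrow> (\<forall>m\<in>Poly_Mapping.keys f. mono_deg m = d)"

definition total_deg :: "mpoly \<Rightarrow> nat" where
  "total_deg f = Max (mono_deg ` Poly_Mapping.keys f)"

definition top_component :: "mpoly \<Rightarrow> mpoly" where
  "top_component f = (\<Sum>m | m \<in> Poly_Mapping.keys f \<and> mono_deg m = total_deg f.
     Poly_Mapping.single m (Poly_Mapping.lookup f m))"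


section \<open>Orbit harmonics\<close>

definition vanishing_ideal :: "nat \<Rightarrow> (nat set \<Rightarrow> complex) set \<Rightarrow> mpoly set" where
  "vanishing_ideal n Z = {f \<in> carrier (edge_ring n). \<forall>z\<in>Z. eval_poly z f = 0}"

definition gr_ideal :: "nat \<Rightarrow> (nat set \<Rightarrow> complex) set \<Rightarrow> mpoly set" where
  "gr_ideal n Z = genideal (edge_ring n) {top_component f | f. f \<in> vanishing_ideal n Z \<and> f \<noteq> 0}"

definition orbit_harmonics_ring :: "nat \<Rightarrow> (nat set \<Rightarrow> complex) set \<Rightarrow> mpoly set ring" where
  "orbit_harmonics_ring n Z = edge_ring n Quot gr_ideal n Z"

text \<open>
  The homogeneous components of the quotient ring. Scalars act through multiplication by the
  classes of constant polynomials, and permutations act on a coset elementwise; for \<open>Z\<close> stable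
  under the symmetric group the latter is again a coset.
\<close>

definition orbit_harmonics :: "nat \<Rightarrow> (nat set \<Rightarrow> complex) set \<Rightarrow> nat \<Rightarrow> mpoly set sn_module" where
  "orbit_harmonics n Z d =
    \<lparr>carrier = {gr_ideal n Z +>\<^bsub>edge_ring n\<^esub> f | f. f \<in> carrier (edge_ring n) \<and> homogeneous d f},
     vadd = add (orbit_harmonics_ring n Z),
     vscale = (\<lambda>c. mult (orbit_harmonics_ring n Z) (gr_ideal n Z +>\<^bsub>edge_ring n\<^esub> const_poly c)),
     act = (\<lambda>w. (`) (act_poly w))\<rparr>"


section \<open>Set partitions as points\<close>

definition partition_point :: "nat \<Rightarrow> nat set set \<Rightarrow> (nat set \<Rightarrow> complex)" where
  "partition_point n \<pi> = (\<lambda>e\<in>nsets {1..n} 2. if \<exists>B\<in>\<pi>. e \<subseteq> B then 1 else 0)"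

definition Pi_two_blocks :: "nat \<Rightarrow> (nat set \<Rightarrow> complex) set" where
  "Pi_two_blocks a = partition_point (2 * a) `
     {\<pi>. partition_on {1..2 * a} \<pi> \<and> card \<pi> = 2 \<and> (\<forall>B\<in>\<pi>. card B = a)}"

end

theory Submission
  imports Defs
begin

text \<open>
  A partition of \<open>{1..2*a}\<close> into two halves is a set \<open>B\<close> of size \<open>a\<close> up to complement. Put
  \<open>eps x B = -1\<close> for \<open>x \<in> B\<close> and \<open>1\<close> otherwise, and let \<open>chi U\<close> be the product of the \<open>eps x\<close>
  over \<open>x \<in> U\<close>. At the point of \<open>B\<close> the variable of \<open>{i, j}\<close> takes the value
  \<open>(1 + eps i * eps j) / 2\<close>, so the polynomials of degree at most \<open>d\<close> restrict to exactly the span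
  of the \<open>chi U\<close> with \<open>U\<close> of even size at most \<open>2*d\<close> (\<open>low_degree\<close>, \<open>low_polynomial\<close>). A homogeneous
  polynomial of degree \<open>d\<close> lies in the associated graded ideal iff on the point set it agrees with
  a polynomial of smaller degree (\<open>gr_ideal_eq\<close>). Hence the component of degree \<open>d\<close> is the quotient
  of the span of the \<open>chi U\<close> with \<open>U\<close> of even size at most \<open>k = 2*d\<close> by the span of those with
  smaller \<open>U\<close>.

  This quotient is the Specht module of shape \<open>(2*a - k, k)\<close> if \<open>k \<le> a\<close>, and zero otherwise. The map
  \<open>hat\<close> sends a tabloid with second row \<open>S\<close> to \<open>chi S\<close>; it sends the polytabloid of a tableau to the
  product of the differences \<open>eps b - eps a'\<close> over the columns \<open>(a', b)\<close> of height two
  (\<open>hat_polytabloid\<close>).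

  It is onto modulo lower terms by \<open>chi_reduction\<close>: as the \<open>eps y\<close> add up to zero on halves, a
  positive multiple of \<open>eps x\<close> is a sum of differences \<open>eps x - eps y\<close>, up to terms that drop in
  degree or vanish against the differences that are already there. Repeating this replaces every
  \<open>chi S\<close> by products of \<open>k\<close> differences; these need \<open>2*k\<close> distinct points, so for \<open>k > a\<close> everything
  is of lower degree.

  It is injective by \<open>hat_low_imp_zero\<close>: a product of \<open>k\<close> differences is orthogonal to \<open>chi U\<close> for
  every \<open>U\<close> with fewer than \<open>k\<close> elements, because some pair avoids \<open>U\<close> and swapping it changes the
  sign. Its inner products with the \<open>chi S\<close> are, up to a nonzero factor, the coefficients of the
  polytabloid. So a vector of the Specht module whose image is of lower degree is orthogonal to all
  polytabloids, hence to itself.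

  Finally, the Frobenius characteristic is given by a definite description, so the multiplicities in
  a sum of Specht modules isomorphic to one of two-row shape have to be shown unique
  (\<open>Specht_sum_two_row\<close>). This compares the vectors on which a column group acts by the sign: in the
  permutation module of another shape they force a dominance relation between the shapes, and for
  two rows they are unique up to a scalar.
\<close>

section \<open>Finite formal linear combinations\<close>

abbreviation lookup :: "('k \<Rightarrow>\<^sub>0 'c::zero) \<Rightarrow> 'k \<Rightarrow> 'c" where
  "lookup \<equiv> Poly_Mapping.lookup"

abbreviation keys :: "('k \<Rightarrow>\<^sub>0 'c::zero) \<Rightarrow> 'k set" where
  "keys \<equiv> Poly_Mapping.keys"

abbreviation single :: "'k \<Rightarrow> 'c::zero \<Rightarrow> 'k \<Rightarrow>\<^sub>0 'c" where
  "single \<equiv> Poly_Mapping.single"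

abbreviation pscale :: "complex \<Rightarrow> ('k \<Rightarrow>\<^sub>0 complex) \<Rightarrow> ('k \<Rightarrow>\<^sub>0 complex)" where
  "pscale c \<equiv> Poly_Mapping.map ((*) c)"

lemma lookup_pscale [simp]: "lookup (pscale c p) k = c * lookup p k"
  by (simp add: Poly_Mapping.map.rep_eq when_def)

interpretation pm: vector_space "pscale :: complex \<Rightarrow> ('k \<Rightarrow>\<^sub>0 complex) \<Rightarrow> _"
  by unfold_locales (auto intro!: poly_mapping_eqI simp: lookup_add algebra_simps)

lemma push_zero [simp]: "push f 0 = 0"
  by (simp add: push_def)

lemma push_single [simp]: "push f (single k v) = single (f k) v"
  by (simp add: push_def)

lemma push_add: "push f (p + q) = push f p + push f q"
  unfolding push_def by (rule setsum_keys_plus_distrib) (simp_all add: single_add)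

lemma push_sum: "push f (\<Sum>i\<in>A. p i) = (\<Sum>i\<in>A. push f (p i))"
  by (induction A rule: infinite_finite_induct) (simp_all add: push_add)

lemma keys_push: "keys (push f p) \<subseteq> f ` keys p"
proof
  fix x assume "x \<in> keys (push f p)"
  then have "lookup (push f p) x \<noteq> 0"
    by (simp add: in_keys_iff)
  then have "(\<Sum>k\<in>keys p. lookup p k when f k = x) \<noteq> 0"
    by (simp add: push_def lookup_sum lookup_single)
  then obtain k where "k \<in> keys p" "(lookup p k when f k = x) \<noteq> 0"
    by (rule sum.not_neutral_contains_not_neutral)
  then show "x \<in> f ` keys p"
    by auto
qed

lemma lookup_push_inj:
  assumes "inj f"
  shows "lookup (push f p) (f k) = lookup p k"
proof -
  have "lookup (push f p) (f k)
      = (\<Sum>l\<in>keys p. if l = k then lookup p l else 0)"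
    using assms by (auto simp: push_def lookup_sum lookup_single when_def inj_eq intro!: sum.cong)
  then show ?thesis
    by (simp add: sum.delta' in_keys_iff)
qed

lemma keys_push_inj:
  assumes "inj f"
  shows "keys (push f p) = f ` keys p"
  using keys_push[of f p] lookup_push_inj[OF assms, of p] by (auto simp: in_keys_iff)

lemma push_pscale: "push f (pscale c p) = pscale c (push f p)"
proof (cases "c = 0")
  case True
  then have "pscale c p = 0"
    by (intro poly_mapping_eqI) simp
  with True show ?thesis
    by (intro poly_mapping_eqI) simp
next
  case False
  then have "keys (pscale c p) = keys p"
    by (auto simp: in_keys_iff)
  then show ?thesis
    by (intro poly_mapping_eqI)
      (simp add: push_def lookup_sum lookup_single sum_distrib_left when_def if_distrib cong: if_cong)
qed

section \<open>Permutations\<close>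

abbreviation pinv :: "('a \<Rightarrow> 'a) \<Rightarrow> 'a \<Rightarrow> 'a" where
  "pinv \<equiv> inv_into UNIV"

lemma sign_mult_self: "of_int (sign \<sigma>) * (of_int (sign \<sigma>) * x) = (x::complex)"
  by (simp add: sign_def)

lemma transpose_image_invariant:
  assumes "x \<in> A \<longleftrightarrow> y \<in> A"
  shows "transpose x y ` A = A"
proof -
  have "transpose x y ` A \<subseteq> A" using assms by (auto simp: transpose_def)
  then have "transpose x y ` transpose x y ` A \<subseteq> transpose x y ` A" by blast
  then have "A \<subseteq> transpose x y ` A" by (simp add: image_image)
  then show ?thesis using \<open>transpose x y ` A \<subseteq> A\<close> by blast
qed

lemma inj_map_image: "inj w \<Longrightarrow> inj (map ((`) w))"
  by (auto intro!: inj_mapI injI simp: inj_image_eq_iff)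

section \<open>Specht modules\<close>

lemma finite_cells [simp]: "finite (cells \<mu>)"
proof -
  have "cells \<mu> \<subseteq> (\<Union>i<length \<mu>. {i} \<times> {..<\<mu> ! i})"
    by (auto simp: cells_def)
  then show ?thesis
    by (rule finite_subset) auto
qed

lemma finite_tableaux [simp]: "finite (tableaux n \<mu>)"
  unfolding tableaux_def by (simp add: finite_PiE)

lemma finite_column_group [simp]: "finite (column_group n \<mu> t)"
proof -
  have "column_group n \<mu> t \<subseteq> {\<sigma>. \<sigma> permutes {1..n}}"
    by (auto simp: column_group_def)
  then show ?thesis
    using finite_permutations[of "{1..n}"] finite_subset by blast
qed

lemma column_group_permutes: "\<sigma> \<in> column_group n \<mu> t \<Longrightarrow> \<sigma> permutes {1..n}"
  by (simp add: column_group_def)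

lemma id_in_column_group: "id \<in> column_group n \<mu> t"
  by (simp add: column_group_def permutes_id)

lemma column_group_comp:
  assumes "\<sigma> \<in> column_group n \<mu> t" "\<tau> \<in> column_group n \<mu> t"
  shows "\<sigma> \<circ> \<tau> \<in> column_group n \<mu> t"
proof -
  have "(\<sigma> \<circ> \<tau>) ` A = A" if "\<sigma> ` A = A" "\<tau> ` A = A" for A
    using that by (metis image_comp)
  then show ?thesis
    using assms by (simp add: column_group_def permutes_compose)
qed

lemma column_group_inv:
  assumes "\<sigma> \<in> column_group n \<mu> t"
  shows "pinv \<sigma> \<in> column_group n \<mu> t"
proof -
  have p: "\<sigma> permutes {1..n}"
    using assms by (rule column_group_permutes)
  have "pinv \<sigma> ` A = A" if "\<sigma> ` A = A" for A
    using that permutes_inj[OF p] by (metis image_inv_f_f)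
  then show ?thesis
    using assms p by (auto simp: column_group_def permutes_inv)
qed

lemma tabloid_cong:
  assumes "\<And>c. c \<in> cells \<mu> \<Longrightarrow> t c = t' c"
  shows "tabloid \<mu> t = tabloid \<mu> t'"
  unfolding tabloid_def using assms by (auto intro!: map_cong image_cong)

lemma column_group_cong:
  assumes "\<And>c. c \<in> cells \<mu> \<Longrightarrow> t c = t' c"
  shows "column_group n \<mu> t = column_group n \<mu> t'"
proof -
  have "t ` {c \<in> cells \<mu>. snd c = j} = t' ` {c \<in> cells \<mu>. snd c = j}" for j
    using assms by (auto intro!: image_cong)
  then show ?thesis
    by (simp add: column_group_def)
qed

lemma polytabloid_cong:
  assumes "\<And>c. c \<in> cells \<mu> \<Longrightarrow> t c = t' c"
  shows "polytabloid n \<mu> t = polytabloid n \<mu> t'"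
proof -
  have "tabloid \<mu> (\<sigma> \<circ> t) = tabloid \<mu> (\<sigma> \<circ> t')" for \<sigma>
    by (rule tabloid_cong) (simp add: assms)
  then show ?thesis
    by (simp add: polytabloid_def column_group_cong[OF assms])
qed

lemma length_tabloid [simp]: "length (tabloid \<mu> t) = length \<mu>"
  by (simp add: tabloid_def)

lemma tabloid_nth: "i < length \<mu> \<Longrightarrow> tabloid \<mu> t ! i = t ` {c \<in> cells \<mu>. fst c = i}"
  by (simp add: tabloid_def)

lemma tabloid_comp: "tabloid \<mu> (w \<circ> t) = map ((`) w) (tabloid \<mu> t)"
  by (simp add: tabloid_def image_comp)

lemma restrict_in_tableaux:
  assumes "bij_betw t (cells \<mu>) {1..n}"
  shows "restrict t (cells \<mu>) \<in> tableaux n \<mu>"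
  using assms bij_betw_imp_surj_on[OF assms]
  by (auto simp: tableaux_def bij_betw_restrict_eq)

lemma bij_permutes_comp:
  assumes "bij_betw t C {1..n}" "w permutes {1..n}"
  shows "bij_betw (w \<circ> t) C {1..n}"
  using bij_betw_trans[OF assms(1) permutes_imp_bij[OF assms(2)]] .

lemma Specht_carrier: "carrier (Specht n \<mu>) = pm.span (polytabloid n \<mu> ` tableaux n \<mu>)"
proof
  show "carrier (Specht n \<mu>) \<subseteq> pm.span (polytabloid n \<mu> ` tableaux n \<mu>)"
    by (auto simp: Specht_def intro!: pm.span_sum pm.span_scale intro: pm.span_base)
  show "pm.span (polytabloid n \<mu> ` tableaux n \<mu>) \<subseteq> carrier (Specht n \<mu>)"
  proof (rule pm.span_minimal)
    show "polytabloid n \<mu> ` tableaux n \<mu> \<subseteq> carrier (Specht n \<mu>)"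
    proof
      fix v assume "v \<in> polytabloid n \<mu> ` tableaux n \<mu>"
      then obtain t where t: "t \<in> tableaux n \<mu>" "v = polytabloid n \<mu> t" by auto
      have "(\<Sum>s\<in>tableaux n \<mu>. pscale (if s = t then 1 else 0) (polytabloid n \<mu> s))
          = (\<Sum>s\<in>tableaux n \<mu>. if s = t then polytabloid n \<mu> s else 0)"
        by (intro sum.cong refl) (auto intro!: poly_mapping_eqI)
      also have "\<dots> = v" using t by simp
      finally have "v = (\<Sum>s\<in>tableaux n \<mu>. pscale (if s = t then 1 else 0) (polytabloid n \<mu> s))" ..
      then show "v \<in> carrier (Specht n \<mu>)"
        unfolding Specht_def by (auto intro!: exI[of _ "\<lambda>s. if s = t then 1 else 0"])
    qed
    show "pm.subspace (carrier (Specht n \<mu>))"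
    proof (rule pm.subspaceI)
      have "0 = (\<Sum>s\<in>tableaux n \<mu>. pscale 0 (polytabloid n \<mu> s))"
        by (simp add: pm.scale_zero_left)
      then show "0 \<in> carrier (Specht n \<mu>)"
        unfolding Specht_def by (auto intro!: exI[of _ "\<lambda>s. 0"])
    next
      fix x y assume "x \<in> carrier (Specht n \<mu>)" "y \<in> carrier (Specht n \<mu>)"
      then obtain c d where
        "x = (\<Sum>s\<in>tableaux n \<mu>. pscale (c s) (polytabloid n \<mu> s))"
        "y = (\<Sum>s\<in>tableaux n \<mu>. pscale (d s) (polytabloid n \<mu> s))"
        by (auto simp: Specht_def)
      then have "x + y = (\<Sum>s\<in>tableaux n \<mu>. pscale (c s + d s) (polytabloid n \<mu> s))"
        by (simp add: sum.distrib pm.scale_left_distrib)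
      then show "x + y \<in> carrier (Specht n \<mu>)"
        unfolding Specht_def by (auto intro!: exI[of _ "\<lambda>s. c s + d s"])
    next
      fix r x assume "x \<in> carrier (Specht n \<mu>)"
      then obtain c where
        "x = (\<Sum>s\<in>tableaux n \<mu>. pscale (c s) (polytabloid n \<mu> s))"
        by (auto simp: Specht_def)
      then have "pscale r x = (\<Sum>s\<in>tableaux n \<mu>. pscale (r * c s) (polytabloid n \<mu> s))"
        by (simp add: pm.scale_sum_right)
      then show "pscale r x \<in> carrier (Specht n \<mu>)"
        unfolding Specht_def by (auto intro!: exI[of _ "\<lambda>s. r * c s"])
    qed
  qed
qed

lemma Specht_simps [simp]:
  "vadd (Specht n \<mu>) = (+)" "vscale (Specht n \<mu>) = pscale"
  "act (Specht n \<mu>) w = push (map ((`) w))"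
  by (simp_all add: Specht_def)

lemma polytabloid_in_Specht:
  assumes "bij_betw t (cells \<mu>) {1..n}"
  shows "polytabloid n \<mu> t \<in> carrier (Specht n \<mu>)"
proof -
  have "polytabloid n \<mu> t = polytabloid n \<mu> (restrict t (cells \<mu>))"
    by (rule polytabloid_cong) simp
  then show ?thesis
    using restrict_in_tableaux[OF assms] by (auto simp: Specht_carrier intro!: pm.span_base)
qed

lemma polytabloid_act:
  assumes w: "w permutes {1..n}"
  shows "push (map ((`) w)) (polytabloid n \<mu> t) = polytabloid n \<mu> (w \<circ> t)"
proof -
  have bw: "bij w" using w by (rule permutes_bij)
  have iw: "pinv w permutes {1..n}" using w by (rule permutes_inv)
  have ww: "w \<circ> pinv w = id" "pinv w \<circ> w = id"
    using permutes_inv_o[OF w] by auto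
  have perm: "permutation p" if "p permutes {1..n}" for p
    using that by (auto simp: permutation_permutes)
  have conj: "v \<circ> \<sigma> \<circ> pinv v \<in> column_group n \<mu> (v \<circ> t)"
    if "\<sigma> \<in> column_group n \<mu> t" "v permutes {1..n}" for v \<sigma> t
  proof -
    have "pinv v \<circ> v = id" using permutes_inv_o[OF that(2)] by auto
    then have "pinv v (v x) = x" for x by (metis comp_apply id_apply)
    then have "(v \<circ> \<sigma> \<circ> pinv v) ` (v \<circ> t) ` A = (v \<circ> t) ` A" if "\<sigma> ` t ` A = t ` A" for A
    proof -
      have "(v \<circ> \<sigma> \<circ> pinv v) ` (v \<circ> t) ` A = v ` \<sigma> ` t ` A"
        using \<open>\<And>x. pinv v (v x) = x\<close> by (simp add: image_image)
      also have "\<dots> = v ` t ` A" by (simp only: that)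
      finally show ?thesis by (simp only: image_comp)
    qed
    then show ?thesis
      using that by (simp add: column_group_def permutes_compose permutes_inv)
  qed
  have "polytabloid n \<mu> (w \<circ> t)
     = (\<Sum>\<sigma>\<in>column_group n \<mu> t. single (tabloid \<mu> (w \<circ> \<sigma> \<circ> t)) (of_int (sign \<sigma>)))"
    unfolding polytabloid_def
  proof (rule sum.reindex_bij_witness[where i = "\<lambda>\<sigma>. w \<circ> \<sigma> \<circ> pinv w" and j = "\<lambda>\<sigma>. pinv w \<circ> \<sigma> \<circ> w"])
    fix \<sigma> assume s: "\<sigma> \<in> column_group n \<mu> (w \<circ> t)"
    show "w \<circ> (pinv w \<circ> \<sigma> \<circ> w) \<circ> pinv w = \<sigma>"
      using ww by (metis comp_assoc comp_id id_comp)
    have "pinv w \<circ> \<sigma> \<circ> pinv (pinv w) \<in> column_group n \<mu> (pinv w \<circ> (w \<circ> t))"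
      using conj[OF s iw] .
    then show "pinv w \<circ> \<sigma> \<circ> w \<in> column_group n \<mu> t"
      using bw ww by (simp add: inv_inv_eq comp_assoc[symmetric])
    have "w \<circ> (pinv w \<circ> \<sigma> \<circ> w) \<circ> t = \<sigma> \<circ> (w \<circ> t)"
      using ww by (metis comp_assoc id_comp)
    moreover have "sign (pinv w \<circ> \<sigma> \<circ> w) = sign \<sigma>"
      using perm[OF w] perm[OF iw] perm[OF column_group_permutes[OF s]]
      by (simp add: sign_compose permutation_compose sign_inverse)
    ultimately show "single (tabloid \<mu> (w \<circ> (pinv w \<circ> \<sigma> \<circ> w) \<circ> t)) (of_int (sign (pinv w \<circ> \<sigma> \<circ> w)))
       = (single (tabloid \<mu> (\<sigma> \<circ> (w \<circ> t))) (of_int (sign \<sigma>)) :: _ \<Rightarrow>\<^sub>0 complex)"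
      by simp
  next
    fix \<sigma> assume s: "\<sigma> \<in> column_group n \<mu> t"
    show "pinv w \<circ> (w \<circ> \<sigma> \<circ> pinv w) \<circ> w = \<sigma>"
      using ww by (metis comp_assoc comp_id id_comp)
    show "w \<circ> \<sigma> \<circ> pinv w \<in> column_group n \<mu> (w \<circ> t)"
      using conj[OF s w] .
  qed
  also have "\<dots> = push (map ((`) w)) (polytabloid n \<mu> t)"
    by (simp add: polytabloid_def push_sum tabloid_comp comp_assoc)
  finally show ?thesis ..
qed

lemma polytabloid_column_act:
  assumes s: "\<sigma> \<in> column_group n \<mu> t"
  shows "push (map ((`) \<sigma>)) (polytabloid n \<mu> t) = pscale (of_int (sign \<sigma>)) (polytabloid n \<mu> t)"
proof -
  have p: "permutation p" if "p \<in> column_group n \<mu> t" for p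
    using column_group_permutes[OF that] by (auto simp: permutation_permutes)
  have ss: "\<sigma> \<circ> pinv \<sigma> = id" "pinv \<sigma> \<circ> \<sigma> = id"
    using permutes_inv_o[OF column_group_permutes[OF s]] by auto
  have "pscale (of_int (sign \<sigma>)) (polytabloid n \<mu> t)
    = (\<Sum>\<tau>\<in>column_group n \<mu> t. single (tabloid \<mu> (\<tau> \<circ> t)) (of_int (sign \<sigma>) * of_int (sign \<tau>)))"
    by (simp add: polytabloid_def pm.scale_sum_right)
  also have "\<dots> = (\<Sum>\<tau>\<in>column_group n \<mu> t. single (tabloid \<mu> (\<sigma> \<circ> \<tau> \<circ> t)) (of_int (sign \<tau>)))"
  proof (rule sum.reindex_bij_witness[where i = "\<lambda>\<tau>. \<sigma> \<circ> \<tau>" and j = "\<lambda>\<tau>. pinv \<sigma> \<circ> \<tau>"])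
    fix \<tau> assume t: "\<tau> \<in> column_group n \<mu> t"
    show "\<sigma> \<circ> (pinv \<sigma> \<circ> \<tau>) = \<tau>" using ss by (metis comp_assoc id_comp)
    show "pinv \<sigma> \<circ> \<tau> \<in> column_group n \<mu> t"
      using column_group_comp[OF column_group_inv[OF s] t] .
    have "sign (pinv \<sigma> \<circ> \<tau>) = sign \<sigma> * sign \<tau>"
      using p[OF t] p[OF s] p[OF column_group_inv[OF s]] by (simp add: sign_compose sign_inverse)
    then show "single (tabloid \<mu> (\<sigma> \<circ> (pinv \<sigma> \<circ> \<tau>) \<circ> t)) (of_int (sign (pinv \<sigma> \<circ> \<tau>)))
      = (single (tabloid \<mu> (\<tau> \<circ> t)) (of_int (sign \<sigma>) * of_int (sign \<tau>)) :: _ \<Rightarrow>\<^sub>0 complex)"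
      using \<open>\<sigma> \<circ> (pinv \<sigma> \<circ> \<tau>) = \<tau>\<close> by simp
  next
    fix \<tau> assume t: "\<tau> \<in> column_group n \<mu> t"
    show "pinv \<sigma> \<circ> (\<sigma> \<circ> \<tau>) = \<tau>" using ss by (metis comp_assoc id_comp)
    show "\<sigma> \<circ> \<tau> \<in> column_group n \<mu> t" using column_group_comp[OF s t] .
  qed
  also have "\<dots> = push (map ((`) \<sigma>)) (polytabloid n \<mu> t)"
    by (simp add: polytabloid_def push_sum tabloid_comp comp_assoc)
  finally show ?thesis ..
qed

lemma column_group_fixes_tabloid:
  assumes t: "bij_betw t (cells \<mu>) {1..n}" and s: "\<sigma> \<in> column_group n \<mu> t"
    and eq: "tabloid \<mu> (\<sigma> \<circ> t) = tabloid \<mu> t"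
  shows "\<sigma> = id"
proof
  fix x
  show "\<sigma> x = id x"
  proof (cases "x \<in> {1..n}")
    case True
    then obtain i j where c: "(i, j) \<in> cells \<mu>" "x = t (i, j)"
      using t by (metis bij_betw_imp_surj_on imageE surj_pair)
    then have i: "i < length \<mu>" by (simp add: cells_def)
    have "x \<in> t ` {c \<in> cells \<mu>. snd c = j}" using c by force
    then have "\<sigma> x \<in> \<sigma> ` t ` {c \<in> cells \<mu>. snd c = j}" by (rule imageI)
    then have "\<sigma> x \<in> t ` {c \<in> cells \<mu>. snd c = j}" using s by (simp add: column_group_def)
    then obtain i' where c': "(i', j) \<in> cells \<mu>" "\<sigma> x = t (i', j)" by auto
    have "\<sigma> x \<in> (\<sigma> \<circ> t) ` {c \<in> cells \<mu>. fst c = i}" using c by force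
    then have "\<sigma> x \<in> t ` {c \<in> cells \<mu>. fst c = i}"
      using arg_cong[OF eq, of "\<lambda>s. s ! i"] i by (simp add: tabloid_nth)
    then obtain j' where c'': "(i, j') \<in> cells \<mu>" "\<sigma> x = t (i, j')" by auto
    have "(i', j) = (i, j')"
      using t c' c'' by (metis bij_betw_imp_inj_on inj_onD)
    then show ?thesis using c c' by simp
  next
    case False
    then show ?thesis using column_group_permutes[OF s] by (auto dest: permutes_not_in)
  qed
qed

lemma lookup_polytabloid_self:
  assumes t: "bij_betw t (cells \<mu>) {1..n}"
  shows "lookup (polytabloid n \<mu> t) (tabloid \<mu> t) = 1"
proof -
  have "lookup (polytabloid n \<mu> t) (tabloid \<mu> t)
      = (\<Sum>\<sigma>\<in>column_group n \<mu> t. if \<sigma> = id then 1 else 0)"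
    unfolding polytabloid_def lookup_sum lookup_single
    using column_group_fixes_tabloid[OF t] by (intro sum.cong refl) (auto simp: when_def)
  then show ?thesis by (simp add: id_in_column_group)
qed

lemma polytabloid_nonzero: "bij_betw t (cells \<mu>) {1..n} \<Longrightarrow> polytabloid n \<mu> t \<noteq> 0"
  using lookup_polytabloid_self by fastforce

lemma keys_polytabloid:
  assumes t: "bij_betw t (cells \<mu>) {1..n}" and "s \<in> keys (polytabloid n \<mu> t)"
  obtains t' where "bij_betw t' (cells \<mu>) {1..n}" "s = tabloid \<mu> t'"
proof -
  have "lookup (polytabloid n \<mu> t) s \<noteq> 0" using assms by (simp add: in_keys_iff)
  then have "(\<Sum>\<sigma>\<in>column_group n \<mu> t. of_int (sign \<sigma>) when tabloid \<mu> (\<sigma> \<circ> t) = s) \<noteq> (0::complex)"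
    by (simp add: polytabloid_def lookup_sum lookup_single)
  then obtain \<sigma> where "\<sigma> \<in> column_group n \<mu> t" "s = tabloid \<mu> (\<sigma> \<circ> t)"
    by (auto elim!: sum.not_neutral_contains_not_neutral)
  then show ?thesis
    using that bij_permutes_comp[OF t] column_group_permutes by blast
qed

lemma keys_Specht:
  assumes "v \<in> carrier (Specht n \<mu>)" "s \<in> keys v"
  shows "\<exists>t. bij_betw t (cells \<mu>) {1..n} \<and> s = tabloid \<mu> t"
proof -
  define S where "S = {v :: nat set list \<Rightarrow>\<^sub>0 complex. \<forall>s\<in>keys v. \<exists>t. bij_betw t (cells \<mu>) {1..n} \<and> s = tabloid \<mu> t}"
  have "pm.span (polytabloid n \<mu> ` tableaux n \<mu>) \<subseteq> S"
  proof (rule pm.span_minimal)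
    show "polytabloid n \<mu> ` tableaux n \<mu> \<subseteq> S"
      unfolding S_def by (auto simp: tableaux_def) (metis keys_polytabloid One_nat_def)
    show "pm.subspace S"
      unfolding S_def
      by (rule pm.subspaceI) (use keys_add in \<open>fastforce simp: in_keys_iff\<close>)+
  qed
  then show ?thesis using assms by (auto simp: Specht_carrier S_def)
qed

lemma Specht_closed:
  shows "0 \<in> carrier (Specht n \<mu>)"
    and "x \<in> carrier (Specht n \<mu>) \<Longrightarrow> y \<in> carrier (Specht n \<mu>) \<Longrightarrow> x + y \<in> carrier (Specht n \<mu>)"
    and "x \<in> carrier (Specht n \<mu>) \<Longrightarrow> pscale c x \<in> carrier (Specht n \<mu>)"
  by (simp_all add: Specht_carrier pm.span_zero pm.span_add pm.span_scale)

lemma Specht_act_closed: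
  assumes "x \<in> carrier (Specht n \<mu>)" and w: "w permutes {1..n}"
  shows "push (map ((`) w)) x \<in> carrier (Specht n \<mu>)"
proof -
  have "pm.span (polytabloid n \<mu> ` tableaux n \<mu>) \<subseteq> {x. push (map ((`) w)) x \<in> carrier (Specht n \<mu>)}"
  proof (rule pm.span_minimal)
    show "polytabloid n \<mu> ` tableaux n \<mu> \<subseteq> {x. push (map ((`) w)) x \<in> carrier (Specht n \<mu>)}"
      using w by (auto simp: polytabloid_act tableaux_def intro!: polytabloid_in_Specht bij_permutes_comp)
    show "pm.subspace {x. push (map ((`) w)) x \<in> carrier (Specht n \<mu>)}"
      by (rule pm.subspaceI) (auto simp: push_add push_pscale Specht_closed)
  qed
  then show ?thesis using assms by (auto simp: Specht_carrier)
qed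

section \<open>Vectors alternating under a column group\<close>

text \<open>
  Polytabloids transform in this way under the column group of their tableau, and isomorphisms of
  modules preserve the property. The domain is all lists of sets, and not only the tabloids of shape
  \<open>\<mu>\<close>, since the vectors to compare come from permutation modules of other shapes.
\<close>

definition alternating :: "nat \<Rightarrow> nat list \<Rightarrow> (nat \<times> nat \<Rightarrow> nat) \<Rightarrow> (nat set list \<Rightarrow> complex) \<Rightarrow> bool" where
  "alternating n \<mu> t u \<longleftrightarrow>
     (\<forall>\<sigma>\<in>column_group n \<mu> t. \<forall>s. u (map ((`) \<sigma>) s) = of_int (sign \<sigma>) * u s)"

lemma alternating_lookup:
  assumes "\<And>\<sigma>. \<sigma> \<in> column_group n \<mu> t \<Longrightarrow> push (map ((`) \<sigma>)) v = pscale (of_int (sign \<sigma>)) v"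
  shows "alternating n \<mu> t (lookup v)"
  unfolding alternating_def
proof (intro ballI allI)
  fix \<sigma> s assume s: "\<sigma> \<in> column_group n \<mu> t"
  have "inj (map ((`) \<sigma>))"
    using permutes_inj[OF column_group_permutes[OF s]] by (rule inj_map_image)
  then have "lookup v s = lookup (push (map ((`) \<sigma>)) v) (map ((`) \<sigma>) s)"
    by (simp add: lookup_push_inj)
  also have "\<dots> = of_int (sign \<sigma>) * lookup v (map ((`) \<sigma>) s)"
    by (simp add: assms[OF s])
  finally show "lookup v (map ((`) \<sigma>) s) = of_int (sign \<sigma>) * lookup v s"
    by (simp add: sign_mult_self)
qed

lemma alternating_polytabloid: "alternating n \<mu> t (lookup (polytabloid n \<mu> t))"
  by (rule alternating_lookup) (rule polytabloid_column_act)

lemma alternating_combination: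
  "alternating n \<mu> t u \<Longrightarrow> alternating n \<mu> t u' \<Longrightarrow> alternating n \<mu> t (\<lambda>s. a * u s - b * u' s)"
  by (simp add: alternating_def algebra_simps)

lemma transpose_in_column_group:
  assumes t: "bij_betw t (cells \<mu>) {1..n}" and c: "(i, j) \<in> cells \<mu>" "(i', j) \<in> cells \<mu>"
  shows "transpose (t (i, j)) (t (i', j)) \<in> column_group n \<mu> t"
proof -
  have inj: "inj_on t (cells \<mu>)" using t by (rule bij_betw_imp_inj_on)
  have mem: "t c \<in> {1..n}" if "c \<in> cells \<mu>" for c using t that by (rule bij_betwE[rule_format])
  have "t (i, j) \<in> t ` {c \<in> cells \<mu>. snd c = k} \<longleftrightarrow> t (i', j) \<in> t ` {c \<in> cells \<mu>. snd c = k}" for k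
    using c inj by (auto dest: inj_onD)
  then show ?thesis
    using c mem by (auto simp: column_group_def transpose_image_invariant intro!: permutes_swap_id)
qed

text \<open>
  Swapping two entries of one column of \<open>t\<close> changes the sign of \<open>u\<close>. It leaves \<open>s\<close> alone if no row
  of \<open>s\<close> separates the two entries.
\<close>

lemma alternating_vanishes:
  assumes t: "bij_betw t (cells \<mu>) {1..n}" and u: "alternating n \<mu> t u"
    and c: "(i, j) \<in> cells \<mu>" "(i', j) \<in> cells \<mu>" "i \<noteq> i'"
    and s: "\<And>R. R \<in> set s \<Longrightarrow> t (i, j) \<in> R \<longleftrightarrow> t (i', j) \<in> R"
  shows "u s = 0"
proof -
  have "t (i, j) \<noteq> t (i', j)"
    using t c by (metis bij_betw_imp_inj_on inj_onD prod.inject)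
  then have sgn: "sign (transpose (t (i, j)) (t (i', j))) = -1"
    by (simp add: sign_swap_id)
  have "map ((`) (transpose (t (i, j)) (t (i', j)))) s = s"
    using s by (auto intro!: map_idI transpose_image_invariant)
  moreover have "u (map ((`) (transpose (t (i, j)) (t (i', j)))) s)
     = of_int (sign (transpose (t (i, j)) (t (i', j)))) * u s"
    using u transpose_in_column_group[OF t c(1,2)] unfolding alternating_def by blast
  ultimately show ?thesis
    by (simp add: sgn)
qed

text \<open>
  The tabloids in the support of an alternating function have no two entries in a common row that
  lie in a common column of \<open>t\<close>.
\<close>

lemma alternating_support:
  assumes t: "bij_betw t (cells \<mu>) {1..n}" and u: "alternating n \<mu> t u"
    and t': "bij_betw t' (cells \<nu>) {1..n}" and nz: "u (tabloid \<nu> t') \<noteq> 0"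
    and c: "(i, j) \<in> cells \<mu>" "(i', j) \<in> cells \<mu>"
    and d: "(r, q) \<in> cells \<nu>" "(r, q') \<in> cells \<nu>" "t (i, j) = t' (r, q)" "t (i', j) = t' (r, q')"
  shows "i = i'"
proof (rule ccontr)
  assume "i \<noteq> i'"
  have inj: "inj_on t' (cells \<nu>)" using t' by (rule bij_betw_imp_inj_on)
  have "t (i, j) \<in> R \<longleftrightarrow> t (i', j) \<in> R" if "R \<in> set (tabloid \<nu> t')" for R
    using that d inj by (auto simp: tabloid_def dest: inj_onD)
  then show False
    using alternating_vanishes[OF t u c \<open>i \<noteq> i'\<close>] nz by blast
qed

lemma cells_bij_pos:
  assumes t: "bij_betw t (cells \<mu>) {1..n}" and x: "x \<in> {1..n}"
  obtains i j where "(i, j) \<in> cells \<mu>" "t (i, j) = x"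
  using assms by (metis bij_betw_imp_surj_on imageE surj_pair)

text \<open>
  The entries of the first row of \<open>t'\<close> lie in different columns of \<open>t\<close>. Of the dominance order this
  keeps just the first inequality; together with \<open>alternating_rows\<close> it suffices to recognise a shape
  with two rows.
\<close>

lemma alternating_first_row:
  assumes t: "bij_betw t (cells \<mu>) {1..n}" and u: "alternating n \<mu> t u"
    and t': "bij_betw t' (cells \<nu>) {1..n}" and nz: "u (tabloid \<nu> t') \<noteq> 0"
    and \<mu>: "sorted_wrt (\<ge>) \<mu>" "\<mu> \<noteq> []" and \<nu>: "\<nu> \<noteq> []"
  shows "\<nu> ! 0 \<le> \<mu> ! 0"
proof -
  define g where "g q = (SOME c. c \<in> cells \<mu> \<and> t c = t' (0, q))" for q
  have g: "g q \<in> cells \<mu> \<and> t (g q) = t' (0, q)" if "q < \<nu> ! 0" for q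
  proof -
    have "(0, q) \<in> cells \<nu>" using that \<nu> by (simp add: cells_def)
    then have "t' (0, q) \<in> {1..n}" using t' by (rule bij_betwE[rule_format, rotated])
    then have "\<exists>c. c \<in> cells \<mu> \<and> t c = t' (0, q)"
      using cells_bij_pos[OF t] by metis
    then show ?thesis unfolding g_def by (rule someI_ex)
  qed
  have "inj_on (\<lambda>q. snd (g q)) {..<\<nu> ! 0}"
  proof (rule inj_onI)
    fix q q' assume q: "q \<in> {..<\<nu> ! 0}" "q' \<in> {..<\<nu> ! 0}" and eq: "snd (g q) = snd (g q')"
    obtain i j where ij: "g q = (i, j)" by fastforce
    obtain i' where ij': "g q' = (i', j)" using eq ij by (metis prod.collapse snd_conv)
    have d: "(0, q) \<in> cells \<nu>" "(0, q') \<in> cells \<nu>" using q \<nu> by (auto simp: cells_def)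
    have "i = i'"
      using alternating_support[OF t u t' nz _ _ d, of i j i'] g[of q] g[of q'] q ij ij' by auto
    then have "t' (0, q) = t' (0, q')" using g[of q] g[of q'] q ij ij' by auto
    then show "q = q'" using t' d by (metis bij_betw_imp_inj_on inj_onD prod.inject)
  qed
  moreover have "(\<lambda>q. snd (g q)) ` {..<\<nu> ! 0} \<subseteq> {..<\<mu> ! 0}"
  proof
    fix x assume "x \<in> (\<lambda>q. snd (g q)) ` {..<\<nu> ! 0}"
    then obtain q where q: "q < \<nu> ! 0" "x = snd (g q)" by auto
    then have gq: "fst (g q) < length \<mu>" "x < \<mu> ! fst (g q)" using g[of q] by (auto simp: cells_def split: prod.splits)
    have "\<mu> ! fst (g q) \<le> \<mu> ! 0"
      using sorted_wrt_nth_less[OF \<mu>(1), of 0 "fst (g q)"] gq by (cases "fst (g q)") auto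
    then show "x \<in> {..<\<mu> ! 0}" using gq by simp
  qed
  ultimately show ?thesis
    using card_inj_on_le[of "\<lambda>q. snd (g q)" "{..<\<nu> ! 0}" "{..<\<mu> ! 0}"] by simp
qed

text \<open>
  The entries of the first column of \<open>t\<close> lie in different rows of \<open>t'\<close>.
\<close>

lemma alternating_rows:
  assumes t: "bij_betw t (cells \<mu>) {1..n}" and u: "alternating n \<mu> t u"
    and t': "bij_betw t' (cells \<nu>) {1..n}" and nz: "u (tabloid \<nu> t') \<noteq> 0"
    and \<mu>: "\<forall>k\<in>set \<mu>. k > 0"
  shows "length \<mu> \<le> length \<nu>"
proof -
  define g where "g i = (SOME c. c \<in> cells \<nu> \<and> t' c = t (i, 0))" for i
  have g: "g i \<in> cells \<nu> \<and> t' (g i) = t (i, 0)" if "i < length \<mu>" for i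
  proof -
    have "(i, 0) \<in> cells \<mu>" using that \<mu> by (simp add: cells_def)
    then have "t (i, 0) \<in> {1..n}" using t by (rule bij_betwE[rule_format, rotated])
    then have "\<exists>c. c \<in> cells \<nu> \<and> t' c = t (i, 0)"
      using cells_bij_pos[OF t'] by metis
    then show ?thesis unfolding g_def by (rule someI_ex)
  qed
  have "inj_on (\<lambda>i. fst (g i)) {..<length \<mu>}"
  proof (rule inj_onI)
    fix i i' assume i: "i \<in> {..<length \<mu>}" "i' \<in> {..<length \<mu>}" and eq: "fst (g i) = fst (g i')"
    obtain r q where rq: "g i = (r, q)" by fastforce
    obtain q' where rq': "g i' = (r, q')" using eq rq by (metis prod.collapse fst_conv)
    have c: "(i, 0) \<in> cells \<mu>" "(i', 0) \<in> cells \<mu>" using i \<mu> by (auto simp: cells_def)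
    show "i = i'"
      using alternating_support[OF t u t' nz c, of r q q'] g[of i] g[of i'] i rq rq' by auto
  qed
  moreover have "(\<lambda>i. fst (g i)) ` {..<length \<mu>} \<subseteq> {..<length \<nu>}"
  proof
    fix x assume "x \<in> (\<lambda>i. fst (g i)) ` {..<length \<mu>}"
    then obtain i where "i < length \<mu>" "x = fst (g i)" by auto
    then show "x \<in> {..<length \<nu>}" using g[of i] by (auto simp: cells_def)
  qed
  ultimately show ?thesis
    using card_inj_on_le[of "\<lambda>i. fst (g i)" "{..<length \<mu>}" "{..<length \<nu>}"] by simp
qed

section \<open>Two-row shapes\<close>

text \<open>
  Partitions are lists of positive numbers, so the empty second row must be dropped.
\<close>

definition two_row :: "nat \<Rightarrow> nat \<Rightarrow> nat list" where
  "two_row n k = (if k = 0 then [n] else [n - k, k])"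

lemma two_row_partition: "1 \<le> n \<Longrightarrow> 2 * k \<le> n \<Longrightarrow> two_row n k \<in> partitions n"
  by (auto simp: two_row_def partitions_def)

lemma cells_two_row: "cells (two_row n k) = {(i, j). i = 0 \<and> j < n - k \<or> i = 1 \<and> j < k}"
  by (auto simp: cells_def two_row_def nth_Cons split: nat.splits if_splits)

lemma two_row_nth: "two_row n k ! 0 = n - k" "two_row n k \<noteq> []" "length (two_row n k) \<le> 2"
  by (auto simp: two_row_def)

lemma two_row_unique:
  assumes "1 \<le> n" "2 * k \<le> n" "\<mu> \<in> partitions n" "\<mu> ! 0 = n - k" "length \<mu> \<le> 2"
  shows "\<mu> = two_row n k"
proof -
  have "\<mu> \<noteq> []" using assms by (auto simp: partitions_def)
  then consider x where "\<mu> = [x]" | x y where "\<mu> = [x, y]"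
    using \<open>length \<mu> \<le> 2\<close> by (cases \<mu>; cases "tl \<mu>") auto
  then show ?thesis using assms by cases (auto simp: partitions_def two_row_def)
qed

text \<open>
  The second row of a tabloid of two-row shape. Taking the complement of the first row covers the
  shape \<open>[n]\<close> as well, whose tabloids are lists of length one.
\<close>

definition lower :: "nat \<Rightarrow> nat set list \<Rightarrow> nat set" where
  "lower n s = {1..n} - hd s"

lemma hd_tabloid_two_row: "hd (tabloid (two_row n k) t) = (\<lambda>j. t (0, j)) ` {..<n - k}"
proof -
  have "hd (tabloid (two_row n k) t) = t ` {c \<in> cells (two_row n k). fst c = 0}"
    by (simp add: tabloid_def two_row_def)
  then show ?thesis by (auto simp: cells_two_row image_iff)
qed

lemma lower_tabloid:
  assumes "bij_betw t (cells (two_row n k)) {1..n}"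
  shows "lower n (tabloid (two_row n k) t) = (\<lambda>j. t (1, j)) ` {..<k}"
proof -
  have inj: "inj_on t (cells (two_row n k))" using assms by (rule bij_betw_imp_inj_on)
  have "{1..n} = t ` cells (two_row n k)" using assms by (simp add: bij_betw_imp_surj_on)
  also have "\<dots> = (\<lambda>j. t (0, j)) ` {..<n - k} \<union> (\<lambda>j. t (1, j)) ` {..<k}"
    by (auto simp: cells_two_row image_iff)
  finally have "{1..n} = (\<lambda>j. t (0, j)) ` {..<n - k} \<union> (\<lambda>j. t (1, j)) ` {..<k}" .
  moreover have "(\<lambda>j. t (0, j)) ` {..<n - k} \<inter> (\<lambda>j. t (1, j)) ` {..<k} = {}"
    using inj by (auto simp: cells_two_row dest!: inj_onD)
  ultimately show ?thesis by (auto simp: lower_def hd_tabloid_two_row)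
qed

lemma card_lower_tabloid:
  assumes "bij_betw t (cells (two_row n k)) {1..n}"
  shows "card (lower n (tabloid (two_row n k) t)) = k"
proof -
  have "inj_on (\<lambda>j. t (1, j)) {..<k}"
    using bij_betw_imp_inj_on[OF assms] by (intro inj_onI) (auto simp: cells_two_row dest!: inj_onD)
  then show ?thesis using assms by (simp add: lower_tabloid card_image)
qed

lemma lower_subset: "lower n s \<subseteq> {1..n}"
  by (auto simp: lower_def)

lemma tabloid_two_row_eqI:
  assumes t: "bij_betw t (cells (two_row n k)) {1..n}" and t': "bij_betw t' (cells (two_row n k)) {1..n}"
    and eq: "lower n (tabloid (two_row n k) t) = lower n (tabloid (two_row n k) t')"
  shows "tabloid (two_row n k) t = tabloid (two_row n k) t'"
proof -
  have hd: "hd (tabloid (two_row n k) t) = {1..n} - lower n (tabloid (two_row n k) t)"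
    if "bij_betw t (cells (two_row n k)) {1..n}" for t
    using bij_betwE[OF that] by (auto simp: lower_def hd_tabloid_two_row cells_two_row)
  define F where "F L = (if k = 0 then [{1..n} - L] else [{1..n} - L, L])" for L
  have tab: "tabloid (two_row n k) t = F (lower n (tabloid (two_row n k) t))"
    if "bij_betw t (cells (two_row n k)) {1..n}" for t
  proof (cases "k = 0")
    case True
    have "tabloid (two_row n k) t = [hd (tabloid (two_row n k) t)]"
      using True by (simp add: tabloid_def two_row_def)
    also have "\<dots> = [{1..n} - lower n (tabloid (two_row n k) t)]"
      by (simp only: hd[OF that, symmetric])
    finally show ?thesis unfolding F_def if_P[OF True] .
  next
    case False
    have "tabloid (two_row n k) t = [hd (tabloid (two_row n k) t), t ` {c \<in> cells (two_row n k). fst c = 1}]"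
      using False by (simp add: tabloid_def two_row_def)
    also have "t ` {c \<in> cells (two_row n k). fst c = 1} = lower n (tabloid (two_row n k) t)"
      unfolding lower_tabloid[OF that] by (auto simp: cells_two_row image_iff)
    also have "[hd (tabloid (two_row n k) t), lower n (tabloid (two_row n k) t)]
      = [{1..n} - lower n (tabloid (two_row n k) t), lower n (tabloid (two_row n k) t)]"
      by (simp only: hd[OF that, symmetric])
    finally show ?thesis unfolding F_def if_not_P[OF False] .
  qed
  show ?thesis
    by (rule trans[OF tab[OF t]], rule trans[OF _ sym[OF tab[OF t']]]) (simp only: eq)
qed

lemma lower_map:
  assumes "w permutes {1..n}" "s \<noteq> []"
  shows "lower n (map ((`) w) s) = w ` lower n s"
  using assms permutes_image[OF assms(1)] permutes_inj[OF assms(1)]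
  by (simp add: lower_def hd_map image_set_diff)

text \<open>
  In the support of \<open>u\<close> every column of \<open>t\<close> of height two has one entry in each row of the tabloid.
  Swapping the two entries of a column that is upside down only changes the sign of \<open>u\<close> and brings
  the tabloid closer to that of \<open>t\<close>, where \<open>u\<close> vanishes.
\<close>

lemma alternating_two_row_zero:
  assumes t: "bij_betw t (cells (two_row n k)) {1..n}" and u: "alternating n (two_row n k) t u"
    and k: "2 * k \<le> n" and z: "u (tabloid (two_row n k) t) = 0"
    and t': "bij_betw t' (cells (two_row n k)) {1..n}"
  shows "u (tabloid (two_row n k) t') = 0"
  using t'
proof (induction "card {j. j < k \<and> t (1, j) \<notin> lower n (tabloid (two_row n k) t')}" arbitrary: t' rule: less_induct)
  case less
  let ?l = "two_row n k"
  let ?L = "lower n (tabloid ?l t')"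
  note t' = less.prems
  show ?case
  proof (cases "\<exists>j<k. t (1, j) \<notin> ?L")
    case False
    then have "lower n (tabloid ?l t) \<subseteq> ?L" unfolding lower_tabloid[OF t] by auto
    then have "lower n (tabloid ?l t) = ?L"
      using card_lower_tabloid[OF t] card_lower_tabloid[OF t']
      by (intro card_subset_eq) (auto intro: finite_subset[OF lower_subset])
    then show ?thesis using tabloid_two_row_eqI[OF t t'] z by simp
  next
    case True
    then obtain j where j: "j < k" "t (1, j) \<notin> ?L" by auto
    have c: "(0, j) \<in> cells ?l" "(1, j) \<in> cells ?l" using j k by (auto simp: cells_two_row)
    define \<tau> where "\<tau> = transpose (t (0, j)) (t (1, j))"
    have \<tau>: "\<tau> \<in> column_group n ?l t"
      unfolding \<tau>_def by (rule transpose_in_column_group[OF t c])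
    have p: "\<tau> permutes {1..n}" using \<tau> by (rule column_group_permutes)
    have ne: "tabloid ?l t' \<noteq> []" by (simp add: tabloid_def two_row_def)
    have us: "u (tabloid ?l (\<tau> \<circ> t')) = of_int (sign \<tau>) * u (tabloid ?l t')"
      using u \<tau> by (simp add: alternating_def tabloid_comp)
    have mem: "t (0, j) \<in> {1..n}" "t (1, j) \<in> {1..n}" using bij_betwE[OF t] c by auto
    show ?thesis
    proof (cases "t (0, j) \<in> ?L")
      case True
      have inj: "t (0, j') \<noteq> t (1, j)" "j' < k \<Longrightarrow> t (1, j') \<noteq> t (0, j)"
        "j' < k \<Longrightarrow> j' \<noteq> j \<Longrightarrow> t (1, j') \<noteq> t (1, j)" if "j' < n - k" for j'
        using that j k bij_betw_imp_inj_on[OF t] by (auto simp: cells_two_row dest!: inj_onD)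
      have k': "x < n - k" if "x < k" for x using that k by simp
      have L': "lower n (tabloid ?l (\<tau> \<circ> t')) = \<tau> ` ?L"
        using lower_map[OF p ne] by (simp add: tabloid_comp)
      have in_img: "x \<in> \<tau> ` ?L \<longleftrightarrow> \<tau> x \<in> ?L" for x
      proof -
        have "\<tau> (\<tau> x) = x" by (simp add: \<tau>_def)
        then show ?thesis using inj_image_mem_iff[OF permutes_inj[OF p], of "\<tau> x" ?L] by simp
      qed
      have sub: "{i. i < k \<and> t (1, i) \<notin> lower n (tabloid ?l (\<tau> \<circ> t'))} \<subset> {i. i < k \<and> t (1, i) \<notin> ?L}"
      proof
        show "{i. i < k \<and> t (1, i) \<notin> lower n (tabloid ?l (\<tau> \<circ> t'))} \<subseteq> {i. i < k \<and> t (1, i) \<notin> ?L}"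
        proof safe
          fix i assume i: "i < k" "t (1, i) \<notin> lower n (tabloid ?l (\<tau> \<circ> t'))" "t (1, i) \<in> ?L"
          then have "i \<noteq> j" using j by auto
          then have "\<tau> (t (1, i)) = t (1, i)"
            using inj[OF k'[OF i(1)]] i(1) unfolding \<tau>_def by (simp add: transpose_apply_other)
          then show False using i(2,3) by (simp add: L' in_img)
        qed
        have "\<tau> (t (1, j)) \<in> ?L" using True by (simp add: \<tau>_def)
        then have "j \<notin> {i. i < k \<and> t (1, i) \<notin> lower n (tabloid ?l (\<tau> \<circ> t'))}"
          by (simp add: L' in_img)
        moreover have "j \<in> {i. i < k \<and> t (1, i) \<notin> ?L}" using j by simp
        ultimately show "{i. i < k \<and> t (1, i) \<notin> lower n (tabloid ?l (\<tau> \<circ> t'))} \<noteq> {i. i < k \<and> t (1, i) \<notin> ?L}"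
          by blast
      qed
      have "card {i. i < k \<and> t (1, i) \<notin> lower n (tabloid ?l (\<tau> \<circ> t'))} < card {i. i < k \<and> t (1, i) \<notin> ?L}"
        using sub by (intro psubset_card_mono) auto
      then have "u (tabloid ?l (\<tau> \<circ> t')) = 0"
        using less.hyps bij_permutes_comp[OF t' p] by blast
      then show ?thesis using us by (simp add: sign_def split: if_splits)
    next
      case False
      obtain q where q: "q < n - k" "t (0, j) = t' (0, q)"
        using False mem by (auto simp: lower_def hd_tabloid_two_row)
      obtain q' where q': "q' < n - k" "t (1, j) = t' (0, q')"
        using j mem by (auto simp: lower_def hd_tabloid_two_row)
      have "(0, q) \<in> cells ?l" "(0, q') \<in> cells ?l" using q q' by (auto simp: cells_two_row)
      then show ?thesis
        using alternating_support[OF t u t' _ c, of 0 q q'] q q' by auto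
    qed
  qed
qed

text \<open>
  Subtracting from \<open>u\<close> the multiple of the polytabloid with the same value at the tabloid of \<open>t\<close> leaves
  an alternating function that vanishes there.
\<close>

lemma alternating_two_row_unique:
  assumes t: "bij_betw t (cells (two_row n k)) {1..n}"
    and u: "alternating n (two_row n k) t u" and k: "2 * k \<le> n"
    and t': "bij_betw t' (cells (two_row n k)) {1..n}"
  shows "u (tabloid (two_row n k) t') = u (tabloid (two_row n k) t)
     * lookup (polytabloid n (two_row n k) t) (tabloid (two_row n k) t')"
proof -
  let ?v = "\<lambda>s. 1 * u s - u (tabloid (two_row n k) t) * lookup (polytabloid n (two_row n k) t) s"
  have "?v (tabloid (two_row n k) t') = 0"
    by (rule alternating_two_row_zero[OF t _ k _ t'])
      (simp_all only: alternating_combination[OF u alternating_polytabloid] lookup_polytabloid_self[OF t], simp)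
  then show ?thesis by simp
qed

section \<open>Frobenius characteristics of two-row Specht modules\<close>

lemma sn_iso_trans:
  assumes "sn_iso n V W" "sn_iso n W X"
  shows "sn_iso n V X"
proof -
  obtain \<phi> where \<phi>: "bij_betw \<phi> (carrier V) (carrier W)"
     "\<forall>x\<in>carrier V. \<forall>y\<in>carrier V. \<phi> (vadd V x y) = vadd W (\<phi> x) (\<phi> y)"
     "\<forall>c. \<forall>x\<in>carrier V. \<phi> (vscale V c x) = vscale W c (\<phi> x)"
     "\<forall>w. w permutes {1..n} \<longrightarrow> (\<forall>x\<in>carrier V. \<phi> (act V w x) = act W w (\<phi> x))"
    using assms(1) unfolding sn_iso_def by blast
  obtain \<psi> where \<psi>: "bij_betw \<psi> (carrier W) (carrier X)"
     "\<forall>x\<in>carrier W. \<forall>y\<in>carrier W. \<psi> (vadd W x y) = vadd X (\<psi> x) (\<psi> y)"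
     "\<forall>c. \<forall>x\<in>carrier W. \<psi> (vscale W c x) = vscale X c (\<psi> x)"
     "\<forall>w. w permutes {1..n} \<longrightarrow> (\<forall>x\<in>carrier W. \<psi> (act W w x) = act X w (\<psi> x))"
    using assms(2) unfolding sn_iso_def by blast
  have m: "\<And>x. x \<in> carrier V \<Longrightarrow> \<phi> x \<in> carrier W" using \<phi>(1) by (auto dest: bij_betwE)
  show ?thesis
    unfolding sn_iso_def
    by (rule exI[of _ "\<psi> \<circ> \<phi>"]) (use \<phi> \<psi> m in \<open>simp add: bij_betw_trans\<close>)
qed

lemma sn_iso_sym:
  assumes "sn_iso n V W"
    and add: "\<And>x y. x \<in> carrier V \<Longrightarrow> y \<in> carrier V \<Longrightarrow> vadd V x y \<in> carrier V"
    and scale: "\<And>c x. x \<in> carrier V \<Longrightarrow> vscale V c x \<in> carrier V"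
    and act: "\<And>w x. w permutes {1..n} \<Longrightarrow> x \<in> carrier V \<Longrightarrow> act V w x \<in> carrier V"
  shows "sn_iso n W V"
proof -
  obtain \<phi> where \<phi>: "bij_betw \<phi> (carrier V) (carrier W)"
     "\<And>x y. x\<in>carrier V \<Longrightarrow> y\<in>carrier V \<Longrightarrow> \<phi> (vadd V x y) = vadd W (\<phi> x) (\<phi> y)"
     "\<And>c x. x\<in>carrier V \<Longrightarrow> \<phi> (vscale V c x) = vscale W c (\<phi> x)"
     "\<And>w x. w permutes {1..n} \<Longrightarrow> x\<in>carrier V \<Longrightarrow> \<phi> (act V w x) = act W w (\<phi> x)"
    using assms(1) unfolding sn_iso_def by blast
  define \<psi> where "\<psi> = inv_into (carrier V) \<phi>"
  have inv: "\<psi> (\<phi> x) = x" if "x \<in> carrier V" for x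
    using that bij_betw_imp_inj_on[OF \<phi>(1)] by (simp add: \<psi>_def)
  have surj: "\<exists>x'\<in>carrier V. x = \<phi> x'" if "x \<in> carrier W" for x
    using that bij_betw_imp_surj_on[OF \<phi>(1)] by auto
  show ?thesis
    unfolding sn_iso_def
  proof (intro exI[of _ \<psi>] conjI ballI allI impI)
    show "bij_betw \<psi> (carrier W) (carrier V)"
      unfolding \<psi>_def by (rule bij_betw_inv_into[OF \<phi>(1)])
  next
    fix x y assume "x \<in> carrier W" "y \<in> carrier W"
    then obtain x' y' where "x' \<in> carrier V" "y' \<in> carrier V" "x = \<phi> x'" "y = \<phi> y'"
      using surj by metis
    then show "\<psi> (vadd W x y) = vadd V (\<psi> x) (\<psi> y)"
      using inv[OF add[of x' y']] by (simp add: inv \<phi>(2))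
  next
    fix c x assume "x \<in> carrier W"
    then obtain x' where "x' \<in> carrier V" "x = \<phi> x'" using surj by metis
    then show "\<psi> (vscale W c x) = vscale V c (\<psi> x)"
      using inv[OF scale[of x' c]] by (simp add: inv \<phi>(3))
  next
    fix w x assume "w permutes {1..n}" "x \<in> carrier W"
    then obtain x' where "x' \<in> carrier V" "x = \<phi> x'" using surj by metis
    then show "\<psi> (act W w x) = act V w (\<psi> x)"
      using inv[OF act[of w x']] \<open>w permutes {1..n}\<close> by (simp add: inv \<phi>(4))
  qed
qed

lemma finite_partitions [simp]: "finite (partitions n)"
proof (rule finite_subset)
  show "partitions n \<subseteq> {\<mu>. set \<mu> \<subseteq> {..n} \<and> length \<mu> \<le> n}"
  proof
    fix \<mu> assume "\<mu> \<in> partitions n"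
    then have \<mu>: "\<forall>k\<in>set \<mu>. k > 0" "sum_list \<mu> = n" by (auto simp: partitions_def)
    have "set \<mu> \<subseteq> {..sum_list \<mu>}" by (auto intro: member_le_sum_list)
    moreover have "length \<mu> \<le> sum_list \<mu>"
      using \<mu>(1) by (induction \<mu>) (auto simp: Suc_le_eq)
    ultimately show "\<mu> \<in> {\<mu>. set \<mu> \<subseteq> {..n} \<and> length \<mu> \<le> n}" using \<mu> by auto
  qed
  show "finite {\<mu>. set \<mu> \<subseteq> {..n} \<and> length \<mu> \<le> n}"
    by (rule finite_lists_length_le) simp
qed

lemma card_cells: "card (cells \<mu>) = sum_list \<mu>"
proof -
  have "cells \<mu> = (SIGMA i:{..<length \<mu>}. {..<\<mu> ! i})" by (auto simp: cells_def)
  then show ?thesis by (simp add: sum_list_sum_nth atLeast0LessThan)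
qed

lemma exists_tableau:
  assumes "\<mu> \<in> partitions n"
  obtains t where "bij_betw t (cells \<mu>) {1..n}"
proof -
  have "card (cells \<mu>) = card {1..n}" using assms by (simp add: card_cells partitions_def)
  then show ?thesis using that finite_same_card_bij[of "cells \<mu>" "{1..n}"] by auto
qed

lemma polytabloids_transitive:
  assumes t: "bij_betw t (cells \<mu>) {1..n}" and t': "bij_betw t' (cells \<mu>) {1..n}"
  obtains w where "w permutes {1..n}" "polytabloid n \<mu> t' = push (map ((`) w)) (polytabloid n \<mu> t)"
proof -
  define w where "w x = (if x \<in> {1..n} then t' (inv_into (cells \<mu>) t x) else x)" for x
  have "bij_betw (t' \<circ> inv_into (cells \<mu>) t) {1..n} {1..n}"
    using bij_betw_inv_into[OF t] t' by (rule bij_betw_trans)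
  then have "bij_betw w {1..n} {1..n}"
    by (rule bij_betw_cong[THEN iffD1, rotated]) (simp add: w_def)
  then have w: "w permutes {1..n}"
    by (rule bij_imp_permutes) (simp only: w_def if_False)
  have "t' c = (w \<circ> t) c" if "c \<in> cells \<mu>" for c
    using bij_betwE[OF t] that bij_betw_imp_inj_on[OF t] by (simp add: w_def)
  then have "polytabloid n \<mu> t' = polytabloid n \<mu> (w \<circ> t)" by (rule polytabloid_cong)
  then show ?thesis using that w by (simp add: polytabloid_act)
qed

lemma Specht_sum_carrier:
  "carrier (Specht_sum n c) = (\<Pi>\<^sub>E i\<in>(SIGMA \<mu>:partitions n. {..<c \<mu>}). carrier (Specht n (fst i)))"
  "vadd (Specht_sum n c) x y = (\<lambda>i\<in>(SIGMA \<mu>:partitions n. {..<c \<mu>}). x i + y i)"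
  "vscale (Specht_sum n c) r x = (\<lambda>i\<in>(SIGMA \<mu>:partitions n. {..<c \<mu>}). pscale r (x i))"
  "act (Specht_sum n c) w x = (\<lambda>i\<in>(SIGMA \<mu>:partitions n. {..<c \<mu>}). push (map ((`) w)) (x i))"
  unfolding Specht_sum_def direct_sum_def by (auto simp: case_prod_beta intro!: restrict_ext PiE_cong)

text \<open>
  The polytabloids show that no Specht module is zero, so only the empty sum has one element.
\<close>

lemma Specht_sum_trivial:
  assumes iso: "sn_iso n V (Specht_sum n c)" and V: "carrier V = {v}" and \<mu>: "\<mu> \<in> partitions n"
  shows "c \<mu> = 0"
proof (rule ccontr)
  assume "c \<mu> \<noteq> 0"
  define I where "I = (SIGMA \<mu>:partitions n. {..<c \<mu>})"
  have I: "(\<mu>, 0) \<in> I" using \<mu> \<open>c \<mu> \<noteq> 0\<close> by (auto simp: I_def)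
  obtain t where t: "bij_betw t (cells \<mu>) {1..n}" using \<mu> by (rule exists_tableau)
  let ?x = "\<lambda>i\<in>I. 0 :: nat set list \<Rightarrow>\<^sub>0 complex" and ?y = "\<lambda>i\<in>I. if i = (\<mu>, 0) then polytabloid n \<mu> t else 0"
  have "?x \<in> carrier (Specht_sum n c)" "?y \<in> carrier (Specht_sum n c)"
    by (auto simp: Specht_sum_carrier I_def Specht_closed polytabloid_in_Specht[OF t])
  moreover obtain \<phi> where "bij_betw \<phi> (carrier V) (carrier (Specht_sum n c))"
    using iso by (auto simp: sn_iso_def)
  then have "carrier (Specht_sum n c) = {\<phi> v}" using V by (auto simp: bij_betw_def)
  ultimately have "?x = ?y" by simp
  then have "?x (\<mu>, 0) = ?y (\<mu>, 0)" by (rule fun_cong)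
  then show False using I polytabloid_nonzero[OF t] by simp
qed

text \<open>
  Let \<open>\<mu>\<close> be the shape of a summand. The preimage of a polytabloid in that summand is a nonzero vector
  in the two-row permutation module that alternates under the column group of a tableau of shape
  \<open>\<mu>\<close>; this bounds the first row of \<open>\<mu>\<close> from below and its number of rows by two. Conversely the
  component in that summand of the image of a two-row polytabloid \<open>e\<close> is alternating, and it is not
  zero because \<open>e\<close> generates the module; this bounds the first row of \<open>\<mu>\<close> from above. So only the
  given shape occurs. Two copies of it would give two linearly independent alternating vectors in
  the two-row module, against \<open>alternating_two_row_unique\<close>.
\<close>

lemma Specht_sum_two_row:
  assumes n: "1 \<le> n" and k: "2 * k \<le> n"
    and iso: "sn_iso n (Specht n (two_row n k)) (Specht_sum n c)" and \<mu>: "\<mu> \<in> partitions n"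
  shows "c \<mu> = (if \<mu> = two_row n k then 1 else 0)"
proof -
  let ?l = "two_row n k"
  define I where "I = (SIGMA \<mu>:partitions n. {..<c \<mu>})"
  define W where "W = carrier (Specht_sum n c)"
  define V where "V = carrier (Specht n ?l)"
  obtain \<phi> where bij: "bij_betw \<phi> V W"
    and add0: "\<And>x y. x \<in> V \<Longrightarrow> y \<in> V \<Longrightarrow> \<phi> (x + y) = vadd (Specht_sum n c) (\<phi> x) (\<phi> y)"
    and scale0: "\<And>r x. x \<in> V \<Longrightarrow> \<phi> (pscale r x) = vscale (Specht_sum n c) r (\<phi> x)"
    and act0: "\<And>w x. w permutes {1..n} \<Longrightarrow> x \<in> V \<Longrightarrow> \<phi> (push (map ((`) w)) x) = act (Specht_sum n c) w (\<phi> x)"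
    using iso unfolding sn_iso_def V_def W_def Specht_simps by blast
  have add: "\<phi> (x + y) i = \<phi> x i + \<phi> y i" if "x \<in> V" "y \<in> V" "i \<in> I" for x y i
    using that by (simp add: add0 Specht_sum_carrier I_def[symmetric])
  have scale: "\<phi> (pscale r x) i = pscale r (\<phi> x i)" if "x \<in> V" "i \<in> I" for r x i
    using that by (simp add: scale0 Specht_sum_carrier I_def[symmetric])
  have act: "\<phi> (push (map ((`) w)) x) i = push (map ((`) w)) (\<phi> x i)" if "w permutes {1..n}" "x \<in> V" "i \<in> I" for w x i
    using that by (simp add: act0 Specht_sum_carrier I_def[symmetric])
  have W: "W = (\<Pi>\<^sub>E i\<in>I. carrier (Specht n (fst i)))" by (simp add: W_def Specht_sum_carrier I_def)
  have inW: "\<phi> x \<in> W" if "x \<in> V" for x using bij that by (auto dest: bij_betwE)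
  have eqI: "x = y" if "x \<in> V" "y \<in> V" "\<And>i. i \<in> I \<Longrightarrow> \<phi> x i = \<phi> y i" for x y
  proof -
    have "\<phi> x = \<phi> y" using inW[OF that(1)] inW[OF that(2)] that(3) unfolding W by (rule PiE_ext)
    then show ?thesis using bij that by (auto dest: bij_betw_imp_inj_on inj_onD)
  qed
  have zero: "\<phi> 0 i = 0" if "i \<in> I" for i
    using scale[of 0 i 0] that by (simp add: V_def Specht_closed pm.scale_zero_left)
  have Vc: "0 \<in> V" "x \<in> V \<Longrightarrow> y \<in> V \<Longrightarrow> x + y \<in> V" "x \<in> V \<Longrightarrow> pscale r x \<in> V" for x y r
    by (simp_all add: V_def Specht_closed)
  \<comment> \<open>the preimage of a polytabloid placed in one summand\<close>
  have pre: "\<exists>v\<in>V. v \<noteq> 0 \<and> (\<forall>i'\<in>I. \<phi> v i' = (if i' = i then polytabloid n (fst i) t else 0))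
      \<and> alternating n (fst i) t (lookup v)"
    if i: "i \<in> I" and t: "bij_betw t (cells (fst i)) {1..n}" for i t
  proof -
    have "(\<lambda>i'\<in>I. if i' = i then polytabloid n (fst i) t else 0) \<in> W"
      unfolding W
    proof (rule restrict_PiE_iff[THEN iffD2], intro ballI)
      fix i'
      show "(if i' = i then polytabloid n (fst i) t else 0) \<in> carrier (Specht n (fst i'))"
        using polytabloid_in_Specht[OF t] by (cases "i' = i") (simp_all only: if_True if_False refl Specht_closed)
    qed
    then have "(\<lambda>i'\<in>I. if i' = i then polytabloid n (fst i) t else 0) \<in> \<phi> ` V"
      by (simp only: bij_betw_imp_surj_on[OF bij])
    then obtain v where v: "v \<in> V" "\<phi> v = (\<lambda>i'\<in>I. if i' = i then polytabloid n (fst i) t else 0)"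
      by (elim imageE) simp
    have "v \<noteq> 0"
    proof
      assume "v = 0"
      then have "\<phi> v i = 0" using zero[OF i] by simp
      then show False using v(2) i polytabloid_nonzero[OF t] by simp
    qed
    moreover have "alternating n (fst i) t (lookup v)"
    proof (rule alternating_lookup)
      fix \<sigma> assume s: "\<sigma> \<in> column_group n (fst i) t"
      have p: "\<sigma> permutes {1..n}" using s by (rule column_group_permutes)
      show "push (map ((`) \<sigma>)) v = pscale (of_int (sign \<sigma>)) v"
      proof (rule eqI)
        show "push (map ((`) \<sigma>)) v \<in> V" using v(1) p by (simp add: V_def Specht_act_closed)
        show "pscale (of_int (sign \<sigma>)) v \<in> V" using v(1) by (rule Vc)
        fix i' assume "i' \<in> I"
        then show "\<phi> (push (map ((`) \<sigma>)) v) i' = \<phi> (pscale (of_int (sign \<sigma>)) v) i'"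
          using v p by (simp add: act scale polytabloid_column_act[OF s] pm.scale_zero_right)
      qed
    qed
    ultimately show ?thesis using v by auto
  qed
  have l: "?l \<in> partitions n" using n k by (rule two_row_partition)
  obtain t\<^sub>0 where t0: "bij_betw t\<^sub>0 (cells ?l) {1..n}" using l by (rule exists_tableau)
  define e where "e = polytabloid n ?l t\<^sub>0"
  have e: "e \<in> V" unfolding e_def V_def by (rule polytabloid_in_Specht[OF t0])
  have shape: "fst i = ?l" if i: "i \<in> I" for i
  proof -
    let ?m = "fst i"
    have m: "?m \<in> partitions n" using i by (auto simp: I_def)
    then have m': "sorted_wrt (\<ge>) ?m" "?m \<noteq> []" "\<forall>k\<in>set ?m. k > 0" using n by (auto simp: partitions_def)
    obtain t where t: "bij_betw t (cells ?m) {1..n}" using m by (rule exists_tableau)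
    obtain v where v: "v \<in> V" "v \<noteq> 0" "\<phi> v i = polytabloid n ?m t" "alternating n ?m t (lookup v)"
      using pre[OF i t] i by auto
    then obtain s where s: "s \<in> keys v" by (metis ex_in_conv keys_zero poly_mapping_eqI in_keys_iff lookup_zero)
    then obtain t' where t': "bij_betw t' (cells ?l) {1..n}" "s = tabloid ?l t'"
      using keys_Specht v(1) V_def by blast
    have nz: "lookup v (tabloid ?l t') \<noteq> 0" using s t' by (simp add: in_keys_iff)
    have "length ?m \<le> 2"
      using alternating_rows[OF t v(4) t'(1) nz m'(3)] two_row_nth(3)[of n k] by simp
    moreover have "n - k \<le> ?m ! 0"
      using alternating_first_row[OF t v(4) t'(1) nz m'(1,2)] two_row_nth by simp
    moreover have "?m ! 0 \<le> n - k"
    proof -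
      have "\<phi> e i \<noteq> 0"
      proof
        assume z: "\<phi> e i = 0"
        have "V \<subseteq> {x \<in> V. \<phi> x i = 0}"
          unfolding V_def Specht_carrier
        proof (rule pm.span_minimal, unfold Specht_carrier[symmetric] V_def[symmetric])
          show "polytabloid n ?l ` tableaux n ?l \<subseteq> {x \<in> V. \<phi> x i = 0}"
          proof
            fix x assume "x \<in> polytabloid n ?l ` tableaux n ?l"
            then obtain t1 where t1: "bij_betw t1 (cells ?l) {1..n}" "x = polytabloid n ?l t1"
              by (auto simp: tableaux_def)
            obtain w where w: "w permutes {1..n}" "x = push (map ((`) w)) e"
              using polytabloids_transitive[OF t0 t1(1)] t1(2) unfolding e_def by metis
            have "x \<in> V" unfolding V_def t1(2) by (rule polytabloid_in_Specht[OF t1(1)])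
            then show "x \<in> {x \<in> V. \<phi> x i = 0}" using w e i z by (simp add: act)
          qed
          show "pm.subspace {x \<in> V. \<phi> x i = 0}"
            by (rule pm.subspaceI) (auto simp: Vc zero i add scale pm.scale_zero_right)
        qed
        then show False using v polytabloid_nonzero[OF t] by auto
      qed
      then obtain s where s: "s \<in> keys (\<phi> e i)"
        by (metis ex_in_conv poly_mapping_eqI in_keys_iff lookup_zero)
      have "\<phi> e i \<in> carrier (Specht n ?m)" using inW[OF e] i unfolding W by auto
      then obtain t' where t': "bij_betw t' (cells ?m) {1..n}" "s = tabloid ?m t'"
        using keys_Specht s by blast
      have nz: "lookup (\<phi> e i) (tabloid ?m t') \<noteq> 0" using s t' by (simp add: in_keys_iff)
      have alt: "alternating n ?l t\<^sub>0 (lookup (\<phi> e i))"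
      proof (rule alternating_lookup)
        fix \<sigma> assume s: "\<sigma> \<in> column_group n ?l t\<^sub>0"
        have "push (map ((`) \<sigma>)) (\<phi> e i) = \<phi> (push (map ((`) \<sigma>)) e) i"
          using act[OF column_group_permutes[OF s] e i] by simp
        then show "push (map ((`) \<sigma>)) (\<phi> e i) = pscale (of_int (sign \<sigma>)) (\<phi> e i)"
          using polytabloid_column_act[OF s] e i by (simp add: e_def scale)
      qed
      show ?thesis
        using alternating_first_row[OF t0 alt t'(1) nz _ _ m'(2)] l two_row_nth[of n k]
        by (simp add: partitions_def)
    qed
    ultimately show ?thesis using two_row_unique[OF n k m] by simp
  qed
  have le1: "c ?l \<le> 1"
  proof (rule ccontr)
    assume "\<not> c ?l \<le> 1"
    then have I2: "(?l, 0) \<in> I" "(?l, 1) \<in> I" using l by (auto simp: I_def)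
    obtain v0 where v0: "v0 \<in> V" "v0 \<noteq> 0"
        "\<forall>i\<in>I. \<phi> v0 i = (if i = (?l, 0) then e else 0)"
        "alternating n ?l t\<^sub>0 (lookup v0)"
      using pre[OF I2(1), unfolded fst_conv, OF t0] unfolding e_def by blast
    obtain v1 where v1: "v1 \<in> V" "v1 \<noteq> 0"
        "\<forall>i\<in>I. \<phi> v1 i = (if i = (?l, 1) then e else 0)"
        "alternating n ?l t\<^sub>0 (lookup v1)"
      using pre[OF I2(2), unfolded fst_conv, OF t0] unfolding e_def by blast
    have multiple: "v = pscale (lookup v (tabloid ?l t\<^sub>0)) e"
      if "v \<in> V" "alternating n ?l t\<^sub>0 (lookup v)" for v
    proof (rule poly_mapping_eqI)
      fix s
      show "lookup v s = lookup (pscale (lookup v (tabloid ?l t\<^sub>0)) e) s"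
      proof (cases "\<exists>t'. bij_betw t' (cells ?l) {1..n} \<and> s = tabloid ?l t'")
        case True
        then show ?thesis
          using alternating_two_row_unique[OF t0 that(2) k] by (auto simp: e_def)
      next
        case False
        then have "s \<notin> keys v" "s \<notin> keys e"
          using keys_Specht that(1) e unfolding V_def by blast+
        then show ?thesis by (simp add: in_keys_iff)
      qed
    qed
    define a b where "a = lookup v0 (tabloid ?l t\<^sub>0)" and "b = lookup v1 (tabloid ?l t\<^sub>0)"
    have ve: "v0 = pscale a e" "v1 = pscale b e" unfolding a_def b_def
      using multiple[OF v0(1,4)] multiple[OF v1(1,4)] .
    have v0_1: "\<phi> v0 (?l, 1) = 0" and v1_1: "\<phi> v1 (?l, 1) = e"
      using v0(3) v1(3) I2 by simp_all
    have "a \<noteq> 0" using ve(1) v0(2) pm.scale_zero_left[of e] by metis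
    have "pscale a (\<phi> e (?l, 1)) = 0"
      using v0_1 scale[OF e I2(2), of a] unfolding ve(1)[symmetric] by simp
    then have "\<phi> e (?l, 1) = 0" using \<open>a \<noteq> 0\<close> by (simp add: pm.scale_eq_0_iff)
    then have "\<phi> v1 (?l, 1) = 0"
      using scale[OF e I2(2), of b] unfolding ve(2)[symmetric] by (simp add: pm.scale_zero_right)
    then show False using v1_1 polytabloid_nonzero[OF t0] by (simp add: e_def)
  qed
  have ge1: "c ?l \<ge> 1"
  proof (rule ccontr)
    assume "\<not> c ?l \<ge> 1"
    then have "I = {}" using shape by (fastforce simp: I_def)
    have "e = 0" by (rule eqI[OF e Vc(1)]) (simp add: \<open>I = {}\<close>)
    then show False using polytabloid_nonzero[OF t0] by (simp add: e_def)
  qed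
  show ?thesis
  proof (cases "\<mu> = ?l")
    case True then show ?thesis using le1 ge1 by simp
  next
    case False
    have "c \<mu> = 0"
    proof (rule ccontr)
      assume "c \<mu> \<noteq> 0"
      then have "(\<mu>, 0) \<in> I" using \<mu> by (simp add: I_def)
      then show False using shape False by fastforce
    qed
    then show ?thesis using False by simp
  qed
qed

lemma Specht_sn_iso_sum:
  assumes "\<mu> \<in> partitions n"
  shows "sn_iso n (Specht n \<mu>) (Specht_sum n (\<lambda>\<nu>. if \<nu> = \<mu> then 1 else 0))"
proof -
  have I: "(SIGMA \<nu>:partitions n. {..<if \<nu> = \<mu> then 1 else 0}) = {(\<mu>, 0::nat)}"
    using assms by (auto split: if_splits)
  show ?thesis
    unfolding sn_iso_def
  proof (intro exI[of _ "\<lambda>v. \<lambda>i\<in>{(\<mu>, 0::nat)}. v"] conjI ballI allI impI)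
    show "bij_betw (\<lambda>v. \<lambda>i\<in>{(\<mu>, 0::nat)}. v) (carrier (Specht n \<mu>))
       (carrier (Specht_sum n (\<lambda>\<nu>. if \<nu> = \<mu> then 1 else 0)))"
    proof (rule bij_betw_byWitness[where f' = "\<lambda>x. x (\<mu>, 0)"])
      show "\<forall>x\<in>carrier (Specht_sum n (\<lambda>\<nu>. if \<nu> = \<mu> then 1 else 0)). (\<lambda>i\<in>{(\<mu>, 0)}. x (\<mu>, 0)) = x"
        unfolding Specht_sum_carrier I by (auto simp: fun_eq_iff PiE_def extensional_def restrict_def)
      show "(\<lambda>v. \<lambda>i\<in>{(\<mu>, 0)}. v) ` carrier (Specht n \<mu>)
          \<subseteq> carrier (Specht_sum n (\<lambda>\<nu>. if \<nu> = \<mu> then 1 else 0))"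
        unfolding Specht_sum_carrier I by (rule image_subsetI, rule restrict_PiE_iff[THEN iffD2]) simp
      show "(\<lambda>x. x (\<mu>, 0)) ` carrier (Specht_sum n (\<lambda>\<nu>. if \<nu> = \<mu> then 1 else 0))
          \<subseteq> carrier (Specht n \<mu>)"
        unfolding Specht_sum_carrier I by (rule image_subsetI) (metis PiE_mem fst_conv singletonI)
    qed simp
  qed (auto simp: Specht_sum_carrier I intro!: restrict_ext)
qed

text \<open>
  The definite description in the definition of \<open>Frob\<close> is meaningful only once the multiplicities are
  known to be unique.
\<close>

lemma Frob_eqI:
  assumes "sn_iso n V (Specht_sum n c)"
    and unique: "\<And>c'. sn_iso n V (Specht_sum n c') \<Longrightarrow> \<forall>\<mu>\<in>partitions n. c' \<mu> = c \<mu>"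
  shows "Frob n V = (\<Sum>\<mu>\<in>partitions n. (\<lambda>\<alpha>. int (c \<mu>) * schur \<mu> \<alpha>))"
  unfolding Frob_def
proof (rule the_equality)
  fix F assume "\<exists>c. sn_iso n V (Specht_sum n c) \<and> F = (\<Sum>\<mu>\<in>partitions n. (\<lambda>\<alpha>. int (c \<mu>) * schur \<mu> \<alpha>))"
  then show "F = (\<Sum>\<mu>\<in>partitions n. (\<lambda>\<alpha>. int (c \<mu>) * schur \<mu> \<alpha>))"
    using unique by (auto intro!: sum.cong)
qed (use assms(1) in blast)

lemma Frob_two_row:
  assumes n: "1 \<le> n" and k: "2 * k \<le> n" and iso: "sn_iso n (Specht n (two_row n k)) V"
  shows "Frob n V = schur (two_row n k)"
proof -
  let ?c = "\<lambda>\<nu>. if \<nu> = two_row n k then 1 else 0 :: nat"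
  have "sn_iso n V (Specht n (two_row n k))"
    using iso by (rule sn_iso_sym) (simp_all add: Specht_closed Specht_act_closed)
  then have "sn_iso n V (Specht_sum n ?c)"
    using Specht_sn_iso_sum[OF two_row_partition[OF n k]] by (rule sn_iso_trans)
  then have "Frob n V = (\<Sum>\<mu>\<in>partitions n. (\<lambda>\<alpha>. int (?c \<mu>) * schur \<mu> \<alpha>))"
  proof (rule Frob_eqI)
    fix c assume "sn_iso n V (Specht_sum n c)"
    with iso have "sn_iso n (Specht n (two_row n k)) (Specht_sum n c)" by (rule sn_iso_trans)
    then show "\<forall>\<mu>\<in>partitions n. c \<mu> = ?c \<mu>" using Specht_sum_two_row[OF n k] by blast
  qed
  also have "\<dots> = (\<Sum>\<mu>\<in>partitions n. if \<mu> = two_row n k then schur \<mu> else 0)"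
    by (intro sum.cong refl) (auto simp: fun_eq_iff)
  also have "\<dots> = schur (two_row n k)"
    using two_row_partition[OF n k] by simp
  finally show ?thesis .
qed

lemma Frob_zero:
  assumes V: "carrier V = {v}" and add: "vadd V v v = v" and scale: "\<And>c. vscale V c v = v"
    and act: "\<And>w. w permutes {1..n} \<Longrightarrow> act V w v = v"
  shows "Frob n V = 0"
proof -
  have "sn_iso n V (Specht_sum n (\<lambda>_. 0))"
    unfolding sn_iso_def
    \<comment> \<open>the only element of a direct sum over the empty set\<close>
    by (rule exI[of _ "\<lambda>_ _. undefined"])
      (auto simp: Specht_sum_carrier V bij_betw_def fun_eq_iff)
  then have "Frob n V = (\<Sum>\<mu>\<in>partitions n. (\<lambda>\<alpha>. int 0 * schur \<mu> \<alpha>))"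
    using Specht_sum_trivial[OF _ V] by (intro Frob_eqI) auto
  then show ?thesis by (simp add: fun_eq_iff zero_fun_def[symmetric])
qed

section \<open>Functions on the balanced slice\<close>

text \<open>
  The sets \<open>B\<close> and \<open>{1..2 * a} - B\<close> stand for the same set partition. Working with one half breaks
  this symmetry, which keeps products such as \<open>eps x\<close> available that are not functions of the
  partition; only even products matter in the end.
\<close>

definition halves :: "nat \<Rightarrow> nat set set" where
  "halves a = {B. B \<subseteq> {1..2 * a} \<and> card B = a}"

definition eps :: "nat \<Rightarrow> nat set \<Rightarrow> complex" where
  "eps x B = (if x \<in> B then - 1 else 1)"

definition chi :: "nat set \<Rightarrow> nat set \<Rightarrow> complex" where
  "chi U B = (\<Prod>x\<in>U. eps x B)"

abbreviation (input) fscale :: "complex \<Rightarrow> ('b \<Rightarrow> complex) \<Rightarrow> ('b \<Rightarrow> complex)" where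
  "fscale c f \<equiv> (\<lambda>B. c * f B)"

interpretation fn: vector_space "fscale :: complex \<Rightarrow> ('b \<Rightarrow> complex) \<Rightarrow> _"
  by unfold_locales (auto simp: fun_eq_iff algebra_simps)

lemma sum_fun_apply: "(\<Sum>i\<in>A. f i) x = (\<Sum>i\<in>A. f i x)" for f :: "'i \<Rightarrow> 'b \<Rightarrow> complex"
  by (induction A rule: infinite_finite_induct) auto

text \<open>
  Functions on \<open>halves a\<close> that are polynomials in the signs \<open>eps x\<close> of degree less than \<open>j\<close> with all
  degrees of the parity of \<open>j\<close>. The functions that vanish on halves are added so that functions on
  all sets can be used as representatives.
\<close>

definition low :: "nat \<Rightarrow> nat \<Rightarrow> (nat set \<Rightarrow> complex) set" where
  "low a j = fn.span ({chi U | U. U \<subseteq> {1..2 * a} \<and> card U < j \<and> even (card U + j)}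
     \<union> {f. \<forall>B\<in>halves a. f B = 0})"

lemma low_subspace: "fn.subspace (low a j)"
  by (simp add: low_def fn.subspace_span)

lemmas low_add = fn.subspace_add[OF low_subspace]
  and low_diff = fn.subspace_diff[OF low_subspace]
  and low_scale = fn.subspace_scale[OF low_subspace]
  and low_zero = fn.subspace_0[OF low_subspace]
  and low_sum = fn.subspace_sum[OF low_subspace]

lemma low_chi: "U \<subseteq> {1..2 * a} \<Longrightarrow> card U < j \<Longrightarrow> even (card U + j) \<Longrightarrow> chi U \<in> low a j"
  unfolding low_def by (rule fn.span_base) auto

lemma low_vanishing: "(\<And>B. B \<in> halves a \<Longrightarrow> f B = 0) \<Longrightarrow> f \<in> low a j"
  unfolding low_def by (rule fn.span_base) auto

lemma low_least:
  assumes "fn.subspace D"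
    and "\<And>U. U \<subseteq> {1..2 * a} \<Longrightarrow> card U < j \<Longrightarrow> even (card U + j) \<Longrightarrow> chi U \<in> D"
    and "\<And>f. (\<And>B. B \<in> halves a \<Longrightarrow> f B = 0) \<Longrightarrow> f \<in> D"
  shows "low a j \<subseteq> D"
  unfolding low_def using assms by (intro fn.span_minimal) auto

lemma low_cong:
  assumes "f \<in> low a j" and "\<And>B. B \<in> halves a \<Longrightarrow> f B = g B"
  shows "g \<in> low a j"
proof -
  have "g - f \<in> low a j" using assms(2) by (intro low_vanishing) simp
  then have "f + (g - f) \<in> low a j" using assms(1) by (intro low_add)
  then show ?thesis by simp
qed

lemma low_mono: "low a j \<subseteq> low a (j + 2)"
proof (rule low_least[OF low_subspace])
  fix U assume "U \<subseteq> {1..2 * a}" "card U < j" "even (card U + j)"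
  then show "chi U \<in> low a (j + 2)" by (intro low_chi) auto
qed (rule low_vanishing)

lemma eps_square: "eps x B * eps x B = 1"
  by (simp add: eps_def)

lemma chi_insert: "finite U \<Longrightarrow> x \<notin> U \<Longrightarrow> chi (insert x U) B = eps x B * chi U B"
  by (simp add: chi_def)

lemma eps_chi: "finite U \<Longrightarrow> x \<in> U \<Longrightarrow> eps x B * chi U B = chi (U - {x}) B"
  using eps_square[of x B] by (simp add: chi_def prod.remove mult.assoc[symmetric])

lemma low_eps:
  assumes x: "x \<in> {1..2 * a}" and f: "f \<in> low a j"
  shows "(\<lambda>B. eps x B * f B) \<in> low a (Suc j)"
proof -
  have "low a j \<subseteq> {f. (\<lambda>B. eps x B * f B) \<in> low a (Suc j)}"
  proof (rule low_least)
    show "fn.subspace {f. (\<lambda>B. eps x B * f B) \<in> low a (Suc j)}"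
    proof (rule fn.subspaceI)
      show "0 \<in> {f. (\<lambda>B. eps x B * f B) \<in> low a (Suc j)}"
        by (auto intro: low_vanishing)
    next
      fix f g assume "f \<in> {f. (\<lambda>B. eps x B * f B) \<in> low a (Suc j)}" "g \<in> {f. (\<lambda>B. eps x B * f B) \<in> low a (Suc j)}"
      then have "(\<lambda>B. eps x B * f B) + (\<lambda>B. eps x B * g B) \<in> low a (Suc j)" by (auto intro: low_add)
      then show "f + g \<in> {f. (\<lambda>B. eps x B * f B) \<in> low a (Suc j)}"
        by (auto elim!: low_cong simp: algebra_simps)
    next
      fix c f assume "f \<in> {f. (\<lambda>B. eps x B * f B) \<in> low a (Suc j)}"
      then have "fscale c (\<lambda>B. eps x B * f B) \<in> low a (Suc j)" by (auto intro: low_scale)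
      then show "fscale c f \<in> {f. (\<lambda>B. eps x B * f B) \<in> low a (Suc j)}"
        by (auto elim!: low_cong simp: algebra_simps)
    qed
  next
    fix U assume U: "U \<subseteq> {1..2 * a}" "card U < j" "even (card U + j)"
    have fin: "finite U" using U(1) finite_subset by blast
    show "chi U \<in> {f. (\<lambda>B. eps x B * f B) \<in> low a (Suc j)}"
    proof (cases "x \<in> U")
      case True
      then have "card U = Suc (card (U - {x}))" using fin by (metis card.remove)
      then have "chi (U - {x}) \<in> low a (Suc j)" using U by (intro low_chi) auto
      then show ?thesis by (auto elim!: low_cong simp: eps_chi fin True)
    next
      case False
      then have "chi (insert x U) \<in> low a (Suc j)" using U x fin by (intro low_chi) auto
      then show ?thesis by (auto elim!: low_cong simp: chi_insert fin False)
    qed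
  next
    fix f :: "nat set \<Rightarrow> complex" assume "\<And>B. B \<in> halves a \<Longrightarrow> f B = 0"
    then show "f \<in> {f. (\<lambda>B. eps x B * f B) \<in> low a (Suc j)}"
      by (auto intro: low_vanishing)
  qed
  then show ?thesis using f by blast
qed

subsection \<open>Reduction to products of differences\<close>

definition pairdiff :: "(nat \<times> nat) list \<Rightarrow> nat set \<Rightarrow> complex" where
  "pairdiff ps B = (\<Prod>p\<leftarrow>ps. eps (fst p) B - eps (snd p) B)"

abbreviation entries :: "(nat \<times> nat) list \<Rightarrow> nat list" where
  "entries ps \<equiv> map fst ps @ map snd ps"

lemma low_pairdiff:
  assumes "f \<in> low a j" "set (entries ps) \<subseteq> {1..2 * a}"
  shows "(\<lambda>B. pairdiff ps B * f B) \<in> low a (j + length ps)"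
  using assms(2)
proof (induction ps)
  case Nil
  then show ?case using assms(1) by (simp add: pairdiff_def)
next
  case (Cons p ps)
  let ?g = "\<lambda>B. pairdiff ps B * f B"
  have "?g \<in> low a (j + length ps)" using Cons by simp
  then have "(\<lambda>B. eps (fst p) B * ?g B) - (\<lambda>B. eps (snd p) B * ?g B) \<in> low a (Suc (j + length ps))"
    using Cons.prems by (intro low_diff low_eps) auto
  then show ?case by (auto elim!: low_cong simp: pairdiff_def algebra_simps)
qed

lemma sum_pairdiff_zero: "(\<Sum>x\<leftarrow>entries ps. eps x B) * pairdiff ps B = 0"
proof (induction ps)
  case Nil
  then show ?case by simp
next
  case (Cons p ps)
  have "(eps (fst p) B + eps (snd p) B) * (eps (fst p) B - eps (snd p) B) = 0"
    by (simp add: eps_def)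
  moreover have "(\<Sum>x\<leftarrow>entries (p # ps). eps x B) * pairdiff (p # ps) B
    = (eps (fst p) B + eps (snd p) B) * (eps (fst p) B - eps (snd p) B) * pairdiff ps B
     + (eps (fst p) B - eps (snd p) B) * ((\<Sum>x\<leftarrow>entries ps. eps x B) * pairdiff ps B)"
    by (simp add: pairdiff_def algebra_simps)
  ultimately show ?case using Cons by (simp only: mult_zero_left mult_zero_right add_0)
qed

lemma sum_eps_halves:
  assumes "B \<in> halves a"
  shows "(\<Sum>x\<in>{1..2 * a}. eps x B) = 0"
proof -
  have B: "B \<subseteq> {1..2 * a}" "card B = a" using assms by (auto simp: halves_def)
  have "(\<Sum>x\<in>{1..2 * a}. eps x B) = (\<Sum>x\<in>{1..2 * a} - B. eps x B) + (\<Sum>x\<in>B. eps x B)"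
    using B by (intro sum.subset_diff) auto
  also have "\<dots> = of_nat (card ({1..2 * a} - B)) - of_nat (card B)"
    by (simp add: eps_def)
  also have "card ({1..2 * a} - B) = a"
    using B by (simp add: card_Diff_subset finite_subset)
  finally show ?thesis using B by simp
qed

text \<open>
  Write \<open>S = insert x S'\<close> and \<open>G = pairdiff ps * chi S'\<close>. On halves the sum of all \<open>eps y\<close> is zero,
  and the sum over the entries of \<open>ps\<close> is killed by \<open>G\<close>, since
  \<open>(eps b + eps c) * (eps b - eps c) = 0\<close>. If \<open>f\<close> is the number of points \<open>y\<close> outside of \<open>S\<close> and \<open>ps\<close>,
  adding up \<open>(eps x - eps y) * G\<close> over these points therefore gives \<open>(f + 1) * eps x * G\<close> plus the
  sum of \<open>eps y * G\<close> over \<open>y \<in> S'\<close>, and the latter terms have lower degree because \<open>y\<close> cancels. The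
  factor \<open>f + 1\<close> is never zero, so the claim for \<open>ps\<close> with the pair \<open>(x, y)\<close> added and \<open>S'\<close> in place
  of \<open>S\<close> implies the one for \<open>ps\<close> and \<open>S\<close>.
\<close>

lemma chi_reduction:
  assumes D: "fn.subspace D" "low a k \<subseteq> D"
    and prods: "\<And>ps. length ps = k \<Longrightarrow> distinct (entries ps) \<Longrightarrow> set (entries ps) \<subseteq> {1..2 * a}
        \<Longrightarrow> pairdiff ps \<in> D"
    and S: "S \<subseteq> {1..2 * a}" and ps: "distinct (entries ps)" "set (entries ps) \<subseteq> {1..2 * a}"
    and disj: "S \<inter> set (entries ps) = {}" and k: "length ps + card S = k"
  shows "(\<lambda>B. pairdiff ps B * chi S B) \<in> D"
  using S ps disj k
proof (induction "card S" arbitrary: S ps)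
  case 0
  then have "S = {}" by (metis card_0_eq finite_atLeastAtMost finite_subset)
  then show ?case using prods[of ps] 0 by (simp add: chi_def)
next
  case (Suc m)
  have Dcong: "g \<in> D" if "f \<in> D" "\<And>B. B \<in> halves a \<Longrightarrow> f B = g B" for f g
  proof -
    have "g - f \<in> low a k" using that(2) by (intro low_vanishing) simp
    then have "f + (g - f) \<in> D" using that(1) D by (intro fn.subspace_add) auto
    then show ?thesis by simp
  qed
  have finS: "finite S" using Suc.prems(1) finite_subset by blast
  obtain x where x: "x \<in> S" using Suc.hyps(2) by fastforce
  define S' where "S' = S - {x}"
  have S': "x \<notin> S'" "S = insert x S'" "finite S'" "card S' = m" "S' \<subseteq> {1..2 * a}" "x \<in> {1..2 * a}"
    using x finS Suc.hyps(2) Suc.prems(1) by (auto simp: S'_def)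
  define P where "P = set (entries ps)"
  define free where "free = {1..2 * a} - P - S"
  define G where "G B = pairdiff ps B * chi S' B" for B
  have free_in: "(\<lambda>B. (eps x B - eps y B) * G B) \<in> D" if y: "y \<in> free" for y
  proof -
    have "(\<lambda>B. pairdiff ((x, y) # ps) B * chi S' B) \<in> D"
    proof (rule Suc.hyps(1))
      show "m = card S'" "S' \<subseteq> {1..2 * a}" using S' by auto
      show "distinct (entries ((x, y) # ps))" "set (entries ((x, y) # ps)) \<subseteq> {1..2 * a}"
        "S' \<inter> set (entries ((x, y) # ps)) = {}"
        using Suc.prems y S' by (auto simp: free_def P_def)
      show "length ((x, y) # ps) + card S' = k" using Suc.prems(5) Suc.hyps(2) S'(4) by simp
    qed
    then show ?thesis by (simp add: G_def pairdiff_def mult.assoc)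
  qed
  have S'_in: "(\<lambda>B. eps y B * G B) \<in> D" if y: "y \<in> S'" for y
  proof -
    have c: "m = Suc (card (S' - {y}))" using card.remove[OF S'(3) y] S'(4) by simp
    then have "k = (card (S' - {y}) + 2) + length ps" using Suc.prems(5) Suc.hyps(2) by simp
    moreover have "(\<lambda>B. pairdiff ps B * chi (S' - {y}) B) \<in> low a ((card (S' - {y}) + 2) + length ps)"
      using S' Suc.prems(3) by (intro low_pairdiff low_chi) auto
    ultimately have "(\<lambda>B. pairdiff ps B * chi (S' - {y}) B) \<in> D" using D(2) by auto
    moreover have "eps y B * G B = pairdiff ps B * chi (S' - {y}) B" for B
      unfolding G_def eps_chi[OF S'(3) y, symmetric] by (rule mult.left_commute)
    ultimately show ?thesis by simp
  qed
  \<comment> \<open>on halves \<open>R\<close> is the positive multiple \<open>Suc (card free)\<close> of the function in question\<close>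
  define R where "R = (\<Sum>y\<in>free. (\<lambda>B. (eps x B - eps y B) * G B)) - (\<Sum>y\<in>S'. (\<lambda>B. eps y B * G B))"
  have "R \<in> D"
    unfolding R_def using free_in S'_in D(1) by (intro fn.subspace_diff fn.subspace_sum) auto
  then have RD: "fscale (1 / of_nat (Suc (card free))) R \<in> D"
    using D(1) by (rule fn.subspace_scale[rotated])
  show ?case
  proof (rule Dcong[OF RD])
    fix B assume B: "B \<in> halves a"
    have split: "{1..2 * a} = insert x (free \<union> (S' \<union> P))"
      using S' Suc.prems by (auto simp: free_def P_def)
    have "(\<Sum>y\<in>P. eps y B) * G B = 0"
      using sum_pairdiff_zero[where ps = ps and B = B]
      unfolding P_def G_def sum_list_distinct_conv_sum_set[OF Suc.prems(2)] mult.assoc[symmetric]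
      by (simp only: mult_zero_left)
    moreover have "0 = (\<Sum>y\<in>{1..2 * a}. eps y B)"
      using sum_eps_halves[OF B] by (rule sym)
    moreover have "(\<Sum>y\<in>{1..2 * a}. eps y B)
        = eps x B + ((\<Sum>y\<in>free. eps y B) + ((\<Sum>y\<in>S'. eps y B) + (\<Sum>y\<in>P. eps y B)))"
    proof -
      have fin: "finite free" "finite S'" "finite P" using S' by (simp_all add: free_def P_def)
      have disj: "x \<notin> free \<union> (S' \<union> P)" "free \<inter> (S' \<union> P) = {}" "S' \<inter> P = {}"
        using S' Suc.prems(4) unfolding free_def P_def by blast+
      show ?thesis
        unfolding split using fin disj by (simp add: sum.union_disjoint)
    qed
    moreover have "e * g = - f * g - q * g" if "p * g = 0" "0 = s" "s = e + (f + (q + p))" for e f g p q s :: complex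
    proof -
      have "e * g + (f * g + (q * g + p * g)) = 0"
        using that(2,3) by (metis distrib_right mult_zero_left)
      then have "e * g + (f * g + q * g) = 0" using that(1) by simp
      then have "e * g = - (f * g + q * g)" by (rule eq_neg_iff_add_eq_0[THEN iffD2])
      then show ?thesis by simp
    qed
    ultimately have eq: "eps x B * G B = - (\<Sum>y\<in>free. eps y B) * G B - (\<Sum>y\<in>S'. eps y B) * G B"
      by blast
    have "R B = (\<Sum>y\<in>free. (eps x B - eps y B) * G B) - (\<Sum>y\<in>S'. eps y B * G B)"
      by (simp add: R_def sum_fun_apply)
    also have "\<dots> = of_nat (card free) * (eps x B * G B) - (\<Sum>y\<in>free. eps y B) * G B - (\<Sum>y\<in>S'. eps y B) * G B"
      by (simp add: left_diff_distrib sum_subtractf sum_distrib_right)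
    also have "\<dots> = of_nat (Suc (card free)) * (eps x B * G B)"
    proof -
      have "c * X - f * g - q * g = (1 + c) * X" if "X = - f * g - q * g" for c X f g q :: complex
        unfolding that by (simp add: algebra_simps)
      from this[OF eq] show ?thesis by simp
    qed
    finally have RB: "R B = of_nat (Suc (card free)) * (eps x B * G B)" .
    have "1 / c * (c * X) = X" if "c \<noteq> 0" for c X :: complex
      using that by simp
    from this[OF of_nat_neq_0[of "card free"]] have "1 / of_nat (Suc (card free)) * R B = eps x B * G B"
      unfolding RB .
    also have "\<dots> = pairdiff ps B * chi S B"
      unfolding G_def S'(2) chi_insert[OF S'(3,1)] by (rule mult.left_commute)
    finally show "1 / of_nat (Suc (card free)) * R B = pairdiff ps B * chi S B" .
  qed
qed

lemma low_step:
  assumes D: "fn.subspace D" "low a k \<subseteq> D"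
    and prods: "\<And>ps. length ps = k \<Longrightarrow> distinct (entries ps) \<Longrightarrow> set (entries ps) \<subseteq> {1..2 * a}
        \<Longrightarrow> pairdiff ps \<in> D"
  shows "low a (k + 2) \<subseteq> D"
proof (rule low_least[OF D(1)])
  fix U assume U: "U \<subseteq> {1..2 * a}" "card U < k + 2" "even (card U + (k + 2))"
  then have "card U < k \<or> card U = k" by presburger
  then show "chi U \<in> D"
  proof
    assume "card U < k"
    then show ?thesis using low_chi[of U a k] U D(2) by auto
  next
    assume "card U = k"
    then have "(\<lambda>B. pairdiff [] B * chi U B) \<in> D"
      using U by (intro chi_reduction[OF D prods]) auto
    then show ?thesis by (simp add: pairdiff_def)
  qed
next
  fix f :: "nat set \<Rightarrow> complex" assume "\<And>B. B \<in> halves a \<Longrightarrow> f B = 0"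
  then show "f \<in> D" using low_vanishing[of a f k] D(2) by blast
qed

text \<open>
  There is no room for \<open>k\<close> disjoint pairs in \<open>{1..2 * a}\<close>, so \<open>low_step\<close> applies with \<open>D = low a k\<close>.
\<close>

lemma low_stable:
  assumes "k > a"
  shows "low a (k + 2) \<subseteq> low a k"
proof (rule low_step[OF low_subspace order_refl])
  fix ps :: "(nat \<times> nat) list"
  assume "length ps = k" "distinct (entries ps)" "set (entries ps) \<subseteq> {1..2 * a}"
  then have "2 * k \<le> card {1..2 * a}"
    using card_mono[of "{1..2 * a}" "set (entries ps)"] distinct_card[of "entries ps"] by simp
  with assms have False by simp
  then show "pairdiff ps \<in> low a k" ..
qed

subsection \<open>Translation by permutations\<close>

lemma halves_image:
  assumes w: "w permutes {1..2 * a}"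
  shows "(`) w ` halves a = halves a"
proof -
  have sub: "(`) w ` halves a \<subseteq> halves a" if w: "w permutes {1..2 * a}" for w
  proof
    fix C assume "C \<in> (`) w ` halves a"
    then obtain B where B: "B \<subseteq> {1..2 * a}" "card B = a" "C = w ` B" by (auto simp: halves_def)
    have "card C = a" using B permutes_inj_on[OF w] by (simp add: card_image)
    moreover have "C \<subseteq> {1..2 * a}" using B permutes_image[OF w] by blast
    ultimately show "C \<in> halves a" by (simp add: halves_def)
  qed
  have "halves a \<subseteq> (`) w ` halves a"
  proof
    fix B assume B: "B \<in> halves a"
    then have "pinv w ` B \<in> halves a" using sub[OF permutes_inv[OF w]] by blast
    moreover have "B = w ` pinv w ` B" using permutes_surj[OF w] by (simp add: image_f_inv_f)
    ultimately show "B \<in> (`) w ` halves a" by blast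
  qed
  then show ?thesis using sub[OF w] by blast
qed

lemma pinv_image_halves: "w permutes {1..2 * a} \<Longrightarrow> B \<in> halves a \<Longrightarrow> pinv w ` B \<in> halves a"
  using halves_image[OF permutes_inv] by blast

lemma chi_pinv:
  assumes "w permutes {1..n}"
  shows "chi U (pinv w ` B) = chi (w ` U) B"
proof -
  have "x \<in> pinv w ` B \<longleftrightarrow> w x \<in> B" for x
    using inj_image_mem_iff[OF permutes_inj[OF permutes_inv[OF assms]], of "w x" B]
    by (simp only: permutes_inverses[OF assms])
  then have "eps x (pinv w ` B) = eps (w x) B" for x
    by (simp add: eps_def)
  moreover have "inj_on w U" using assms by (rule permutes_inj_on)
  ultimately show ?thesis
    unfolding chi_def by (simp only: prod.reindex comp_def)
qed

lemma low_translate: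
  assumes w: "w permutes {1..2 * a}" and f: "f \<in> low a j"
  shows "(\<lambda>B. f (pinv w ` B)) \<in> low a j"
proof -
  have "low a j \<subseteq> {f. (\<lambda>B. f (pinv w ` B)) \<in> low a j}"
  proof (rule low_least)
    show "fn.subspace {f. (\<lambda>B. f (pinv w ` B)) \<in> low a j}"
    proof (rule fn.subspaceI)
      show "0 \<in> {f. (\<lambda>B. f (pinv w ` B)) \<in> low a j}" by (auto intro: low_vanishing)
    next
      fix f g assume "f \<in> {f. (\<lambda>B. f (pinv w ` B)) \<in> low a j}" "g \<in> {f. (\<lambda>B. f (pinv w ` B)) \<in> low a j}"
      then show "f + g \<in> {f. (\<lambda>B. f (pinv w ` B)) \<in> low a j}"
        using low_add[of "\<lambda>B. f (pinv w ` B)" a j "\<lambda>B. g (pinv w ` B)"] by (simp add: plus_fun_def)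
    next
      fix c f assume "f \<in> {f. (\<lambda>B. f (pinv w ` B)) \<in> low a j}"
      then show "fscale c f \<in> {f. (\<lambda>B. f (pinv w ` B)) \<in> low a j}"
        using low_scale[of "\<lambda>B. f (pinv w ` B)" a j c] by simp
    qed
  next
    fix U assume U: "U \<subseteq> {1..2 * a}" "card U < j" "even (card U + j)"
    have "(\<lambda>B. chi U (pinv w ` B)) = chi (w ` U)" using chi_pinv[OF w] by auto
    moreover have "card (w ` U) = card U" using permutes_inj_on[OF w] by (simp add: card_image)
    moreover have "w ` U \<subseteq> {1..2 * a}" using U permutes_image[OF w] by blast
    ultimately show "chi U \<in> {f. (\<lambda>B. f (pinv w ` B)) \<in> low a j}"
      using U by (simp add: low_chi)
  next
    fix f :: "nat set \<Rightarrow> complex" assume "\<And>B. B \<in> halves a \<Longrightarrow> f B = 0"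
    then show "f \<in> {f. (\<lambda>B. f (pinv w ` B)) \<in> low a j}"
      using pinv_image_halves[OF w] by (auto intro!: low_vanishing)
  qed
  then show ?thesis using f by blast
qed

lemma sum_halves_translate:
  assumes w: "w permutes {1..2 * a}"
  shows "(\<Sum>B\<in>halves a. f (pinv w ` B)) = (\<Sum>B\<in>halves a. f B)"
proof -
  have "inj_on ((`) (pinv w)) (halves a)"
    using permutes_inj[OF permutes_inv[OF w]] by (auto intro!: inj_onI simp: inj_image_eq_iff)
  then have "(\<Sum>B\<in>(`) (pinv w) ` halves a. f B) = (\<Sum>B\<in>halves a. f (pinv w ` B))"
    by (simp add: sum.reindex)
  then show ?thesis by (simp only: halves_image[OF permutes_inv[OF w]])
qed

subsection \<open>The function attached to a combination of tabloids\<close>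

text \<open>
  The equivariant map from the permutation module on tabloids to functions that turns the second row
  \<open>S\<close> of a tabloid into \<open>chi S\<close>.
\<close>

definition hat :: "nat \<Rightarrow> (nat set list \<Rightarrow>\<^sub>0 complex) \<Rightarrow> nat set \<Rightarrow> complex" where
  "hat n v B = (\<Sum>s\<in>keys v. lookup v s * chi (lower n s) B)"

lemma hat_superset:
  assumes "finite A" "keys v \<subseteq> A"
  shows "hat n v B = (\<Sum>s\<in>A. lookup v s * chi (lower n s) B)"
  unfolding hat_def using assms
  by (intro sum.mono_neutral_left) (auto simp: in_keys_iff)

lemma hat_zero: "hat n 0 = 0"
  by (simp add: hat_def fun_eq_iff)

lemma hat_add: "hat n (v + w) = hat n v + hat n w"
proof
  fix B
  let ?A = "keys v \<union> keys w"
  have "hat n (v + w) B = (\<Sum>s\<in>?A. lookup (v + w) s * chi (lower n s) B)"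
    by (rule hat_superset) (use keys_add[of v w] in auto)
  also have "\<dots> = hat n v B + hat n w B"
    by (simp add: hat_superset[of ?A v] hat_superset[of ?A w] lookup_add distrib_right sum.distrib)
  finally show "hat n (v + w) B = (hat n v + hat n w) B" by simp
qed

lemma hat_pscale: "hat n (pscale c v) = fscale c (hat n v)"
proof
  fix B
  have "hat n (pscale c v) B
      = (\<Sum>s\<in>keys v. lookup (pscale c v) s * chi (lower n s) B)"
    by (rule hat_superset) (auto simp: in_keys_iff)
  then show "hat n (pscale c v) B = c * hat n v B"
    by (simp add: hat_def sum_distrib_left mult.assoc)
qed

lemma hat_sum: "hat n (\<Sum>i\<in>A. v i) = (\<Sum>i\<in>A. hat n (v i))"
  by (induction A rule: infinite_finite_induct) (simp_all add: hat_zero hat_add)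

lemma hat_single: "hat n (single s c) B = c * chi (lower n s) B"
  by (simp add: hat_def)

lemma hat_push:
  assumes w: "w permutes {1..n}" and "[] \<notin> keys v"
  shows "hat n (push (map ((`) w)) v) B = hat n v (pinv w ` B)"
proof -
  have inj: "inj (map ((`) w))" using permutes_inj[OF w] by (rule inj_map_image)
  have "hat n (push (map ((`) w)) v) B
      = (\<Sum>s\<in>keys v. lookup v s * chi (lower n (map ((`) w) s)) B)"
    unfolding hat_def keys_push_inj[OF inj]
    using inj by (subst sum.reindex) (auto intro: inj_on_subset simp: lookup_push_inj)
  also have "\<dots> = hat n v (pinv w ` B)"
    unfolding hat_def
  proof (intro sum.cong refl)
    fix s assume "s \<in> keys v"
    then have "s \<noteq> []" using assms(2) by auto
    then show "lookup v s * chi (lower n (map ((`) w) s)) B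
       = lookup v s * chi (lower n s) (pinv w ` B)"
      using lower_map[OF w] chi_pinv[OF w] by simp
  qed
  finally show ?thesis .
qed

lemma Nil_notin_keys_Specht:
  assumes "v \<in> carrier (Specht n (two_row n k))"
  shows "[] \<notin> keys v"
  using keys_Specht[OF assms] by (metis length_tabloid length_0_conv two_row_nth(2))

subsection \<open>Polytabloids as products of differences\<close>

text \<open>
  The sum runs over the group generated by the \<open>m\<close> disjoint transpositions of \<open>b j\<close> and \<open>c j\<close>. Each
  element either fixes the last pair or swaps it, with opposite signs, so the last factor
  \<open>g (b j) - g (c j)\<close> splits off.
\<close>

lemma signed_sum_swaps:
  fixes b c :: "nat \<Rightarrow> 'x" and g :: "'x \<Rightarrow> complex"
  assumes "inj_on b {..<m}" "inj_on c {..<m}" "b ` {..<m} \<inter> c ` {..<m} = {}"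
    and finX: "finite X" "b ` {..<m} \<subseteq> X" "c ` {..<m} \<subseteq> X"
  shows "(\<Sum>\<sigma> | \<sigma> permutes X \<and> (\<forall>j<m. \<sigma> ` {b j, c j} = {b j, c j})
            \<and> (\<forall>x. x \<notin> b ` {..<m} \<union> c ` {..<m} \<longrightarrow> \<sigma> x = x).
          of_int (sign \<sigma>) * (\<Prod>j<m. g (\<sigma> (b j))))
       = (\<Prod>j<m. g (b j) - g (c j))"
  using assms
proof (induction m)
  case 0
  have "{\<sigma>. \<sigma> permutes X \<and> (\<forall>x. \<sigma> x = x)} = {id}"
    using permutes_id[of X] by (auto simp: id_def)
  then show ?case by (simp add: sign_id)
next
  case (Suc m)
  define A where "A = {\<sigma>. \<sigma> permutes X \<and> (\<forall>j<m. \<sigma> ` {b j, c j} = {b j, c j})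
            \<and> (\<forall>x. x \<notin> b ` {..<m} \<union> c ` {..<m} \<longrightarrow> \<sigma> x = x)}"
  define A' where "A' = {\<sigma>. \<sigma> permutes X \<and> (\<forall>j<Suc m. \<sigma> ` {b j, c j} = {b j, c j})
            \<and> (\<forall>x. x \<notin> b ` {..<Suc m} \<union> c ` {..<Suc m} \<longrightarrow> \<sigma> x = x)}"
  define \<tau> where "\<tau> = transpose (b m) (c m)"
  have bc: "b m \<noteq> c m" "b m \<notin> b ` {..<m} \<union> c ` {..<m}" "c m \<notin> b ` {..<m} \<union> c ` {..<m}"
    using Suc.prems by (auto simp: inj_on_def lessThan_Suc)
  have ne: "b j \<noteq> b m" "b j \<noteq> c m" "c j \<noteq> b m" "c j \<noteq> c m" if "j < m" for j
    using bc(2,3) that by (metis UnI1 UnI2 imageI lessThan_iff)+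
  have X: "b m \<in> X" "c m \<in> X" using Suc.prems by auto
  have \<tau>: "\<tau> permutes X" unfolding \<tau>_def using X by (rule permutes_swap_id)
  have sgn: "sign \<tau> = -1" unfolding \<tau>_def using bc by (simp add: sign_swap_id)
  have perm: "permutation p" if "p permutes X" for p using that finX(1) by (auto simp: permutation_permutes)
  have \<tau>id: "\<tau> \<circ> \<tau> = id" unfolding \<tau>_def by simp
  have \<tau>j: "\<tau> (b j) = b j" "\<tau> (c j) = c j" if "j < m" for j
    using ne[OF that] by (auto simp: \<tau>_def transpose_apply_other)
  have \<tau>m: "\<tau> (b m) = c m" "\<tau> (c m) = b m" by (simp_all add: \<tau>_def)
  have \<tau>x: "\<tau> x = x" if "x \<notin> b ` {..<Suc m} \<union> c ` {..<Suc m}" for x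
    using that unfolding \<tau>_def by (intro transpose_apply_other) auto
  have A_fix: "\<sigma> (b m) = b m" "\<sigma> (c m) = c m" if "\<sigma> \<in> A" for \<sigma>
    using that bc unfolding A_def by blast+
  have A_sub: "\<sigma> \<in> A'" if s: "\<sigma> \<in> A" for \<sigma>
  proof -
    have "\<sigma> ` {b j, c j} = {b j, c j}" if "j < Suc m" for j
    proof (cases "j = m")
      case True then show ?thesis using A_fix[OF s] by simp
    next
      case False
      then have "j < m" using that by simp
      then show ?thesis using s unfolding A_def by blast
    qed
    moreover have "\<sigma> x = x" if "x \<notin> b ` {..<Suc m} \<union> c ` {..<Suc m}" for x
    proof -
      have "x \<notin> b ` {..<m} \<union> c ` {..<m}" using that by auto
      then show ?thesis using s unfolding A_def by blast
    qed
    ultimately show ?thesis using s unfolding A'_def A_def by blast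
  qed
  have A'_\<tau>: "\<sigma> \<circ> \<tau> \<in> A'" if s: "\<sigma> \<in> A'" for \<sigma>
  proof -
    have "(\<sigma> \<circ> \<tau>) ` {b j, c j} = {b j, c j}" if "j < Suc m" for j
    proof -
      have "\<tau> ` {b j, c j} = {b j, c j}"
        using \<tau>j[of j] \<tau>m that by (cases "j = m") auto
      then have "(\<sigma> \<circ> \<tau>) ` {b j, c j} = \<sigma> ` {b j, c j}" by (metis image_comp)
      then show ?thesis using s that unfolding A'_def by simp
    qed
    moreover have "(\<sigma> \<circ> \<tau>) x = x" if "x \<notin> b ` {..<Suc m} \<union> c ` {..<Suc m}" for x
      using s that \<tau>x[OF that] unfolding A'_def by simp
    moreover have "\<sigma> \<circ> \<tau> permutes X" using s \<tau> unfolding A'_def by (simp add: permutes_compose)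
    ultimately show ?thesis unfolding A'_def by blast
  qed
  have A'_A: "\<sigma> \<in> A" if s: "\<sigma> \<in> A'" and fix_b: "\<sigma> (b m) = b m" for \<sigma>
  proof -
    have p: "\<sigma> permutes X" and im: "\<sigma> ` {b m, c m} = {b m, c m}" using s unfolding A'_def by auto
    have "\<sigma> (c m) \<noteq> b m" using permutes_inj[OF p] fix_b bc(1) by (metis injD)
    then have "\<sigma> (c m) = c m" using im by auto
    then have "\<sigma> x = x" if "x \<notin> b ` {..<m} \<union> c ` {..<m}" for x
      using s that fix_b unfolding A'_def by (cases "x = b m \<or> x = c m") (auto simp: lessThan_Suc)
    moreover have "\<forall>j<m. \<sigma> ` {b j, c j} = {b j, c j}" using s unfolding A'_def by simp
    ultimately show ?thesis using p unfolding A_def by blast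
  qed
  have A': "A' = A \<union> (\<lambda>\<sigma>. \<sigma> \<circ> \<tau>) ` A"
  proof
    show "A' \<subseteq> A \<union> (\<lambda>\<sigma>. \<sigma> \<circ> \<tau>) ` A"
    proof
      fix \<sigma> assume s: "\<sigma> \<in> A'"
      then have im: "\<sigma> ` {b m, c m} = {b m, c m}" and p: "\<sigma> permutes X" unfolding A'_def by auto
      show "\<sigma> \<in> A \<union> (\<lambda>\<sigma>. \<sigma> \<circ> \<tau>) ` A"
      proof (cases "\<sigma> (b m) = b m")
        case True then show ?thesis using A'_A[OF s] by blast
      next
        case False
        then have "\<sigma> (b m) = c m" using im by auto
        then have "\<sigma> (c m) \<noteq> c m" using permutes_inj[OF p] bc(1) by (metis injD)
        then have "\<sigma> (c m) = b m" using im by auto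
        then have "(\<sigma> \<circ> \<tau>) (b m) = b m" using \<tau>m by simp
        then have "\<sigma> \<circ> \<tau> \<in> A" using A'_A[OF A'_\<tau>[OF s]] by blast
        moreover have "\<sigma> = (\<sigma> \<circ> \<tau>) \<circ> \<tau>" using \<tau>id by (simp add: comp_assoc)
        ultimately show ?thesis by blast
      qed
    qed
    show "A \<union> (\<lambda>\<sigma>. \<sigma> \<circ> \<tau>) ` A \<subseteq> A'"
      using A_sub A'_\<tau> by blast
  qed
  have disj: "A \<inter> (\<lambda>\<sigma>. \<sigma> \<circ> \<tau>) ` A = {}"
  proof (rule ccontr)
    assume "A \<inter> (\<lambda>\<sigma>. \<sigma> \<circ> \<tau>) ` A \<noteq> {}"
    then obtain \<sigma> where "\<sigma> \<in> A" "\<sigma> \<circ> \<tau> \<in> A" by blast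
    then have "\<sigma> (c m) = b m" using A_fix(1)[of "\<sigma> \<circ> \<tau>"] \<tau>m by simp
    then show False using A_fix(2)[OF \<open>\<sigma> \<in> A\<close>] bc by simp
  qed
  have fin: "finite A"
    by (rule finite_subset[OF _ finite_permutations[OF finX(1)]]) (auto simp: A_def)
  have inj: "inj_on (\<lambda>\<sigma>. \<sigma> \<circ> \<tau>) A"
    by (rule inj_onI) (metis \<tau>id comp_assoc comp_id)
  let ?f = "\<lambda>m \<sigma>. of_int (sign \<sigma>) * (\<Prod>j<m. g (\<sigma> (b j))) :: complex"
  have m_sub: "{..<m} \<subseteq> {..<Suc m}" by auto
  have "inj_on b {..<m}" by (rule inj_on_subset[OF Suc.prems(1) m_sub])
  moreover have "inj_on c {..<m}" by (rule inj_on_subset[OF Suc.prems(2) m_sub])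
  moreover have "b ` {..<m} \<inter> c ` {..<m} = {}"
    using Suc.prems(3) image_mono[OF m_sub, of b] image_mono[OF m_sub, of c] by blast
  moreover have "b ` {..<m} \<subseteq> X" "c ` {..<m} \<subseteq> X"
    using order_trans[OF image_mono[OF m_sub] Suc.prems(5)] order_trans[OF image_mono[OF m_sub] Suc.prems(6)] .
  ultimately have prems_m: "inj_on b {..<m}" "inj_on c {..<m}" "b ` {..<m} \<inter> c ` {..<m} = {}"
    "finite X" "b ` {..<m} \<subseteq> X" "c ` {..<m} \<subseteq> X"
    using Suc.prems(4) by simp_all
  have IH: "sum (?f m) A = (\<Prod>j<m. g (b j) - g (c j))"
    unfolding A_def by (rule Suc.IH[OF prems_m])
  have "sum (?f (Suc m)) A' = sum (?f (Suc m)) A + (\<Sum>\<sigma>\<in>A. ?f (Suc m) (\<sigma> \<circ> \<tau>))"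
    unfolding A' using fin disj inj by (simp add: sum.union_disjoint sum.reindex)
  also have "sum (?f (Suc m)) A = (\<Sum>\<sigma>\<in>A. ?f m \<sigma> * g (b m))"
    by (intro sum.cong refl) (simp add: A_fix)
  also have "(\<Sum>\<sigma>\<in>A. ?f (Suc m) (\<sigma> \<circ> \<tau>)) = (\<Sum>\<sigma>\<in>A. - (?f m \<sigma> * g (c m)))"
  proof (intro sum.cong refl)
    fix \<sigma> assume s: "\<sigma> \<in> A"
    then have "\<sigma> permutes X" by (simp add: A_def)
    then have "sign (\<sigma> \<circ> \<tau>) = - sign \<sigma>"
      using perm \<tau> sgn by (simp add: sign_compose)
    moreover have "(\<Prod>j<m. g ((\<sigma> \<circ> \<tau>) (b j))) = (\<Prod>j<m. g (\<sigma> (b j)))"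
      by (intro prod.cong refl) (simp add: \<tau>j)
    moreover have "g ((\<sigma> \<circ> \<tau>) (b m)) = g (c m)"
      using \<tau>m A_fix[OF s] by simp
    ultimately show "?f (Suc m) (\<sigma> \<circ> \<tau>) = - (?f m \<sigma> * g (c m))"
      by simp
  qed
  also have "(\<Sum>\<sigma>\<in>A. ?f m \<sigma> * g (b m)) + (\<Sum>\<sigma>\<in>A. - (?f m \<sigma> * g (c m))) = sum (?f m) A * (g (b m) - g (c m))"
    by (simp add: sum_distrib_right[symmetric] sum_negf right_diff_distrib)
  finally show ?case unfolding IH A'_def by simp
qed

lemma column_group_two_row:
  assumes t: "bij_betw t (cells (two_row n k)) {1..n}" and k: "2 * k \<le> n"
  shows "column_group n (two_row n k) t =
    {\<sigma>. \<sigma> permutes {1..n} \<and> (\<forall>j<k. \<sigma> ` {t (1, j), t (0, j)} = {t (1, j), t (0, j)})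
       \<and> (\<forall>x. x \<notin> (\<lambda>j. t (1, j)) ` {..<k} \<union> (\<lambda>j. t (0, j)) ` {..<k} \<longrightarrow> \<sigma> x = x)}"
    (is "_ = ?R")
proof -
  have col: "t ` {c \<in> cells (two_row n k). snd c = j}
     = (if j < k then {t (1, j), t (0, j)} else if j < n - k then {t (0, j)} else {})" for j
    using k by (auto simp: cells_two_row)
  have inj: "inj_on t (cells (two_row n k))" using t by (rule bij_betw_imp_inj_on)
  show ?thesis
  proof (rule subset_antisym; rule subsetI)
    fix \<sigma> assume s: "\<sigma> \<in> column_group n (two_row n k) t"
    then have p: "\<sigma> permutes {1..n}" by (rule column_group_permutes)
    have c: "\<sigma> ` t ` {c \<in> cells (two_row n k). snd c = j} = t ` {c \<in> cells (two_row n k). snd c = j}" for j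
      using s by (simp add: column_group_def)
    have "\<sigma> ` {t (1, j), t (0, j)} = {t (1, j), t (0, j)}" if "j < k" for j
      using c[of j] that unfolding col by (simp only: if_True)
    moreover have "\<sigma> x = x" if x: "x \<notin> (\<lambda>j. t (1, j)) ` {..<k} \<union> (\<lambda>j. t (0, j)) ` {..<k}" for x
    proof (cases "x \<in> {1..n}")
      case True
      then obtain i j where ij: "(i, j) \<in> cells (two_row n k)" "t (i, j) = x" using cells_bij_pos[OF t] by metis
      then have "i = 0" "\<not> j < k" "j < n - k" using x by (auto simp: cells_two_row)
      then show ?thesis using c[of j] ij unfolding col by simp
    next
      case False then show ?thesis using p by (simp add: permutes_not_in)
    qed
    ultimately show "\<sigma> \<in> ?R" using p by blast
  next
    fix \<sigma> assume s: "\<sigma> \<in> ?R"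
    have "\<sigma> ` t ` {c \<in> cells (two_row n k). snd c = j} = t ` {c \<in> cells (two_row n k). snd c = j}" for j
    proof -
      have "\<sigma> (t (0, j)) = t (0, j)" if "\<not> j < k" "j < n - k"
      proof -
        have "t (0, j) \<notin> (\<lambda>j. t (1, j)) ` {..<k} \<union> (\<lambda>j. t (0, j)) ` {..<k}"
          using that inj by (auto simp: cells_two_row dest!: inj_onD)
        then show ?thesis using s by blast
      qed
      then show ?thesis unfolding col using s by auto
    qed
    then show "\<sigma> \<in> column_group n (two_row n k) t" using s by (simp add: column_group_def)
  qed
qed

lemma two_row_entries:
  assumes t: "bij_betw t (cells (two_row n k)) {1..n}"
  shows "j < k \<Longrightarrow> j' < n - k \<Longrightarrow> t (1, j) \<noteq> t (0, j')"
    and "j < k \<Longrightarrow> j' < k \<Longrightarrow> t (1, j) = t (1, j') \<longleftrightarrow> j = j'"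
    and "j < n - k \<Longrightarrow> j' < n - k \<Longrightarrow> t (0, j) = t (0, j') \<longleftrightarrow> j = j'"
    and "j < k \<Longrightarrow> t (1, j) \<in> {1..n}" and "j < n - k \<Longrightarrow> t (0, j) \<in> {1..n}"
proof -
  have c: "j < k \<Longrightarrow> (1, j) \<in> cells (two_row n k)" "j < n - k \<Longrightarrow> (0, j) \<in> cells (two_row n k)" for j
    by (simp_all add: cells_two_row)
  have inj: "x \<in> cells (two_row n k) \<Longrightarrow> y \<in> cells (two_row n k) \<Longrightarrow> t x = t y \<longleftrightarrow> x = y" for x y
    using bij_betw_imp_inj_on[OF t] by (rule inj_on_eq_iff)
  show "j < k \<Longrightarrow> j' < n - k \<Longrightarrow> t (1, j) \<noteq> t (0, j')"
    "j < k \<Longrightarrow> j' < k \<Longrightarrow> t (1, j) = t (1, j') \<longleftrightarrow> j = j'"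
    "j < n - k \<Longrightarrow> j' < n - k \<Longrightarrow> t (0, j) = t (0, j') \<longleftrightarrow> j = j'"
    by (simp_all only: inj c) simp_all
  show "j < k \<Longrightarrow> t (1, j) \<in> {1..n}" "j < n - k \<Longrightarrow> t (0, j) \<in> {1..n}"
    using bij_betwE[OF t] c by blast+
qed

lemma hat_polytabloid:
  assumes t: "bij_betw t (cells (two_row n k)) {1..n}" and k: "2 * k \<le> n"
  shows "hat n (polytabloid n (two_row n k) t) B = (\<Prod>j<k. eps (t (1, j)) B - eps (t (0, j)) B)"
proof -
  let ?l = "two_row n k"
  have k': "j < n - k" if "j < k" for j using that k by simp
  have inj1: "inj_on (\<lambda>j. t (1, j)) {..<k}"
    by (rule inj_onI) (simp only: lessThan_iff two_row_entries(2)[OF t])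
  have inj0: "inj_on (\<lambda>j. t (0, j)) {..<k}"
    by (rule inj_onI) (simp only: lessThan_iff k' two_row_entries(3)[OF t])
  have disj: "(\<lambda>j. t (1, j)) ` {..<k} \<inter> (\<lambda>j. t (0, j)) ` {..<k} = {}"
    using two_row_entries(1)[OF t _ k'] by blast
  have sub: "(\<lambda>j. t (1, j)) ` {..<k} \<subseteq> {1..n}" "(\<lambda>j. t (0, j)) ` {..<k} \<subseteq> {1..n}"
    using two_row_entries(4)[OF t] two_row_entries(5)[OF t k'] by blast+
  have "hat n (polytabloid n ?l t) B
     = (\<Sum>\<sigma>\<in>column_group n ?l t. of_int (sign \<sigma>) * chi (lower n (tabloid ?l (\<sigma> \<circ> t))) B)"
    by (simp add: polytabloid_def hat_sum sum_fun_apply hat_single)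
  also have "\<dots> = (\<Sum>\<sigma>\<in>column_group n ?l t. of_int (sign \<sigma>) * (\<Prod>j<k. eps (\<sigma> (t (1, j))) B))"
  proof (intro sum.cong refl)
    fix \<sigma> assume "\<sigma> \<in> column_group n ?l t"
    then have p: "\<sigma> permutes {1..n}" by (rule column_group_permutes)
    have "inj_on (\<lambda>j. \<sigma> (t (1, j))) {..<k}"
      using comp_inj_on[OF inj1 permutes_inj_on[OF p]] by (simp add: comp_def)
    then have "chi (lower n (tabloid ?l (\<sigma> \<circ> t))) B = (\<Prod>j<k. eps (\<sigma> (t (1, j))) B)"
      unfolding lower_tabloid[OF bij_permutes_comp[OF t p]] chi_def
      by (simp add: prod.reindex)
    then show "of_int (sign \<sigma>) * chi (lower n (tabloid ?l (\<sigma> \<circ> t))) B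
      = of_int (sign \<sigma>) * (\<Prod>j<k. eps (\<sigma> (t (1, j))) B)" by simp
  qed
  also have "\<dots> = (\<Prod>j<k. eps (t (1, j)) B - eps (t (0, j)) B)"
    unfolding column_group_two_row[OF t k]
    by (rule signed_sum_swaps[OF inj1 inj0 disj _ sub, where g = "\<lambda>x. eps x B"]) simp
  finally show ?thesis .
qed

subsection \<open>The pairing with a polytabloid\<close>

lemma finite_halves [simp]: "finite (halves a)"
proof -
  have "halves a \<subseteq> Pow {1..2 * a}" by (auto simp: halves_def)
  then show ?thesis by (rule finite_subset) simp
qed

lemma hat_polytabloid_alternates:
  assumes t: "bij_betw t (cells (two_row n k)) {1..n}" and \<sigma>: "\<sigma> \<in> column_group n (two_row n k) t"
  shows "hat n (polytabloid n (two_row n k) t) (pinv \<sigma> ` B)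
    = of_int (sign \<sigma>) * hat n (polytabloid n (two_row n k) t) B"
  using hat_push[OF column_group_permutes[OF \<sigma>] Nil_notin_keys_Specht[OF polytabloid_in_Specht[OF t]], of B]
  by (simp add: polytabloid_column_act[OF \<sigma>] hat_pscale)

text \<open>
  Fewer than \<open>k\<close> points miss both entries of some column of height two. Swapping these entries fixes
  \<open>chi U\<close> and changes the sign of the polytabloid, and the sum over all halves is invariant.
\<close>

lemma pairing_chi_zero:
  assumes t: "bij_betw t (cells (two_row (2 * a) k)) {1..2 * a}" and k: "2 * k \<le> 2 * a"
    and U: "finite U" "card U < k"
  shows "(\<Sum>B\<in>halves a. hat (2 * a) (polytabloid (2 * a) (two_row (2 * a) k) t) B * chi U B) = 0"
proof -
  let ?F = "hat (2 * a) (polytabloid (2 * a) (two_row (2 * a) k) t)"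
  have k': "j < 2 * a - k" if "j < k" for j using that k by simp
  have "\<exists>j<k. t (1, j) \<notin> U \<and> t (0, j) \<notin> U"
  proof (rule ccontr)
    assume "\<not> (\<exists>j<k. t (1, j) \<notin> U \<and> t (0, j) \<notin> U)"
    then have all: "t (1, j) \<in> U \<or> t (0, j) \<in> U" if "j < k" for j using that by blast
    define h where "h j = (if t (1, j) \<in> U then t (1, j) else t (0, j))" for j
    have "inj_on h {..<k}"
    proof (rule inj_onI)
      fix i j assume "i \<in> {..<k}" "j \<in> {..<k}" "h i = h j"
      then show "i = j"
        using two_row_entries(1)[OF t, of i j] two_row_entries(1)[OF t, of j i]
          two_row_entries(2)[OF t, of i j] two_row_entries(3)[OF t, of i j] k'[of i] k'[of j]
        by (simp add: h_def split: if_splits)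
    qed
    moreover have "h ` {..<k} \<subseteq> U" using all by (auto simp: h_def)
    ultimately have "k \<le> card U" using card_inj_on_le[of h "{..<k}" U] U by simp
    then show False using U by simp
  qed
  then obtain j where j: "j < k" "t (1, j) \<notin> U" "t (0, j) \<notin> U" by blast
  have c: "(0, j) \<in> cells (two_row (2 * a) k)" "(1, j) \<in> cells (two_row (2 * a) k)"
    using j k by (simp_all add: cells_two_row)
  define \<tau> where "\<tau> = transpose (t (0, j)) (t (1, j))"
  have \<tau>: "\<tau> \<in> column_group (2 * a) (two_row (2 * a) k) t"
    unfolding \<tau>_def by (rule transpose_in_column_group[OF t c])
  have p: "\<tau> permutes {1..2 * a}" using \<tau> by (rule column_group_permutes)
  have "t (0, j) \<noteq> t (1, j)" using two_row_entries(1)[OF t j(1) k'[OF j(1)]] by simp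
  then have sgn: "sign \<tau> = -1" by (simp add: \<tau>_def sign_swap_id)
  have "\<tau> ` U = U" unfolding \<tau>_def using j by (intro transpose_image_invariant) simp
  then have "?F (pinv \<tau> ` B) * chi U (pinv \<tau> ` B) = - (?F B * chi U B)" for B
    using hat_polytabloid_alternates[OF t \<tau>, of B] chi_pinv[OF p, of U B] by (simp add: sgn)
  then have "(\<Sum>B\<in>halves a. ?F B * chi U B) = - (\<Sum>B\<in>halves a. ?F B * chi U B)"
    using sum_halves_translate[OF p, of "\<lambda>B. ?F B * chi U B"] by (simp add: sum_negf)
  then show ?thesis by simp
qed

lemma pairing_low_zero:
  assumes t: "bij_betw t (cells (two_row (2 * a) k)) {1..2 * a}" and k: "2 * k \<le> 2 * a"
    and f: "f \<in> low a k"
  shows "(\<Sum>B\<in>halves a. hat (2 * a) (polytabloid (2 * a) (two_row (2 * a) k) t) B * f B) = 0"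
proof -
  let ?F = "hat (2 * a) (polytabloid (2 * a) (two_row (2 * a) k) t)"
  have "low a k \<subseteq> {f. (\<Sum>B\<in>halves a. ?F B * f B) = 0}"
  proof (rule low_least)
    show "fn.subspace {f. (\<Sum>B\<in>halves a. ?F B * f B) = 0}"
      by (rule fn.subspaceI)
        (simp_all add: distrib_left sum.distrib mult.left_commute sum_distrib_left[symmetric])
  next
    fix U assume "U \<subseteq> {1..2 * a}" "card U < k"
    then show "chi U \<in> {f. (\<Sum>B\<in>halves a. ?F B * f B) = 0}"
      using pairing_chi_zero[OF t k, of U] finite_subset by blast
  qed simp
  then show ?thesis using f by blast
qed

text \<open>
  The two functions multiply to the product of the factors \<open>1 - eps c * eps b\<close> over the columns
  \<open>(c, b)\<close>, each of which is \<open>0\<close> or \<open>2\<close>. So it is enough to find one half that separates all pairs.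
\<close>

lemma pairing_self_nonzero:
  assumes t: "bij_betw t (cells (two_row (2 * a) k)) {1..2 * a}" and k: "2 * k \<le> 2 * a"
  shows "(\<Sum>B\<in>halves a. hat (2 * a) (polytabloid (2 * a) (two_row (2 * a) k) t) B
     * chi (lower (2 * a) (tabloid (two_row (2 * a) k) t)) B) \<noteq> 0"
proof -
  define h where "h B = (\<Prod>j<k. if t (1, j) \<in> B \<longleftrightarrow> t (0, j) \<in> B then 0 else 2 :: nat)" for B
  have k': "j < 2 * a - k" if "j < k" for j using that k by simp
  have inj1: "inj_on (\<lambda>j. t (1, j)) {..<k}"
    by (rule inj_onI) (simp only: lessThan_iff two_row_entries(2)[OF t])
  have "hat (2 * a) (polytabloid (2 * a) (two_row (2 * a) k) t) B
     * chi (lower (2 * a) (tabloid (two_row (2 * a) k) t)) B = of_nat (h B)" for B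
  proof -
    have "chi (lower (2 * a) (tabloid (two_row (2 * a) k) t)) B = (\<Prod>j<k. eps (t (1, j)) B)"
      unfolding lower_tabloid[OF t] chi_def by (simp only: prod.reindex[OF inj1] comp_def)
    then show ?thesis
      unfolding hat_polytabloid[OF t k] h_def of_nat_prod
      by (simp only: prod.distrib[symmetric], intro prod.cong refl) (simp add: eps_def)
  qed
  then have "(\<Sum>B\<in>halves a. hat (2 * a) (polytabloid (2 * a) (two_row (2 * a) k) t) B
     * chi (lower (2 * a) (tabloid (two_row (2 * a) k) t)) B) = of_nat (\<Sum>B\<in>halves a. h B)"
    by (simp only: of_nat_sum)
  moreover have "(\<Sum>B\<in>halves a. h B) \<noteq> 0"
  proof -
    \<comment> \<open>the second row, filled up with entries of the first row that stand alone in their column\<close>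
    define B where "B = (\<lambda>j. t (1, j)) ` {..<k} \<union> (\<lambda>j. t (0, j)) ` {k..<a}"
    have a: "j < 2 * a - k" if "j < a" for j using that k by simp
    have inj0: "inj_on (\<lambda>j. t (0, j)) {k..<a}"
      by (rule inj_onI) (simp add: two_row_entries(3)[OF t] a)
    have "(\<lambda>j. t (1, j)) ` {..<k} \<inter> (\<lambda>j. t (0, j)) ` {k..<a} = {}"
      using two_row_entries(1)[OF t _ a] by fastforce
    then have "card B = k + (a - k)"
      unfolding B_def using inj0 inj1 by (simp add: card_Un_disjoint card_image)
    moreover have "B \<subseteq> {1..2 * a}"
      unfolding B_def using two_row_entries(4)[OF t] two_row_entries(5)[OF t a] by fastforce
    ultimately have "B \<in> halves a" using k by (simp add: halves_def)
    moreover have "h B \<noteq> 0"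
    proof -
      have "t (1, j) \<in> B \<and> t (0, j) \<notin> B" if j: "j < k" for j
      proof
        show "t (1, j) \<in> B" using j by (simp add: B_def)
        have n1: "t (0, j) \<noteq> t (1, i)" if "i < k" for i
          using two_row_entries(1)[OF t that k'[OF j]] by simp
        have n0: "t (0, j) \<noteq> t (0, i)" if "k \<le> i" "i < a" for i
          using two_row_entries(3)[OF t k'[OF j] a[OF that(2)]] that j by simp
        show "t (0, j) \<notin> B"
        proof
          assume "t (0, j) \<in> B"
          then consider i where "t (0, j) = t (1, i)" "i < k" | i where "t (0, j) = t (0, i)" "k \<le> i" "i < a"
            unfolding B_def by (elim UnE imageE) (simp_all only: lessThan_iff atLeastLessThan_iff)
          then show False using n1 n0 by cases blast+
        qed
      qed
      then show ?thesis unfolding h_def by simp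
    qed
    ultimately show ?thesis by (simp add: sum_eq_0_iff) blast
  qed
  ultimately show ?thesis by (simp only: of_nat_eq_0_iff not_False_eq_True)
qed

text \<open>
  As a function of the tabloid the pairing alternates under the column group, so up to a factor it
  is the polytabloid itself.
\<close>

lemma pairing_tabloid:
  assumes t: "bij_betw t (cells (two_row (2 * a) k)) {1..2 * a}" and k: "2 * k \<le> 2 * a"
    and t': "bij_betw t' (cells (two_row (2 * a) k)) {1..2 * a}"
  defines "u \<equiv> \<lambda>s. \<Sum>B\<in>halves a. hat (2 * a) (polytabloid (2 * a) (two_row (2 * a) k) t) B * chi (lower (2 * a) s) B"
  shows "u (tabloid (two_row (2 * a) k) t') = u (tabloid (two_row (2 * a) k) t)
    * lookup (polytabloid (2 * a) (two_row (2 * a) k) t) (tabloid (two_row (2 * a) k) t')"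
proof -
  let ?F = "hat (2 * a) (polytabloid (2 * a) (two_row (2 * a) k) t)"
  \<comment> \<open>the empty list has no first row, so \<open>lower\<close> is not equivariant at it\<close>
  let ?u = "\<lambda>s. if s = [] then 0 else u s"
  have "alternating (2 * a) (two_row (2 * a) k) t ?u"
    unfolding alternating_def
  proof (intro ballI allI)
    fix \<sigma> s assume \<sigma>: "\<sigma> \<in> column_group (2 * a) (two_row (2 * a) k) t"
    have p: "\<sigma> permutes {1..2 * a}" using \<sigma> by (rule column_group_permutes)
    show "?u (map ((`) \<sigma>) s) = of_int (sign \<sigma>) * ?u s"
    proof (cases "s = []")
      case False
      have "?F B * chi (lower (2 * a) (map ((`) \<sigma>) s)) B
        = of_int (sign \<sigma>) * (?F (pinv \<sigma> ` B) * chi (lower (2 * a) s) (pinv \<sigma> ` B))" for B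
        unfolding hat_polytabloid_alternates[OF t \<sigma>] lower_map[OF p False] chi_pinv[OF p]
        by (simp add: sign_mult_self mult.assoc)
      then have "u (map ((`) \<sigma>) s) = of_int (sign \<sigma>) * u s"
        unfolding u_def using sum_halves_translate[OF p, of "\<lambda>B. ?F B * chi (lower (2 * a) s) B"]
        by (simp add: sum_distrib_left[symmetric])
      then show ?thesis using False by simp
    qed simp
  qed
  from alternating_two_row_unique[OF t this k t'] show ?thesis
    by (simp add: tabloid_def two_row_nth)
qed

lemma hat_low_imp_zero:
  assumes v: "v \<in> carrier (Specht (2 * a) (two_row (2 * a) k))" and k: "2 * k \<le> 2 * a"
    and low: "hat (2 * a) v \<in> low a k"
  shows "v = 0"
proof -
  let ?n = "2 * a" and ?l = "two_row (2 * a) k"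
  have orth: "(\<Sum>s\<in>keys v. lookup v s * lookup (polytabloid ?n ?l t) s) = 0"
    if t: "bij_betw t (cells ?l) {1..?n}" for t
  proof -
    let ?F = "hat ?n (polytabloid ?n ?l t)"
    define u where "u s = (\<Sum>B\<in>halves a. ?F B * chi (lower ?n s) B)" for s
    have "0 = (\<Sum>B\<in>halves a. ?F B * hat ?n v B)"
      using pairing_low_zero[OF t k low] by simp
    also have "\<dots> = (\<Sum>B\<in>halves a. \<Sum>s\<in>keys v. lookup v s * (?F B * chi (lower ?n s) B))"
      by (simp add: hat_def[of _ v] sum_distrib_left mult.left_commute)
    also have "\<dots> = (\<Sum>s\<in>keys v. lookup v s * u s)"
      by (subst sum.swap) (simp add: u_def sum_distrib_left)
    also have "\<dots> = (\<Sum>s\<in>keys v. u (tabloid ?l t)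
         * (lookup v s * lookup (polytabloid ?n ?l t) s))"
    proof (intro sum.cong refl)
      fix s assume "s \<in> keys v"
      then obtain t' where t': "bij_betw t' (cells ?l) {1..?n}" "s = tabloid ?l t'"
        using keys_Specht[OF v] by blast
      have "u s = u (tabloid ?l t) * lookup (polytabloid ?n ?l t) s"
        unfolding t'(2) u_def by (rule pairing_tabloid[OF t k t'(1)])
      then show "lookup v s * u s
          = u (tabloid ?l t) * (lookup v s * lookup (polytabloid ?n ?l t) s)"
        by (simp only: mult.left_commute)
    qed
    finally have "u (tabloid ?l t)
      * (\<Sum>s\<in>keys v. lookup v s * lookup (polytabloid ?n ?l t) s) = 0"
      by (simp only: sum_distrib_left)
    moreover have "u (tabloid ?l t) \<noteq> 0"
      unfolding u_def by (rule pairing_self_nonzero[OF t k])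
    ultimately show ?thesis by simp
  qed
  have real: "cnj (lookup (polytabloid ?n ?l t) s) = lookup (polytabloid ?n ?l t) s" for t s
    by (simp add: polytabloid_def lookup_sum lookup_single when_def if_distrib cong: if_cong)
  \<comment> \<open>polytabloids are real, so the conjugate may be inserted; at \<open>v\<close> it produces the squared norm\<close>
  define Q where "Q = {y. (\<Sum>s\<in>keys v. lookup v s * cnj (lookup y s)) = 0}"
  have "pm.span (polytabloid ?n ?l ` tableaux ?n ?l) \<subseteq> Q"
  proof (rule pm.span_minimal)
    show "polytabloid ?n ?l ` tableaux ?n ?l \<subseteq> Q"
      using orth by (auto simp: Q_def tableaux_def real)
    show "pm.subspace Q"
      unfolding Q_def
      by (rule pm.subspaceI)
        (simp_all add: lookup_add distrib_left sum.distrib mult.left_commute sum_distrib_left[symmetric])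
  qed
  then have "v \<in> Q" using v by (auto simp: Specht_carrier)
  then have "(\<Sum>s\<in>keys v. complex_of_real ((norm (lookup v s))\<^sup>2)) = 0"
    by (simp only: Q_def mem_Collect_eq complex_norm_square)
  then have "(\<Sum>s\<in>keys v. (norm (lookup v s))\<^sup>2) = 0"
    by (simp only: of_real_sum[symmetric] of_real_eq_0_iff)
  then have "\<forall>s\<in>keys v. (norm (lookup v s))\<^sup>2 = 0"
    by (subst (asm) sum_nonneg_eq_0_iff) simp_all
  then have "lookup v s = 0" for s
    by (cases "s \<in> keys v") (simp_all add: in_keys_iff)
  then show ?thesis by (intro poly_mapping_eqI) simp
qed

text \<open>
  The pairs become the columns of height two, the remaining points fill up the first row.
\<close>

lemma pairdiff_is_hat:
  assumes ps: "length ps = k" "distinct (entries ps)" "set (entries ps) \<subseteq> {1..n}"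
  obtains t where "bij_betw t (cells (two_row n k)) {1..n}" "2 * k \<le> n"
    "hat n (polytabloid n (two_row n k) t) = pairdiff ps"
proof -
  have k: "2 * k \<le> n"
    using card_mono[OF _ ps(3)] distinct_card[OF ps(2)] ps(1) by simp
  define top where "top = map snd ps @ sorted_list_of_set ({1..n} - set (entries ps))"
  define bot where "bot = map fst ps"
  define t where "t c = (if fst c = 0 then top ! snd c else bot ! snd c)" for c :: "nat \<times> nat"
  have dist: "distinct (top @ bot)" using ps(2) by (auto simp: top_def bot_def)
  have set: "set (top @ bot) = {1..n}" using ps(3) by (auto simp: top_def bot_def)
  have lbot: "length bot = k" using ps by (simp add: bot_def)
  have "length (top @ bot) = n" using distinct_card[OF dist] set by simp
  then have ltop: "length top = n - k" using lbot by simp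
  have bij_t: "bij_betw t (cells (two_row n k)) {1..n}"
    unfolding bij_betw_def
  proof
    show "inj_on t (cells (two_row n k))"
    proof (rule inj_onI)
      fix c d assume cd: "c \<in> cells (two_row n k)" "d \<in> cells (two_row n k)" "t c = t d"
      have pos: "t c = (top @ bot) ! (snd c + (if fst c = 0 then 0 else n - k))
          \<and> snd c + (if fst c = 0 then 0 else n - k) < length (top @ bot) \<and> (fst c = 0 \<longrightarrow> snd c < n - k) \<and> fst c \<le> 1"
        if "c \<in> cells (two_row n k)" for c
        using that ltop lbot by (auto simp: cells_two_row t_def nth_append)
      have "snd c + (if fst c = 0 then 0 else n - k) = snd d + (if fst d = 0 then 0 else n - k)"
        using pos[OF cd(1)] pos[OF cd(2)] cd(3) nth_eq_iff_index_eq[OF dist] by metis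
      then show "c = d" using pos[OF cd(1)] pos[OF cd(2)] by (cases c; cases d) (auto split: if_splits)
    qed
    have "t ` cells (two_row n k) = (\<lambda>j. top ! j) ` {..<n - k} \<union> (\<lambda>j. bot ! j) ` {..<k}"
    proof -
      have "cells (two_row n k) = Pair 0 ` {..<n - k} \<union> Pair 1 ` {..<k}"
        by (auto simp: cells_two_row)
      then show ?thesis by (simp only: image_Un image_image) (simp add: t_def)
    qed
    also have "\<dots> = set top \<union> set bot"
      using ltop lbot by (auto simp: set_conv_nth)
    finally show "t ` cells (two_row n k) = {1..n}" using set by simp
  qed
  have "hat n (polytabloid n (two_row n k) t) = pairdiff ps"
  proof
    fix B
    have "pairdiff ps B = (\<Prod>j<k. eps (fst (ps ! j)) B - eps (snd (ps ! j)) B)"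
      unfolding pairdiff_def using ps(1) by (simp add: prod.list_conv_set_nth atLeast0LessThan)
    also have "\<dots> = (\<Prod>j<k. eps (t (1, j)) B - eps (t (0, j)) B)"
      using ps(1) by (intro prod.cong refl) (simp add: t_def top_def bot_def nth_append)
    also have "\<dots> = hat n (polytabloid n (two_row n k) t) B"
      using hat_polytabloid[OF bij_t k] by simp
    finally show "hat n (polytabloid n (two_row n k) t) B = pairdiff ps B" ..
  qed
  then show ?thesis by (rule that[OF bij_t k])
qed

lemma low_step_Specht:
  assumes "f \<in> low a (k + 2)" and a: "2 * k \<le> 2 * a"
  shows "\<exists>v\<in>carrier (Specht (2 * a) (two_row (2 * a) k)). f - hat (2 * a) v \<in> low a k"
proof -
  define D where "D = {f. \<exists>v\<in>carrier (Specht (2 * a) (two_row (2 * a) k)). f - hat (2 * a) v \<in> low a k}"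
  have "low a (k + 2) \<subseteq> D"
  proof (rule low_step)
    show "low a k \<subseteq> D"
      unfolding D_def using Specht_closed(1) by (force simp: hat_zero)
    show "fn.subspace D"
    proof (rule fn.subspaceI)
      show "0 \<in> D" unfolding D_def using Specht_closed(1) low_zero by (force simp: hat_zero)
    next
      fix f g assume "f \<in> D" "g \<in> D"
      then obtain v w where vw: "v \<in> carrier (Specht (2 * a) (two_row (2 * a) k))" "f - hat (2 * a) v \<in> low a k"
          "w \<in> carrier (Specht (2 * a) (two_row (2 * a) k))" "g - hat (2 * a) w \<in> low a k" unfolding D_def by blast
      have "(f + g) - hat (2 * a) (v + w) = (f - hat (2 * a) v) + (g - hat (2 * a) w)"
        by (simp add: hat_add)
      then have "(f + g) - hat (2 * a) (v + w) \<in> low a k" using low_add vw by metis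
      then show "f + g \<in> D" unfolding D_def using Specht_closed(2) vw by blast
    next
      fix c f assume "f \<in> D"
      then obtain v where v: "v \<in> carrier (Specht (2 * a) (two_row (2 * a) k))" "f - hat (2 * a) v \<in> low a k"
        unfolding D_def by blast
      have "fscale c f - hat (2 * a) (pscale c v) = fscale c (f - hat (2 * a) v)"
        by (simp add: hat_pscale fun_eq_iff right_diff_distrib)
      then have "fscale c f - hat (2 * a) (pscale c v) \<in> low a k" using low_scale[OF v(2)] by metis
      then show "fscale c f \<in> D" unfolding D_def using Specht_closed(3) v by blast
    qed
  next
    fix ps :: "(nat \<times> nat) list"
    assume "length ps = k" "distinct (entries ps)" "set (entries ps) \<subseteq> {1..2 * a}"
    then obtain t where t: "bij_betw t (cells (two_row (2 * a) k)) {1..2 * a}"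
      "hat (2 * a) (polytabloid (2 * a) (two_row (2 * a) k) t) = pairdiff ps"
      by (rule pairdiff_is_hat)
    have "pairdiff ps - hat (2 * a) (polytabloid (2 * a) (two_row (2 * a) k) t) \<in> low a k"
      using t low_zero by simp
    then show "pairdiff ps \<in> D"
      unfolding D_def using polytabloid_in_Specht[OF t(1)] by blast
  qed
  then show ?thesis using assms(1) unfolding D_def by blast
qed

lemma hat_in_low:
  assumes v: "v \<in> carrier (Specht (2 * a) (two_row (2 * a) k))"
  shows "hat (2 * a) v \<in> low a (k + 2)"
proof -
  have sum: "hat (2 * a) v = (\<Sum>s\<in>keys v. fscale (lookup v s) (chi (lower (2 * a) s)))"
    by (simp add: fun_eq_iff hat_def sum_fun_apply)
  have "fscale (lookup v s) (chi (lower (2 * a) s)) \<in> low a (k + 2)"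
    if s: "s \<in> keys v" for s
  proof -
    obtain t where "bij_betw t (cells (two_row (2 * a) k)) {1..2 * a}" "s = tabloid (two_row (2 * a) k) t"
      using keys_Specht[OF v s] by blast
    then have "card (lower (2 * a) s) = k" using card_lower_tabloid by blast
    then show ?thesis by (intro low_scale low_chi lower_subset) auto
  qed
  then show ?thesis unfolding sum by (rule low_sum)
qed

section \<open>Polynomials and their evaluation\<close>

lemma poly_mapping_sum_singles:
  "(\<Sum>m\<in>keys p. single m (lookup p m)) = p"
proof (rule poly_mapping_eqI)
  fix k
  have "lookup (\<Sum>m\<in>keys p. single m (lookup p m)) k
     = (\<Sum>m\<in>keys p. if m = k then lookup p m else 0)"
    by (simp add: lookup_sum lookup_single when_def)
  also have "\<dots> = lookup p k"
    by (simp add: in_keys_iff)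
  finally show "lookup (\<Sum>m\<in>keys p. single m (lookup p m)) k
     = lookup p k" .
qed

lemma push_push: "push f (push g p) = push (f \<circ> g) p"
  by (simp add: push_def[of g p] push_def[of "f \<circ> g" p] push_sum)

lemma push_id: "push id p = p"
  by (simp add: push_def poly_mapping_sum_singles)

lemma inj_push: "inj f \<Longrightarrow> inj (push f :: ('a \<Rightarrow>\<^sub>0 'c::comm_monoid_add) \<Rightarrow> ('b \<Rightarrow>\<^sub>0 'c))"
  by (rule injI, rule poly_mapping_eqI) (metis lookup_push_inj)

definition mono_eval :: "(nat set \<Rightarrow> complex) \<Rightarrow> monomial \<Rightarrow> complex" where
  "mono_eval z m = (\<Prod>e\<in>keys m. z e ^ lookup m e)"

lemma mono_eval_superset:
  assumes "finite A" "keys m \<subseteq> A"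
  shows "mono_eval z m = (\<Prod>e\<in>A. z e ^ lookup m e)"
  unfolding mono_eval_def using assms
  by (intro prod.mono_neutral_left) (auto simp: in_keys_iff)

lemma mono_eval_add: "mono_eval z (m + m') = mono_eval z m * mono_eval z m'"
proof -
  let ?A = "keys m \<union> keys m'"
  have "mono_eval z (m + m') = (\<Prod>e\<in>?A. z e ^ lookup (m + m') e)"
    by (rule mono_eval_superset) (use keys_add[of m m'] in auto)
  also have "\<dots> = mono_eval z m * mono_eval z m'"
    by (simp add: mono_eval_superset[of ?A m] mono_eval_superset[of ?A m'] lookup_add power_add prod.distrib)
  finally show ?thesis .
qed

lemma mono_deg_add: "mono_deg (m + m') = mono_deg m + mono_deg m'"
  unfolding mono_deg_def by (rule setsum_keys_plus_distrib) simp_all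

lemma mono_deg_single: "mono_deg (single e r) = r"
  by (simp add: mono_deg_def)

lemma eval_poly_mono: "eval_poly z f = (\<Sum>m\<in>keys f. lookup f m * mono_eval z m)"
  by (simp add: eval_poly_def mono_eval_def)

lemma eval_poly_zero [simp]: "eval_poly z 0 = 0"
  by (simp add: eval_poly_def)

lemma eval_poly_add: "eval_poly z (f + g) = eval_poly z f + eval_poly z g"
  unfolding eval_poly_mono by (rule setsum_keys_plus_distrib) (simp_all add: distrib_right)

lemma eval_poly_single: "eval_poly z (single m c) = c * mono_eval z m"
  by (simp add: eval_poly_mono)

lemma eval_poly_sum: "eval_poly z (\<Sum>i\<in>A. f i) = (\<Sum>i\<in>A. eval_poly z (f i))"
  by (induction A rule: infinite_finite_induct) (simp_all add: eval_poly_add)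

lemma eval_poly_single_mult: "eval_poly z (single m c * f) = c * mono_eval z m * eval_poly z f"
proof -
  have "single m c * f
      = (\<Sum>k\<in>keys f. single (m + k) (c * lookup f k))"
    by (subst (1) poly_mapping_sum_singles[symmetric, of f]) (simp add: sum_distrib_left mult_single)
  then show ?thesis
    by (simp add: eval_poly_sum eval_poly_single mono_eval_add eval_poly_mono[of z f] sum_distrib_left mult_ac)
qed

lemma eval_poly_minus: "eval_poly z (- f) = - eval_poly z f"
  using eval_poly_add[of z f "- f"] by (simp add: eq_neg_iff_add_eq_0 add.commute)

lemma eval_poly_diff: "eval_poly z (f - g) = eval_poly z f - eval_poly z g"
  using eval_poly_add[of z f "- g"] by (simp add: eval_poly_minus)

lemma eval_poly_cong:
  assumes "f \<in> carrier (edge_ring n)" "\<And>e. e \<in> nsets {1..n} 2 \<Longrightarrow> z e = z' e"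
  shows "eval_poly z f = eval_poly z' f"
proof -
  have "mono_eval z m = mono_eval z' m" if "m \<in> keys f" for m
    unfolding mono_eval_def
  proof (intro prod.cong refl)
    fix e assume "e \<in> keys m"
    then have "e \<in> nsets {1..n} 2" using that assms(1) unfolding edge_ring_def by auto
    then show "z e ^ lookup m e = z' e ^ lookup m e" using assms(2) by simp
  qed
  then show ?thesis unfolding eval_poly_mono by simp
qed

subsection \<open>Homogeneous components\<close>

definition hom_part :: "nat \<Rightarrow> mpoly \<Rightarrow> mpoly" where
  "hom_part d f = (\<Sum>m | m \<in> keys f \<and> mono_deg m = d.
     single m (lookup f m))"

lemma lookup_hom_part: "lookup (hom_part d f) m = (if mono_deg m = d then lookup f m else 0)"
proof -
  have "lookup (hom_part d f) m
     = (\<Sum>k | k \<in> keys f \<and> mono_deg k = d. if k = m then lookup f k else 0)"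
    by (simp add: hom_part_def lookup_sum lookup_single when_def)
  also have "\<dots> = (if mono_deg m = d then lookup f m else 0)"
    by (simp add: in_keys_iff)
  finally show ?thesis .
qed

lemma top_component_hom_part: "top_component f = hom_part (total_deg f) f"
  by (simp add: top_component_def hom_part_def)

lemma homogeneous_iff: "homogeneous d f \<longleftrightarrow> (\<forall>m. lookup f m \<noteq> 0 \<longrightarrow> mono_deg m = d)"
  by (auto simp: homogeneous_def in_keys_iff)

lemma homogeneous_hom_part: "homogeneous d (hom_part d f)"
  by (simp add: homogeneous_iff lookup_hom_part)

lemma homogeneous_add: "homogeneous d f \<Longrightarrow> homogeneous d g \<Longrightarrow> homogeneous d (f + g)"
  by (auto simp: homogeneous_iff lookup_add) (metis add_0)

lemma hom_part_homogeneous: "homogeneous d f \<Longrightarrow> hom_part e f = (if e = d then f else 0)"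
  by (rule poly_mapping_eqI) (auto simp: lookup_hom_part homogeneous_iff)

lemma hom_part_zero [simp]: "hom_part d 0 = 0"
  by (simp add: hom_part_def)

lemma hom_part_add: "hom_part d (f + g) = hom_part d f + hom_part d g"
  by (rule poly_mapping_eqI) (simp add: lookup_hom_part lookup_add)

lemma hom_part_sum: "hom_part d (\<Sum>i\<in>A. f i) = (\<Sum>i\<in>A. hom_part d (f i))"
  by (induction A rule: infinite_finite_induct) (simp_all add: hom_part_add)

lemma hom_part_minus: "hom_part d (- f) = - hom_part d f"
  by (rule poly_mapping_eqI) (simp add: lookup_hom_part)

lemma sum_hom_part: "(\<Sum>d\<in>mono_deg ` keys f. hom_part d f) = f"
proof (rule poly_mapping_eqI)
  fix m
  show "lookup (\<Sum>d\<in>mono_deg ` keys f. hom_part d f) m = lookup f m"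
    by (auto simp: lookup_sum lookup_hom_part in_keys_iff)
qed

lemma hom_part_single_mult:
  "hom_part d (single m c * f)
     = (if mono_deg m \<le> d then single m c * hom_part (d - mono_deg m) f else 0)"
proof -
  have single: "single m c * g
      = (\<Sum>k\<in>keys g. single (m + k) (c * lookup g k))" for g :: mpoly
    by (subst (1) poly_mapping_sum_singles[symmetric, of g]) (simp add: sum_distrib_left mult_single)
  have hom: "homogeneous (mono_deg m + e) (single m c * hom_part e f)" for e
    unfolding homogeneous_def
  proof
    fix k assume "k \<in> keys (single m c * hom_part e f)"
    then obtain k' where "k = m + k'" "k' \<in> keys (hom_part e f)"
      using keys_mult[of "single m c" "hom_part e f"] by (auto split: if_splits)
    then show "mono_deg k = mono_deg m + e"
      using homogeneous_hom_part[of e f] by (simp add: mono_deg_add homogeneous_def)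
  qed
  let ?E = "mono_deg ` keys f"
  have "single m c * f = (\<Sum>e\<in>?E. single m c * hom_part e f)"
    by (subst (1) sum_hom_part[symmetric]) (simp add: sum_distrib_left)
  then have "hom_part d (single m c * f)
      = (\<Sum>e\<in>?E. if d = mono_deg m + e then single m c * hom_part e f else 0)"
    by (simp add: hom_part_sum hom_part_homogeneous[OF hom])
  also have "\<dots> = (if mono_deg m \<le> d then single m c * hom_part (d - mono_deg m) f else 0)"
  proof (cases "mono_deg m \<le> d")
    case True
    then have "(\<Sum>e\<in>?E. if d = mono_deg m + e then single m c * hom_part e f else 0)
       = (\<Sum>e\<in>?E. if e = d - mono_deg m then single m c * hom_part e f else 0)"
      by (intro sum.cong refl) auto
    also have "\<dots> = single m c * hom_part (d - mono_deg m) f"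
    proof (cases "d - mono_deg m \<in> ?E")
      case False
      then have "hom_part (d - mono_deg m) f = 0"
        by (intro poly_mapping_eqI) (auto simp: lookup_hom_part image_iff Ball_def in_keys_iff)
      with False show ?thesis by simp
    qed simp
    finally show ?thesis using True by simp
  qed auto
  finally show ?thesis .
qed

subsection \<open>The polynomial ring\<close>

lemma edge_ring_carrier:
  "f \<in> carrier (edge_ring n) \<longleftrightarrow> (\<forall>m. lookup f m \<noteq> 0 \<longrightarrow> keys m \<subseteq> nsets {1..n} 2)"
  by (auto simp: edge_ring_def in_keys_iff)

lemma edge_ring_ops [simp]:
  "mult (edge_ring n) = (*)" "one (edge_ring n) = 1" "zero (edge_ring n) = 0" "add (edge_ring n) = (+)"
  by (simp_all add: edge_ring_def)

lemma edge_ring_closed: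
  shows "0 \<in> carrier (edge_ring n)" "1 \<in> carrier (edge_ring n)"
    and "f \<in> carrier (edge_ring n) \<Longrightarrow> g \<in> carrier (edge_ring n) \<Longrightarrow> f + g \<in> carrier (edge_ring n)"
    and "f \<in> carrier (edge_ring n) \<Longrightarrow> - f \<in> carrier (edge_ring n)"
    and "f \<in> carrier (edge_ring n) \<Longrightarrow> g \<in> carrier (edge_ring n) \<Longrightarrow> f * g \<in> carrier (edge_ring n)"
    and "keys m \<subseteq> nsets {1..n} 2 \<Longrightarrow> single m c \<in> carrier (edge_ring n)"
    and "f \<in> carrier (edge_ring n) \<Longrightarrow> hom_part d f \<in> carrier (edge_ring n)"
proof -
  show "f * g \<in> carrier (edge_ring n)" if "f \<in> carrier (edge_ring n)" "g \<in> carrier (edge_ring n)"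
    unfolding edge_ring_def partial_object.simps mem_Collect_eq
  proof
    fix m assume "m \<in> keys (f * g)"
    then obtain k l where kl: "m = k + l" "k \<in> keys f" "l \<in> keys g"
      using keys_mult[of f g] by auto
    have "keys k \<subseteq> nsets {1..n} 2" "keys l \<subseteq> nsets {1..n} 2"
      using kl(2,3) that unfolding edge_ring_def by simp_all
    then show "keys m \<subseteq> nsets {1..n} 2"
      unfolding kl(1) using keys_add[of k l] by blast
  qed
  show "f + g \<in> carrier (edge_ring n)" if "f \<in> carrier (edge_ring n)" "g \<in> carrier (edge_ring n)"
    unfolding edge_ring_carrier
  proof (intro allI impI)
    fix m assume "lookup (f + g) m \<noteq> 0"
    then have "lookup f m \<noteq> 0 \<or> lookup g m \<noteq> 0" by (auto simp: lookup_add)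
    then show "keys m \<subseteq> nsets {1..n} 2" using that unfolding edge_ring_carrier by blast
  qed
qed (simp_all add: edge_ring_carrier lookup_one lookup_single lookup_hom_part when_def)

lemma edge_ring_diff: "f \<in> carrier (edge_ring n) \<Longrightarrow> g \<in> carrier (edge_ring n) \<Longrightarrow> f - g \<in> carrier (edge_ring n)"
  using edge_ring_closed(3)[of f n "- g"] edge_ring_closed(4)[of g n] by simp

lemma edge_ring_cring: "cring (edge_ring n)"
proof (rule cringI)
  show "abelian_group (edge_ring n)"
  proof (rule abelian_groupI)
    fix x assume x: "x \<in> carrier (edge_ring n)"
    show "\<exists>y\<in>carrier (edge_ring n). y \<oplus>\<^bsub>edge_ring n\<^esub> x = \<zero>\<^bsub>edge_ring n\<^esub>"
      by (rule bexI[of _ "- x"]) (simp_all add: x edge_ring_closed)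
  qed (simp_all add: edge_ring_closed add.assoc add.commute)
  show "Group.comm_monoid (edge_ring n)"
    by (rule comm_monoidI) (simp_all add: edge_ring_closed mult.assoc mult.commute)
qed (simp_all add: distrib_right)

lemma edge_ring_ring: "ring (edge_ring n)"
  using edge_ring_cring by (rule cring.axioms(1))

section \<open>Evaluation on the slice\<close>

text \<open>
  The value of a polynomial at the point of the set partition with the blocks \<open>B\<close> and
  \<open>{1..2 * a} - B\<close>, by \<open>partition_point_eval\<close>.
\<close>

abbreviation evB :: "mpoly \<Rightarrow> nat set \<Rightarrow> complex" where
  "evB f \<equiv> (\<lambda>B. eval_poly (\<lambda>e. (1 + chi e B) / 2) f)"

lemma edge_elim:
  assumes "e \<in> nsets {1..n} 2"
  obtains x y where "e = {x, y}" "x \<noteq> y" "x \<in> {1..n}" "y \<in> {1..n}"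
proof -
  have "card e = 2" "e \<subseteq> {1..n}" using assms by (auto simp: nsets_def)
  then obtain x y where "e = {x, y}" "x \<noteq> y" by (auto simp: card_2_iff)
  with \<open>e \<subseteq> {1..n}\<close> show ?thesis by (intro that[of x y]) auto
qed

lemma low_edge:
  assumes e: "e \<in> nsets {1..2 * a} 2" and f: "f \<in> low a j"
  shows "(\<lambda>B. (1 + chi e B) / 2 * f B) \<in> low a (j + 2)"
proof -
  obtain x y where xy: "e = {x, y}" "x \<noteq> y" "x \<in> {1..2 * a}" "y \<in> {1..2 * a}"
    using e by (rule edge_elim)
  have "(\<lambda>B. eps x B * (eps y B * f B)) \<in> low a (Suc (Suc j))"
    using xy f by (intro low_eps) auto
  then have "fscale (1 / 2) (f + (\<lambda>B. eps x B * (eps y B * f B))) \<in> low a (j + 2)"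
    using low_mono f by (intro low_scale low_add) auto
  moreover have "(1 + chi e B) / 2 * f B = 1 / 2 * (f + (\<lambda>B. eps x B * (eps y B * f B))) B" for B
    using xy by (simp add: chi_def algebra_simps)
  ultimately show ?thesis by (simp only:)
qed

lemma low_edge_power:
  assumes e: "e \<in> nsets {1..2 * a} 2" and f: "f \<in> low a j"
  shows "(\<lambda>B. ((1 + chi e B) / 2) ^ r * f B) \<in> low a (j + 2 * r)"
proof (induction r)
  case 0 then show ?case using f by simp
next
  case (Suc r)
  have "(\<lambda>B. (1 + chi e B) / 2 * (((1 + chi e B) / 2) ^ r * f B)) \<in> low a (j + 2 * r + 2)"
    by (rule low_edge[OF e Suc])
  then show ?case by (simp only: power_Suc mult.assoc) (simp add: algebra_simps)
qed

lemma low_mono_eval: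
  assumes m: "keys m \<subseteq> nsets {1..2 * a} 2" and f: "f \<in> low a j"
  shows "(\<lambda>B. mono_eval (\<lambda>e. (1 + chi e B) / 2) m * f B) \<in> low a (j + 2 * mono_deg m)"
proof -
  have "(\<lambda>B. (\<Prod>e\<in>A. ((1 + chi e B) / 2) ^ lookup m e) * f B)
      \<in> low a (j + 2 * (\<Sum>e\<in>A. lookup m e))" if "finite A" "A \<subseteq> nsets {1..2 * a} 2" for A
    using that
  proof (induction A rule: finite_induct)
    case empty then show ?case using f by simp
  next
    case (insert e A)
    have "(\<lambda>B. ((1 + chi e B) / 2) ^ lookup m e *
        ((\<Prod>e\<in>A. ((1 + chi e B) / 2) ^ lookup m e) * f B))
      \<in> low a (j + 2 * (\<Sum>e\<in>A. lookup m e) + 2 * lookup m e)"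
      using insert by (intro low_edge_power) auto
    then show ?case
      using insert by (simp add: mult.assoc algebra_simps)
  qed
  from this[OF finite_keys m] show ?thesis
    by (simp only: mono_eval_def mono_deg_def)
qed

lemma low_mono_le: "i \<le> d \<Longrightarrow> low a (2 * i) \<subseteq> low a (2 * d)"
proof (induction rule: dec_induct)
  case (step d)
  then show ?case using low_mono[of a "2 * d"] by simp
qed simp

lemma low_degree:
  assumes f: "f \<in> carrier (edge_ring (2 * a))" and d: "\<And>m. m \<in> keys f \<Longrightarrow> mono_deg m < d"
  shows "evB f \<in> low a (2 * d)"
proof -
  have "(\<lambda>B. mono_eval (\<lambda>e. (1 + chi e B) / 2) m) \<in> low a (2 * d)" if m: "m \<in> keys f" for m
  proof -
    have "chi {} \<in> low a 2" by (rule low_chi) simp_all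
    moreover have "keys m \<subseteq> nsets {1..2 * a} 2" using f m by (simp add: edge_ring_def)
    ultimately have "(\<lambda>B. mono_eval (\<lambda>e. (1 + chi e B) / 2) m * chi {} B) \<in> low a (2 + 2 * mono_deg m)"
      by (intro low_mono_eval)
    moreover have "low a (2 + 2 * mono_deg m) \<subseteq> low a (2 * d)"
      using low_mono_le[of "Suc (mono_deg m)" d a] d[OF m] by simp
    ultimately show ?thesis by (auto simp: chi_def)
  qed
  then have "(\<Sum>m\<in>keys f. fscale (lookup f m) (\<lambda>B. mono_eval (\<lambda>e. (1 + chi e B) / 2) m)) \<in> low a (2 * d)"
    by (intro low_sum low_scale)
  moreover have "evB f = (\<Sum>m\<in>keys f. fscale (lookup f m) (\<lambda>B. mono_eval (\<lambda>e. (1 + chi e B) / 2) m))"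
    by (simp add: fun_eq_iff eval_poly_mono sum_fun_apply)
  ultimately show ?thesis by (simp only:)
qed

lemma chi_polynomial:
  assumes "U \<subseteq> {1..2 * a}" "card U = 2 * i"
  shows "\<exists>h\<in>carrier (edge_ring (2 * a)). (\<forall>m\<in>keys h. mono_deg m \<le> i) \<and> evB h = chi U"
  using assms
proof (induction i arbitrary: U)
  case 0
  then have "U = {}" by (metis card_0_eq finite_atLeastAtMost finite_subset mult_0_right)
  moreover have "evB 1 = chi {}"
    by (simp add: fun_eq_iff chi_def eval_poly_def)
  ultimately show ?case
    by (intro bexI[of _ 1]) (simp_all add: edge_ring_closed mono_deg_def)
next
  case (Suc i)
  have fin: "finite U" using Suc.prems(1) finite_subset by blast
  obtain x where x: "x \<in> U" using Suc.prems(2) by fastforce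
  have c1: "card (U - {x}) = Suc (2 * i)" using Suc.prems(2) x fin by simp
  have "U - {x} \<noteq> {}" using c1 by (metis card.empty nat.distinct(1))
  then obtain y where y: "y \<in> U - {x}" by blast
  define U' where "U' = U - {x} - {y}"
  have U': "card U' = 2 * i" "U' \<subseteq> {1..2 * a}" "finite U'" "x \<notin> U'" "y \<notin> U'" "x \<noteq> y" "U = insert x (insert y U')"
    using c1 y fin Suc.prems(1) x by (auto simp: U'_def)
  obtain h where h: "h \<in> carrier (edge_ring (2 * a))" "\<forall>m\<in>keys h. mono_deg m \<le> i" "evB h = chi U'"
    using Suc.IH[OF U'(2,1)] by blast
  have xy: "{x, y} \<in> nsets {1..2 * a} 2"
    using x y Suc.prems(1) by (auto simp: nsets_def)
  let ?s = "single (single {x, y} 1) 2 :: mpoly"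
  have s: "?s \<in> carrier (edge_ring (2 * a))" using xy by (intro edge_ring_closed) simp
  have "?s * h - h \<in> carrier (edge_ring (2 * a))"
    using edge_ring_diff[OF edge_ring_closed(5)[OF s h(1)] h(1)] .
  moreover have "mono_deg m \<le> Suc i" if "m \<in> keys (?s * h - h)" for m
  proof (cases "m \<in> keys h")
    case True then show ?thesis using h(2) by (simp add: le_SucI)
  next
    case False
    then have "m \<in> keys (?s * h)" using that by (simp add: in_keys_iff lookup_minus)
    then obtain k where k: "m = single {x, y} 1 + k" "k \<in> keys h"
      using keys_mult[of ?s h] by auto
    then have "mono_deg m = 1 + mono_deg k" by (simp only: mono_deg_add mono_deg_single)
    then show ?thesis using h(2) k(2) by simp
  qed
  moreover have "evB (?s * h - h) = chi U"
  proof
    fix B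
    have hB: "eval_poly (\<lambda>e. (1 + chi e B) / 2) h = chi U' B" using h(3) by (rule fun_cong)
    have "chi U B = eps x B * (eps y B * chi U' B)"
      using U' by (simp add: chi_def)
    moreover have "chi {x, y} B = eps x B * eps y B" using U'(6) by (simp add: chi_def)
    moreover have "mono_eval (\<lambda>e. (1 + chi e B) / 2) (single {x, y} 1) = (1 + chi {x, y} B) / 2"
      by (simp add: mono_eval_def)
    ultimately show "eval_poly (\<lambda>e. (1 + chi e B) / 2) (?s * h - h) = chi U B"
      by (simp only: eval_poly_diff eval_poly_single_mult hB) (simp add: algebra_simps)
  qed
  ultimately show ?case by (intro bexI[of _ "?s * h - h"]) simp_all
qed

text \<open>
  Conversely to \<open>low_degree\<close>, functions in \<open>low a (2 * d)\<close> come from polynomials of degree less than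
  \<open>d\<close>, since \<open>chi {x, y}\<close> is the value of \<open>2 * e - 1\<close> where \<open>e\<close> is the variable of \<open>{x, y}\<close>.
\<close>

lemma low_polynomial:
  assumes "f \<in> low a (2 * d)"
  shows "\<exists>h\<in>carrier (edge_ring (2 * a)). (\<forall>m\<in>keys h. mono_deg m < d) \<and> (\<forall>B\<in>halves a. evB h B = f B)"
proof -
  define P where "P h \<longleftrightarrow> h \<in> carrier (edge_ring (2 * a)) \<and> (\<forall>m. lookup h m \<noteq> 0 \<longrightarrow> mono_deg m < d)" for h
  define D where "D = {f. \<exists>h. P h \<and> (\<forall>B\<in>halves a. evB h B = f B)}"
  have P0: "P 0" by (simp add: P_def edge_ring_closed)
  have "low a (2 * d) \<subseteq> D"
  proof (rule low_least)
    show "fn.subspace D"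
    proof (rule fn.subspaceI)
      show "0 \<in> D" unfolding D_def using P0 by (auto intro!: exI[of _ 0])
    next
      fix f g assume "f \<in> D" "g \<in> D"
      then obtain h h' where h: "P h" "\<forall>B\<in>halves a. evB h B = f B" "P h'" "\<forall>B\<in>halves a. evB h' B = g B"
        unfolding D_def by blast
      have "P (h + h')" using h(1,3) unfolding P_def lookup_add
        by (metis edge_ring_closed(3) add_0)
      moreover have "\<forall>B\<in>halves a. evB (h + h') B = (f + g) B" using h by (simp add: eval_poly_add)
      ultimately show "f + g \<in> D" unfolding D_def by blast
    next
      fix c f assume "f \<in> D"
      then obtain h where h: "P h" "\<forall>B\<in>halves a. evB h B = f B" unfolding D_def by blast
      have eq: "pscale c h = single 0 c * h" by (rule mult_map_scale_conv_mult)
      have "P (pscale c h)"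
        using h(1) unfolding P_def edge_ring_carrier lookup_pscale by auto
      moreover have "\<forall>B\<in>halves a. evB (pscale c h) B = c * f B"
        using h(2) unfolding eq eval_poly_single_mult by (simp add: mono_eval_def)
      ultimately show "fscale c f \<in> D" unfolding D_def by blast
    qed
  next
    fix U assume U: "U \<subseteq> {1..2 * a}" "card U < 2 * d" "even (card U + 2 * d)"
    then obtain i where i: "card U = 2 * i" by (auto elim!: evenE)
    obtain h where "h \<in> carrier (edge_ring (2 * a))" "\<forall>m\<in>keys h. mono_deg m \<le> i" "evB h = chi U"
      using chi_polynomial[OF U(1) i] by blast
    moreover from this have "P h" unfolding P_def using U(2) i by (force simp: in_keys_iff)
    ultimately show "chi U \<in> D" unfolding D_def by (auto simp: fun_eq_iff)
  next
    fix f :: "nat set \<Rightarrow> complex" assume "\<And>B. B \<in> halves a \<Longrightarrow> f B = 0"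
    then show "f \<in> D" unfolding D_def using P0 by (auto intro!: exI[of _ 0])
  qed
  then have "f \<in> D" using assms by blast
  then show ?thesis unfolding D_def P_def by (auto simp: in_keys_iff)
qed

section \<open>The associated graded ideal\<close>

lemma partition_point_eval:
  assumes B: "B \<subseteq> {1..2 * a}" and e: "e \<in> nsets {1..2 * a} 2"
  shows "partition_point (2 * a) {B, {1..2 * a} - B} e = (1 + chi e B) / 2"
proof -
  obtain x y where "e = {x, y}" "x \<noteq> y" "x \<in> {1..2 * a}" "y \<in> {1..2 * a}"
    using e by (rule edge_elim)
  then show ?thesis
    using e by (auto simp: partition_point_def chi_def eps_def)
qed

text \<open>
  For \<open>a = 0\<close> both halves are empty and do not form two blocks.
\<close>

lemma two_block_partitions:
  assumes "a \<ge> 1"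
  shows "{\<pi>. partition_on {1..2 * a} \<pi> \<and> card \<pi> = 2 \<and> (\<forall>B\<in>\<pi>. card B = a)}
    = (\<lambda>B. {B, {1..2 * a} - B}) ` halves a"
proof (intro subset_antisym subsetI)
  fix \<pi> assume "\<pi> \<in> {\<pi>. partition_on {1..2 * a} \<pi> \<and> card \<pi> = 2 \<and> (\<forall>B\<in>\<pi>. card B = a)}"
  then have p: "partition_on {1..2 * a} \<pi>" "card \<pi> = 2" "\<forall>B\<in>\<pi>. card B = a" by auto
  then obtain B C where BC: "\<pi> = {B, C}" "B \<noteq> C" by (auto simp: card_2_iff)
  have "B \<union> C = {1..2 * a}" "B \<inter> C = {}"
    using p(1) BC by (auto simp: partition_on_def disjoint_def)
  then have "C = {1..2 * a} - B" "B \<subseteq> {1..2 * a}" by auto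
  then show "\<pi> \<in> (\<lambda>B. {B, {1..2 * a} - B}) ` halves a"
    using p(3) BC by (auto simp: halves_def)
next
  fix \<pi> assume "\<pi> \<in> (\<lambda>B. {B, {1..2 * a} - B}) ` halves a"
  then obtain B where B: "B \<subseteq> {1..2 * a}" "card B = a" "\<pi> = {B, {1..2 * a} - B}"
    by (auto simp: halves_def)
  have fin: "finite B" using B(1) finite_subset by blast
  have c: "card ({1..2 * a} - B) = a" using B fin by (simp add: card_Diff_subset)
  have ne: "B \<noteq> {}" "{1..2 * a} - B \<noteq> {}" using B(2) c assms by (metis card.empty not_one_le_zero)+
  then have "B \<noteq> {1..2 * a} - B" by blast
  then have "card \<pi> = 2" using B(3) by simp
  moreover have "partition_on {1..2 * a} \<pi>"
    using B(1,3) ne by (auto simp: partition_on_def disjoint_def)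
  ultimately show "\<pi> \<in> {\<pi>. partition_on {1..2 * a} \<pi> \<and> card \<pi> = 2 \<and> (\<forall>B\<in>\<pi>. card B = a)}"
    using B c by simp
qed

lemma vanishing_ideal_halves:
  assumes "a \<ge> 1"
  shows "vanishing_ideal (2 * a) (Pi_two_blocks a)
    = {f \<in> carrier (edge_ring (2 * a)). \<forall>B\<in>halves a. evB f B = 0}"
proof -
  have "eval_poly (partition_point (2 * a) {B, {1..2 * a} - B}) f = evB f B"
    if "f \<in> carrier (edge_ring (2 * a))" "B \<in> halves a" for f B
    using that partition_point_eval[of B a] by (intro eval_poly_cong) (auto simp: halves_def)
  then show ?thesis
    unfolding vanishing_ideal_def Pi_two_blocks_def two_block_partitions[OF assms] by auto
qed

text \<open>
  The explicit form of the associated graded ideal: every homogeneous component restricts to a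
  function that is also given by a polynomial of smaller degree.
\<close>

definition leading_low :: "nat \<Rightarrow> mpoly set" where
  "leading_low a = {f \<in> carrier (edge_ring (2 * a)). \<forall>d. evB (hom_part d f) \<in> low a (2 * d)}"

lemma leading_low_homogeneous:
  assumes "f \<in> carrier (edge_ring (2 * a))" "homogeneous d f"
  shows "f \<in> leading_low a \<longleftrightarrow> evB f \<in> low a (2 * d)"
proof -
  have "evB 0 \<in> low a j" for j by (rule low_vanishing) simp
  then show ?thesis
    using assms unfolding leading_low_def
    by (auto simp: hom_part_homogeneous[OF assms(2)] split: if_splits)
qed

lemma evB_add: "evB (f + g) = evB f + evB g"
  by (simp add: fun_eq_iff eval_poly_add)

lemma evB_diff: "evB (f - g) = evB f - evB g"
  by (simp add: fun_eq_iff eval_poly_diff)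

lemma leading_low_closed:
  shows "0 \<in> leading_low a"
    and "f \<in> leading_low a \<Longrightarrow> g \<in> leading_low a \<Longrightarrow> f + g \<in> leading_low a"
    and "f \<in> leading_low a \<Longrightarrow> - f \<in> leading_low a"
proof -
  show "0 \<in> leading_low a"
    unfolding leading_low_def by (simp add: edge_ring_closed) (auto intro: low_vanishing)
  show "f + g \<in> leading_low a" if "f \<in> leading_low a" "g \<in> leading_low a"
    using that unfolding leading_low_def
    by (simp add: edge_ring_closed hom_part_add) (simp only: evB_add low_add simp_thms)
  show "- f \<in> leading_low a" if "f \<in> leading_low a"
  proof -
    have "evB (hom_part d (- f)) \<in> low a (2 * d)" for d
    proof -
      have "evB (hom_part d f) \<in> low a (2 * d)" using that unfolding leading_low_def by blast
      then have "fscale (- 1) (evB (hom_part d f)) \<in> low a (2 * d)" by (rule low_scale)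
      then show ?thesis by (simp add: hom_part_minus eval_poly_minus)
    qed
    then show ?thesis using that unfolding leading_low_def by (simp add: edge_ring_closed)
  qed
qed

lemma leading_low_sum: "(\<And>i. i \<in> A \<Longrightarrow> f i \<in> leading_low a) \<Longrightarrow> (\<Sum>i\<in>A. f i) \<in> leading_low a"
  by (induction A rule: infinite_finite_induct) (simp_all add: leading_low_closed)

lemma leading_low_single_mult:
  assumes m: "keys m \<subseteq> nsets {1..2 * a} 2" and f: "f \<in> leading_low a"
  shows "single m c * f \<in> leading_low a"
proof -
  have fc: "f \<in> carrier (edge_ring (2 * a))" and fl: "\<And>d. evB (hom_part d f) \<in> low a (2 * d)"
    using f unfolding leading_low_def by auto
  have "evB (hom_part d (single m c * f)) \<in> low a (2 * d)" for d
  proof (cases "mono_deg m \<le> d")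
    case True
    have "fscale c (\<lambda>B. mono_eval (\<lambda>e. (1 + chi e B) / 2) m * evB (hom_part (d - mono_deg m) f) B)
        \<in> low a (2 * (d - mono_deg m) + 2 * mono_deg m)"
      by (intro low_scale low_mono_eval[OF m] fl)
    moreover have "2 * (d - mono_deg m) + 2 * mono_deg m = 2 * d" using True by simp
    ultimately show ?thesis
      using True by (simp add: hom_part_single_mult eval_poly_single_mult mult.assoc)
  next
    case False
    then show ?thesis by (simp add: hom_part_single_mult) (auto intro: low_vanishing)
  qed
  moreover have "single m c * f \<in> carrier (edge_ring (2 * a))"
    by (rule edge_ring_closed(5)[OF edge_ring_closed(6)[OF m] fc])
  ultimately show ?thesis unfolding leading_low_def by blast
qed

lemma leading_low_mult:
  assumes g: "g \<in> carrier (edge_ring (2 * a))" and f: "f \<in> leading_low a"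
  shows "g * f \<in> leading_low a"
proof -
  have "(\<Sum>m\<in>keys g. single m (lookup g m) * f) \<in> leading_low a"
  proof (intro leading_low_sum leading_low_single_mult f)
    fix m assume "m \<in> keys g"
    then show "keys m \<subseteq> nsets {1..2 * a} 2" using g unfolding edge_ring_def by simp
  qed
  then show ?thesis by (simp only: sum_distrib_right[symmetric] poly_mapping_sum_singles)
qed

lemma leading_low_ideal: "ideal (leading_low a) (edge_ring (2 * a))"
proof (rule idealI[OF edge_ring_ring])
  show "subgroup (leading_low a) (add_monoid (edge_ring (2 * a)))"
  proof (rule group.subgroupI)
    show "group (add_monoid (edge_ring (2 * a)))"
      using abelian_group.a_group[OF ring.is_abelian_group[OF edge_ring_ring]] .
    show "leading_low a \<subseteq> carrier (add_monoid (edge_ring (2 * a)))" by (auto simp: leading_low_def)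
    show "leading_low a \<noteq> {}" using leading_low_closed(1) by blast
    fix f assume f: "f \<in> leading_low a"
    have fc: "f \<in> carrier (edge_ring (2 * a))" using f by (simp add: leading_low_def)
    have "\<ominus>\<^bsub>edge_ring (2 * a)\<^esub> f = - f"
      using abelian_group.minus_equality[OF ring.is_abelian_group[OF edge_ring_ring[of "2 * a"]], of "- f" f] fc
      by (simp add: edge_ring_closed)
    then show "inv\<^bsub>add_monoid (edge_ring (2 * a))\<^esub> f \<in> leading_low a"
      using leading_low_closed(3)[OF f] by (simp add: a_inv_def)
    fix g assume "g \<in> leading_low a"
    then show "f \<otimes>\<^bsub>add_monoid (edge_ring (2 * a))\<^esub> g \<in> leading_low a"
      using f by (simp add: leading_low_closed)
  qed
next
  fix f g assume "f \<in> leading_low a" "g \<in> carrier (edge_ring (2 * a))"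
  then show "g \<otimes>\<^bsub>edge_ring (2 * a)\<^esub> f \<in> leading_low a" "f \<otimes>\<^bsub>edge_ring (2 * a)\<^esub> g \<in> leading_low a"
    by (simp_all add: leading_low_mult mult.commute[of f])
qed

text \<open>
  If \<open>f\<close> vanishes on the points, its top component agrees there with minus the remaining terms.
\<close>

lemma top_component_in_leading_low:
  assumes f: "f \<in> carrier (edge_ring (2 * a))" and z: "\<And>B. B \<in> halves a \<Longrightarrow> evB f B = 0"
  shows "top_component f \<in> leading_low a"
proof -
  let ?D = "total_deg f" and ?t = "top_component f"
  have t: "?t = hom_part ?D f" by (rule top_component_hom_part)
  have tc: "?t \<in> carrier (edge_ring (2 * a))" unfolding t using f by (rule edge_ring_closed(7))
  have "mono_deg m < ?D" if m: "m \<in> keys (f - ?t)" for m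
  proof -
    have l: "lookup f m \<noteq> 0" "mono_deg m \<noteq> ?D"
      using m by (auto simp: in_keys_iff lookup_minus t lookup_hom_part split: if_splits)
    then have "mono_deg m \<le> ?D"
      unfolding total_deg_def by (intro Max_ge) (auto simp: in_keys_iff)
    then show ?thesis using l by simp
  qed
  then have "evB (f - ?t) \<in> low a (2 * ?D)"
    using edge_ring_diff[OF f tc] by (intro low_degree)
  then have "fscale (- 1) (evB (f - ?t)) \<in> low a (2 * ?D)" by (rule low_scale)
  then have "evB ?t \<in> low a (2 * ?D)"
    by (rule low_cong) (simp add: eval_poly_diff z)
  then show ?thesis
    using leading_low_homogeneous[OF tc, of ?D] homogeneous_hom_part[of ?D f] t by simp
qed

text \<open>
  Subtracting from \<open>f\<close> a polynomial of smaller degree with the same values gives a polynomial that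
  vanishes on the points and has \<open>f\<close> as its top component.
\<close>

lemma homogeneous_low_is_top_component:
  assumes f: "f \<in> carrier (edge_ring (2 * a))" "homogeneous d f" "f \<noteq> 0" and l: "evB f \<in> low a (2 * d)"
  shows "\<exists>g\<in>carrier (edge_ring (2 * a)). g \<noteq> 0 \<and> (\<forall>B\<in>halves a. evB g B = 0) \<and> f = top_component g"
proof -
  obtain h where h: "h \<in> carrier (edge_ring (2 * a))" "\<forall>m\<in>keys h. mono_deg m < d"
    "\<forall>B\<in>halves a. evB h B = evB f B"
    using low_polynomial[OF l] by blast
  define g where "g = f - h"
  have hd: "lookup h m = 0" if "mono_deg m \<ge> d" for m
    using h(2) that by (metis in_keys_iff not_le)
  have fd: "lookup f m = 0" if "mono_deg m \<noteq> d" for m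
    using f(2) that by (auto simp: homogeneous_iff)
  obtain m where m: "lookup f m \<noteq> 0"
    using f(3) by (metis lookup_zero poly_mapping_eqI)
  then have md: "mono_deg m = d" using fd by blast
  have mg: "m \<in> keys g" using m md hd[of m] by (simp add: g_def in_keys_iff lookup_minus)
  have "total_deg g = d"
    unfolding total_deg_def
  proof (rule Max_eqI)
    show "d \<in> mono_deg ` keys g" using mg md by blast
    fix y assume "y \<in> mono_deg ` keys g"
    then obtain k where k: "y = mono_deg k" "lookup g k \<noteq> 0" by (auto simp: in_keys_iff)
    then show "y \<le> d" using hd[of k] fd[of k] by (force simp: g_def lookup_minus)
  qed simp
  then have "top_component g = f"
    unfolding top_component_hom_part
    by (intro poly_mapping_eqI) (auto simp: lookup_hom_part g_def lookup_minus hd fd)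
  moreover have "g \<in> carrier (edge_ring (2 * a))" unfolding g_def using f(1) h(1) by (rule edge_ring_diff)
  moreover have "\<forall>B\<in>halves a. evB g B = 0" using h(3) by (simp add: g_def eval_poly_diff)
  moreover have "g \<noteq> 0" using mg by auto
  ultimately show ?thesis by (intro bexI[of _ g]) simp_all
qed

lemma gr_ideal_eq:
  assumes a: "a \<ge> 1"
  shows "gr_ideal (2 * a) (Pi_two_blocks a) = leading_low a"
proof
  let ?R = "edge_ring (2 * a)"
  let ?T = "{top_component f | f. f \<in> vanishing_ideal (2 * a) (Pi_two_blocks a) \<and> f \<noteq> 0}"
  have T: "?T \<subseteq> leading_low a"
    unfolding vanishing_ideal_halves[OF a] using top_component_in_leading_low by auto
  then show "gr_ideal (2 * a) (Pi_two_blocks a) \<subseteq> leading_low a"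
    unfolding gr_ideal_def by (rule ring.genideal_minimal[OF edge_ring_ring leading_low_ideal])
  have Tc: "?T \<subseteq> carrier ?R" using T by (auto simp: leading_low_def)
  have id: "ideal (gr_ideal (2 * a) (Pi_two_blocks a)) ?R"
    unfolding gr_ideal_def by (rule ring.genideal_ideal[OF edge_ring_ring Tc])
  have T_gr: "?T \<subseteq> gr_ideal (2 * a) (Pi_two_blocks a)"
    unfolding gr_ideal_def by (rule ring.genideal_self[OF edge_ring_ring Tc])
  have zero: "0 \<in> gr_ideal (2 * a) (Pi_two_blocks a)"
    using additive_subgroup.zero_closed[OF ideal.axioms(1)[OF id]] by simp
  have add: "f + g \<in> gr_ideal (2 * a) (Pi_two_blocks a)"
    if "f \<in> gr_ideal (2 * a) (Pi_two_blocks a)" "g \<in> gr_ideal (2 * a) (Pi_two_blocks a)" for f g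
    using additive_subgroup.a_closed[OF ideal.axioms(1)[OF id] that] by simp
  show "leading_low a \<subseteq> gr_ideal (2 * a) (Pi_two_blocks a)"
  proof
    fix f assume "f \<in> leading_low a"
    then have f: "f \<in> carrier ?R" "\<And>d. evB (hom_part d f) \<in> low a (2 * d)" by (auto simp: leading_low_def)
    have part: "hom_part d f \<in> gr_ideal (2 * a) (Pi_two_blocks a)" for d
    proof (cases "hom_part d f = 0")
      case False
      then obtain g where g: "g \<in> carrier ?R" "g \<noteq> 0" "\<forall>B\<in>halves a. evB g B = 0" "hom_part d f = top_component g"
        using homogeneous_low_is_top_component[OF edge_ring_closed(7)[OF f(1)] homogeneous_hom_part False f(2)] by blast
      then have "g \<in> vanishing_ideal (2 * a) (Pi_two_blocks a)"
        unfolding vanishing_ideal_halves[OF a] by simp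
      then have "hom_part d f \<in> ?T" using g by blast
      then show ?thesis using T_gr by blast
    qed (simp add: zero)
    have "(\<Sum>d\<in>A. hom_part d f) \<in> gr_ideal (2 * a) (Pi_two_blocks a)" for A
      by (induction A rule: infinite_finite_induct) (simp_all add: zero add part)
    from this[of "mono_deg ` keys f"] show "f \<in> gr_ideal (2 * a) (Pi_two_blocks a)"
      by (simp only: sum_hom_part)
  qed
qed

subsection \<open>The action of permutations\<close>

lemma inj_image_monomial: "inj w \<Longrightarrow> inj (push ((`) w) :: monomial \<Rightarrow> monomial)"
  by (intro inj_push) (auto intro!: injI simp: inj_image_eq_iff)

lemma keys_act_poly:
  assumes "inj w"
  shows "keys (act_poly w f) = push ((`) w) ` keys f"
  unfolding act_poly_def by (rule keys_push_inj[OF inj_image_monomial[OF assms]])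

lemma act_poly_add: "act_poly w (f + g) = act_poly w f + act_poly w g"
  by (simp add: act_poly_def push_add)

lemma act_poly_sum: "act_poly w (\<Sum>i\<in>A. f i) = (\<Sum>i\<in>A. act_poly w (f i))"
  by (simp add: act_poly_def push_sum)

lemma keys_push_image:
  assumes "inj w"
  shows "keys (push ((`) w) m) = (`) w ` keys m"
  using assms by (intro keys_push_inj) (auto intro!: injI simp: inj_image_eq_iff)

lemma lookup_push_image:
  assumes "inj w"
  shows "lookup (push ((`) w) m) (w ` e) = lookup m e"
  using assms by (intro lookup_push_inj) (auto intro!: injI simp: inj_image_eq_iff)

lemma mono_deg_push:
  assumes "inj w"
  shows "mono_deg (push ((`) w) m) = mono_deg m"
proof -
  have "inj_on ((`) w) (keys m)"
    using assms by (auto intro!: inj_onI simp: inj_image_eq_iff)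
  then show ?thesis
    unfolding mono_deg_def keys_push_image[OF assms]
    by (simp add: sum.reindex lookup_push_image[OF assms])
qed

lemma mono_eval_push:
  assumes "inj w"
  shows "mono_eval z (push ((`) w) m) = mono_eval (\<lambda>e. z (w ` e)) m"
proof -
  have "inj_on ((`) w) (keys m)"
    using assms by (auto intro!: inj_onI simp: inj_image_eq_iff)
  then show ?thesis
    unfolding mono_eval_def keys_push_image[OF assms]
    by (simp add: prod.reindex lookup_push_image[OF assms])
qed

lemma eval_act_poly:
  assumes "inj w"
  shows "eval_poly z (act_poly w f) = eval_poly (\<lambda>e. z (w ` e)) f"
proof -
  note inj = inj_image_monomial[OF assms]
  have "inj_on (push ((`) w)) (keys f)" using inj by (rule inj_on_subset) simp
  then show ?thesis
    unfolding eval_poly_mono keys_act_poly[OF assms]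
    by (simp add: sum.reindex act_poly_def lookup_push_inj[OF inj] mono_eval_push[OF assms])
qed

lemma evB_act_poly:
  assumes "w permutes {1..2 * a}"
  shows "evB (act_poly w f) = (\<lambda>B. evB f (pinv w ` B))"
  by (simp add: eval_act_poly[OF permutes_inj[OF assms]] chi_pinv[OF assms])

lemma act_poly_carrier:
  assumes w: "w permutes {1..n}" and f: "f \<in> carrier (edge_ring n)"
  shows "act_poly w f \<in> carrier (edge_ring n)"
proof -
  have "w ` e \<in> nsets {1..n} 2" if "e \<in> nsets {1..n} 2" for e
  proof -
    have "w ` e \<subseteq> {1..n}" using that permutes_image[OF w] by (auto simp: nsets_def)
    moreover have "card (w ` e) = card e" using permutes_inj_on[OF w] by (simp add: card_image)
    ultimately show ?thesis using that by (simp add: nsets_def)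
  qed
  then have edges: "keys (push ((`) w) m) \<subseteq> nsets {1..n} 2"
    if "keys m \<subseteq> nsets {1..n} 2" for m :: monomial
    using that unfolding keys_push_image[OF permutes_inj[OF w]] by (intro image_subsetI) (simp add: subset_iff)
  show ?thesis
    unfolding edge_ring_def partial_object.simps mem_Collect_eq keys_act_poly[OF permutes_inj[OF w]]
  proof
    fix m assume "m \<in> push ((`) w) ` keys f"
    then obtain k where k: "m = push ((`) w) k" "k \<in> keys f" by (rule imageE)
    have "keys k \<subseteq> nsets {1..n} 2" using f k(2) unfolding edge_ring_def by simp
    then show "keys m \<subseteq> nsets {1..n} 2" unfolding k(1) by (rule edges)
  qed
qed

lemma homogeneous_act_poly:
  assumes "inj w" "homogeneous d f"
  shows "homogeneous d (act_poly w f)"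
  using assms unfolding homogeneous_def keys_act_poly[OF assms(1)] by (simp add: mono_deg_push)

lemma act_poly_leading_low:
  assumes w: "w permutes {1..2 * a}" and f: "f \<in> leading_low a"
  shows "act_poly w f \<in> leading_low a"
proof -
  have fc: "f \<in> carrier (edge_ring (2 * a))" and fl: "\<And>d. evB (hom_part d f) \<in> low a (2 * d)"
    using f unfolding leading_low_def by auto
  have "act_poly w (hom_part d f) \<in> leading_low a" for d
  proof -
    have "evB (act_poly w (hom_part d f)) \<in> low a (2 * d)"
      unfolding evB_act_poly[OF w] by (rule low_translate[OF w fl])
    then show ?thesis
      using leading_low_homogeneous[OF act_poly_carrier[OF w edge_ring_closed(7)[OF fc]]
          homogeneous_act_poly[OF permutes_inj[OF w] homogeneous_hom_part]] by blast
  qed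
  then have "(\<Sum>d\<in>mono_deg ` keys f. act_poly w (hom_part d f)) \<in> leading_low a"
    by (intro leading_low_sum)
  then show ?thesis by (simp only: act_poly_sum[symmetric] sum_hom_part)
qed

lemma act_poly_pinv:
  assumes "w permutes {1..n}"
  shows "act_poly w (act_poly (pinv w) f) = f"
proof -
  have "push ((`) w) \<circ> push ((`) (pinv w)) = (id :: monomial \<Rightarrow> monomial)"
  proof
    fix m :: monomial
    have "(`) w \<circ> (`) (pinv w) = (id :: nat set \<Rightarrow> _)"
      using permutes_inv_o(1)[OF assms] by (simp add: fun_eq_iff image_comp)
    then show "(push ((`) w) \<circ> push ((`) (pinv w))) m = id m" by (simp add: push_push push_id)
  qed
  then show ?thesis by (simp add: act_poly_def push_push push_id)
qed

abbreviation coset :: "nat \<Rightarrow> mpoly \<Rightarrow> mpoly set" where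
  "coset a f \<equiv> leading_low a +>\<^bsub>edge_ring (2 * a)\<^esub> f"

lemma coset_def: "coset a f = (\<lambda>h. h + f) ` leading_low a"
  by (auto simp: a_r_coset_def')

lemma coset_eq_iff:
  "coset a f = coset a g \<longleftrightarrow> f - g \<in> leading_low a"
proof
  assume eq: "coset a f = coset a g"
  have "0 + f \<in> coset a f"
    unfolding coset_def using leading_low_closed(1) by (rule imageI)
  then obtain h where "h \<in> leading_low a" "f = h + g" unfolding eq unfolding coset_def by auto
  then show "f - g \<in> leading_low a" by simp
next
  have sub: "coset a f \<subseteq> coset a g"
    if d: "f - g \<in> leading_low a" for f g
    unfolding coset_def
  proof (rule image_subsetI)
    fix h assume "h \<in> leading_low a"
    then have "h + (f - g) \<in> leading_low a" using d by (rule leading_low_closed(2))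
    then have "(h + (f - g)) + g \<in> (\<lambda>h. h + g) ` leading_low a" by (rule imageI)
    then show "h + f \<in> (\<lambda>h. h + g) ` leading_low a" by simp
  qed
  assume d: "f - g \<in> leading_low a"
  have "g - f \<in> leading_low a" using leading_low_closed(3)[OF d] by simp
  then show "coset a f = coset a g"
    using sub d by blast
qed

lemma act_coset:
  assumes w: "w permutes {1..2 * a}"
  shows "act_poly w ` (coset a f) = coset a (act_poly w f)"
proof -
  have "act_poly w ` leading_low a = leading_low a"
  proof
    show "act_poly w ` leading_low a \<subseteq> leading_low a" using act_poly_leading_low[OF w] by blast
    show "leading_low a \<subseteq> act_poly w ` leading_low a"
    proof
      fix f assume "f \<in> leading_low a"
      then have "act_poly (pinv w) f \<in> leading_low a" by (rule act_poly_leading_low[OF permutes_inv[OF w]])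
      then have "act_poly w (act_poly (pinv w) f) \<in> act_poly w ` leading_low a" by (rule imageI)
      then show "f \<in> act_poly w ` leading_low a" by (simp only: act_poly_pinv[OF w])
    qed
  qed
  moreover have "act_poly w ` (\<lambda>h. h + f) ` leading_low a = (\<lambda>h. h + act_poly w f) ` act_poly w ` leading_low a"
    by (simp add: image_image act_poly_add)
  ultimately show ?thesis unfolding coset_def by simp
qed

section \<open>The graded pieces\<close>

lemma orbit_harmonics_simps:
  assumes "a \<ge> 1"
  shows "carrier (orbit_harmonics (2 * a) (Pi_two_blocks a) d)
      = {coset a f | f. f \<in> carrier (edge_ring (2 * a)) \<and> homogeneous d f}"
    and "f \<in> carrier (edge_ring (2 * a)) \<Longrightarrow> g \<in> carrier (edge_ring (2 * a)) \<Longrightarrow>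
      vadd (orbit_harmonics (2 * a) (Pi_two_blocks a) d) (coset a f)
        (coset a g) = coset a (f + g)"
    and "f \<in> carrier (edge_ring (2 * a)) \<Longrightarrow>
      vscale (orbit_harmonics (2 * a) (Pi_two_blocks a) d) c (coset a f)
        = coset a (const_poly c * f)"
    and "w permutes {1..2 * a} \<Longrightarrow>
      act (orbit_harmonics (2 * a) (Pi_two_blocks a) d) w (coset a f)
        = coset a (act_poly w f)"
proof -
  note gr = gr_ideal_eq[OF assms]
  have c: "const_poly c \<in> carrier (edge_ring (2 * a))" for c
    unfolding const_poly_def by (rule edge_ring_closed(6)) simp
  show "carrier (orbit_harmonics (2 * a) (Pi_two_blocks a) d)
      = {coset a f | f. f \<in> carrier (edge_ring (2 * a)) \<and> homogeneous d f}"
    by (simp add: orbit_harmonics_def gr)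
  show "vadd (orbit_harmonics (2 * a) (Pi_two_blocks a) d) (coset a f)
        (coset a g) = coset a (f + g)"
    if "f \<in> carrier (edge_ring (2 * a))" "g \<in> carrier (edge_ring (2 * a))"
    using ideal.a_rcos_sum[OF leading_low_ideal that]
    by (simp add: orbit_harmonics_def orbit_harmonics_ring_def FactRing_def gr)
  show "vscale (orbit_harmonics (2 * a) (Pi_two_blocks a) d) c (coset a f)
        = coset a (const_poly c * f)"
    if "f \<in> carrier (edge_ring (2 * a))"
    using ideal.rcoset_mult_add[OF leading_low_ideal c that]
    by (simp add: orbit_harmonics_def orbit_harmonics_ring_def FactRing_def gr)
  show "act (orbit_harmonics (2 * a) (Pi_two_blocks a) d) w (coset a f)
        = coset a (act_poly w f)" if "w permutes {1..2 * a}"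
    using act_coset[OF that] by (simp add: orbit_harmonics_def)
qed

text \<open>
  Take a polynomial of degree at most \<open>d\<close> with the values of \<open>g\<close> and drop its terms of lower degree.
\<close>

lemma low_homogeneous_representative:
  assumes "g \<in> low a (2 * d + 2)"
  shows "\<exists>p\<in>carrier (edge_ring (2 * a)). homogeneous d p \<and> evB p - g \<in> low a (2 * d)"
proof -
  have "g \<in> low a (2 * Suc d)" using assms by simp
  then obtain h where h: "h \<in> carrier (edge_ring (2 * a))" "\<forall>m\<in>keys h. mono_deg m < Suc d"
    "\<forall>B\<in>halves a. evB h B = g B"
    using low_polynomial by blast
  let ?p = "hom_part d h"
  have pc: "?p \<in> carrier (edge_ring (2 * a))" using h(1) by (rule edge_ring_closed(7))
  have "mono_deg m < d" if "m \<in> keys (?p - h)" for m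
  proof -
    have "lookup h m \<noteq> 0" "mono_deg m \<noteq> d"
      using that by (auto simp: in_keys_iff lookup_minus lookup_hom_part split: if_splits)
    then have "mono_deg m < Suc d" "mono_deg m \<noteq> d" using h(2) by (auto simp: in_keys_iff)
    then show ?thesis by simp
  qed
  then have "evB (?p - h) \<in> low a (2 * d)"
    using edge_ring_diff[OF pc h(1)] by (intro low_degree)
  then have "evB ?p - g \<in> low a (2 * d)"
    by (rule low_cong) (simp add: eval_poly_diff h(3))
  then show ?thesis using pc homogeneous_hom_part by blast
qed

lemma homogeneous_low:
  assumes "f \<in> carrier (edge_ring (2 * a))" "homogeneous d f"
  shows "evB f \<in> low a (2 * d + 2)"
proof -
  have "evB f \<in> low a (2 * Suc d)"
    using assms by (intro low_degree) (auto simp: homogeneous_def)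
  then show ?thesis by simp
qed

lemma orbit_harmonics_vanishing_degree:
  assumes a: "a \<ge> 1" and d: "d > a div 2"
  shows "Frob (2 * a) (orbit_harmonics (2 * a) (Pi_two_blocks a) d) = 0"
proof (rule Frob_zero)
  let ?v = "coset a 0"
  have zero: "(0 :: mpoly) \<in> carrier (edge_ring (2 * a))" "homogeneous d 0"
    by (simp_all add: edge_ring_closed homogeneous_def)
  have "f \<in> leading_low a" if f: "f \<in> carrier (edge_ring (2 * a))" "homogeneous d f" for f
  proof -
    have "2 * d > a" using d by simp
    then have "evB f \<in> low a (2 * d)" using low_stable[of a "2 * d"] homogeneous_low[OF f] by blast
    then show ?thesis using leading_low_homogeneous[OF f] by simp
  qed
  then have "coset a f = ?v" if "f \<in> carrier (edge_ring (2 * a))" "homogeneous d f" for f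
    using that by (simp add: coset_eq_iff)
  then show "carrier (orbit_harmonics (2 * a) (Pi_two_blocks a) d) = {?v}"
    unfolding orbit_harmonics_simps(1)[OF a] using zero by blast
  show "vadd (orbit_harmonics (2 * a) (Pi_two_blocks a) d) ?v ?v = ?v"
    using orbit_harmonics_simps(2)[OF a zero(1) zero(1)] by simp
  show "vscale (orbit_harmonics (2 * a) (Pi_two_blocks a) d) c ?v = ?v" for c
    using orbit_harmonics_simps(3)[OF a zero(1)] by simp
  show "act (orbit_harmonics (2 * a) (Pi_two_blocks a) d) w ?v = ?v" if "w permutes {1..2 * a}" for w
    using orbit_harmonics_simps(4)[OF a that, of d 0] by (simp add: act_poly_def)
qed

text \<open>
  The isomorphism sends \<open>v\<close> to the class of any homogeneous polynomial of degree \<open>d\<close> whose values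
  are those of \<open>hat v\<close> up to lower terms. The class does not depend on the choice, which makes the
  map linear and equivariant. It is injective by \<open>hat_low_imp_zero\<close> and onto by \<open>low_step_Specht\<close>.
\<close>

lemma orbit_harmonics_Specht:
  assumes a: "a \<ge> 1" and d: "d \<le> a div 2"
  shows "sn_iso (2 * a) (Specht (2 * a) (two_row (2 * a) (2 * d)))
    (orbit_harmonics (2 * a) (Pi_two_blocks a) d)"
proof -
  let ?n = "2 * a" and ?R = "edge_ring (2 * a)" and ?V = "orbit_harmonics (2 * a) (Pi_two_blocks a) d"
  define S where "S = Specht (2 * a) (two_row (2 * a) (2 * d))"
  have k: "2 * (2 * d) \<le> 2 * a" using d by simp
  have "\<exists>\<psi>. \<forall>g\<in>low a (2 * d + 2). \<psi> g \<in> carrier ?R \<and> homogeneous d (\<psi> g) \<and> evB (\<psi> g) - g \<in> low a (2 * d)"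
    using low_homogeneous_representative[of _ a d] by (intro bchoice) blast
  then obtain \<psi>0 where \<psi>0: "\<And>g. g \<in> low a (2 * d + 2) \<Longrightarrow>
      \<psi>0 g \<in> carrier ?R \<and> homogeneous d (\<psi>0 g) \<and> evB (\<psi>0 g) - g \<in> low a (2 * d)"
    by blast
  define \<psi> where "\<psi> v = \<psi>0 (hat ?n v)" for v
  have \<psi>: "\<psi> v \<in> carrier ?R" "homogeneous d (\<psi> v)" "evB (\<psi> v) - hat ?n v \<in> low a (2 * d)"
    if "v \<in> carrier S" for v
    using \<psi>0[OF hat_in_low[OF that[unfolded S_def]]] by (simp_all add: \<psi>_def)
  have eq: "coset a f = coset a g \<longleftrightarrow> evB f - evB g \<in> low a (2 * d)"
    if "f \<in> carrier ?R" "homogeneous d f" "g \<in> carrier ?R" "homogeneous d g" for f g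
  proof -
    have hd: "homogeneous d (f - g)"
      using that(2,4) by (auto simp: homogeneous_iff lookup_minus) (metis diff_zero)
    show ?thesis
      unfolding coset_eq_iff leading_low_homogeneous[OF edge_ring_diff[OF that(1,3)] hd] evB_diff by (rule refl)
  qed
  have coset_\<psi>: "coset a f = coset a (\<psi> v) \<longleftrightarrow> evB f - hat ?n v \<in> low a (2 * d)"
    if "f \<in> carrier ?R" "homogeneous d f" "v \<in> carrier S" for f v
  proof -
    have "evB f - evB (\<psi> v) \<in> low a (2 * d) \<longleftrightarrow> evB f - hat ?n v \<in> low a (2 * d)"
      using low_add[of "evB f - evB (\<psi> v)" a "2 * d" "evB (\<psi> v) - hat ?n v"]
        low_diff[of "evB f - hat ?n v" a "2 * d" "evB (\<psi> v) - hat ?n v"] \<psi>(3)[OF that(3)] by auto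
    then show ?thesis using eq[OF that(1,2) \<psi>(1,2)[OF that(3)]] by simp
  qed
  have scale_c: "const_poly c * f \<in> carrier ?R" "homogeneous d (const_poly c * f)" "evB (const_poly c * f) = fscale c (evB f)"
    if "f \<in> carrier ?R" "homogeneous d f" for c f
  proof -
    have e: "const_poly c * f = pscale c f" unfolding const_poly_def by (rule mult_map_scale_conv_mult[symmetric])
    show "const_poly c * f \<in> carrier ?R" using that(1) unfolding e edge_ring_carrier by simp
    show "homogeneous d (const_poly c * f)" using that(2) unfolding e homogeneous_iff by simp
    show "evB (const_poly c * f) = fscale c (evB f)"
      unfolding const_poly_def eval_poly_single_mult by (simp add: mono_eval_def)
  qed
  show ?thesis
    unfolding sn_iso_def S_def[symmetric]
  proof (intro exI[of _ "\<lambda>v. coset a (\<psi> v)"] conjI ballI allI impI)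
    show "bij_betw (\<lambda>v. coset a (\<psi> v)) (carrier S) (carrier ?V)"
      unfolding bij_betw_def
    proof
      show "inj_on (\<lambda>v. coset a (\<psi> v)) (carrier S)"
      proof (rule inj_onI)
        fix v w assume v: "v \<in> carrier S" and w: "w \<in> carrier S"
          and "coset a (\<psi> v) = coset a (\<psi> w)"
        then have "evB (\<psi> v) - hat ?n w \<in> low a (2 * d)"
          using coset_\<psi>[OF \<psi>(1,2)[OF v] w] by simp
        then have "(evB (\<psi> v) - hat ?n w) - (evB (\<psi> v) - hat ?n v) \<in> low a (2 * d)"
          using \<psi>(3)[OF v] by (rule low_diff)
        moreover have "(evB (\<psi> v) - hat ?n w) - (evB (\<psi> v) - hat ?n v) = hat ?n (v - w)"
          using hat_add[of ?n "v - w" w] by simp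
        moreover have "v - w \<in> carrier S"
          using v w unfolding S_def Specht_carrier by (rule pm.span_diff)
        ultimately have "v - w = 0"
          unfolding S_def by (intro hat_low_imp_zero[OF _ k]) (simp_all only:)
        then show "v = w" by simp
      qed
      show "(\<lambda>v. coset a (\<psi> v)) ` carrier S = carrier ?V"
        unfolding orbit_harmonics_simps(1)[OF a]
      proof
        show "(\<lambda>v. coset a (\<psi> v)) ` carrier S
          \<subseteq> {coset a f | f. f \<in> carrier ?R \<and> homogeneous d f}"
          using \<psi>(1,2) by blast
        show "{coset a f | f. f \<in> carrier ?R \<and> homogeneous d f}
          \<subseteq> (\<lambda>v. coset a (\<psi> v)) ` carrier S"
        proof
          fix x assume "x \<in> {coset a f | f. f \<in> carrier ?R \<and> homogeneous d f}"
          then obtain f where f: "x = coset a f" "f \<in> carrier ?R" "homogeneous d f" by blast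
          obtain v where v: "v \<in> carrier S" "evB f - hat ?n v \<in> low a (2 * d)"
            using low_step_Specht[OF homogeneous_low[OF f(2,3)] k] unfolding S_def by blast
          then have "x = coset a (\<psi> v)" using coset_\<psi>[OF f(2,3) v(1)] f(1) by simp
          then show "x \<in> (\<lambda>v. coset a (\<psi> v)) ` carrier S" using v(1) by blast
        qed
      qed
    qed
  next
    fix v w assume v: "v \<in> carrier S" and w: "w \<in> carrier S"
    have vw: "v + w \<in> carrier S" using v w unfolding S_def by (rule Specht_closed)
    have "(evB (\<psi> v) - hat ?n v) + (evB (\<psi> w) - hat ?n w) \<in> low a (2 * d)"
      using \<psi>(3)[OF v] \<psi>(3)[OF w] by (rule low_add)
    moreover have "(evB (\<psi> v) - hat ?n v) + (evB (\<psi> w) - hat ?n w) = evB (\<psi> v + \<psi> w) - hat ?n (v + w)"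
      unfolding evB_add hat_add by simp
    ultimately have "evB (\<psi> v + \<psi> w) - hat ?n (v + w) \<in> low a (2 * d)" by (simp only:)
    then have "coset a (\<psi> v + \<psi> w) = coset a (\<psi> (v + w))"
      using coset_\<psi>[OF edge_ring_closed(3)[OF \<psi>(1)[OF v] \<psi>(1)[OF w]] homogeneous_add[OF \<psi>(2)[OF v] \<psi>(2)[OF w]] vw]
      by blast
    then show "coset a (\<psi> (vadd S v w))
      = vadd ?V (coset a (\<psi> v)) (coset a (\<psi> w))"
      using orbit_harmonics_simps(2)[OF a \<psi>(1)[OF v] \<psi>(1)[OF w]] by (simp add: S_def)
  next
    fix c v assume v: "v \<in> carrier S"
    have cv: "pscale c v \<in> carrier S" using v unfolding S_def by (rule Specht_closed)
    have "fscale c (evB (\<psi> v) - hat ?n v) \<in> low a (2 * d)"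
      using \<psi>(3)[OF v] by (rule low_scale)
    moreover have "fscale c (evB (\<psi> v) - hat ?n v) = evB (const_poly c * \<psi> v) - hat ?n (pscale c v)"
      unfolding scale_c(3)[OF \<psi>(1,2)[OF v]] hat_pscale by (simp add: fun_eq_iff right_diff_distrib)
    ultimately have "evB (const_poly c * \<psi> v) - hat ?n (pscale c v) \<in> low a (2 * d)" by (simp only:)
    then have "coset a (const_poly c * \<psi> v) = coset a (\<psi> (pscale c v))"
      using coset_\<psi>[OF scale_c(1,2)[OF \<psi>(1,2)[OF v]] cv] by blast
    then show "coset a (\<psi> (vscale S c v)) = vscale ?V c (coset a (\<psi> v))"
      using orbit_harmonics_simps(3)[OF a \<psi>(1)[OF v]] by (simp add: S_def)
  next
    fix w v assume w: "w permutes {1..2 * a}" and v: "v \<in> carrier S"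
    have wv: "push (map ((`) w)) v \<in> carrier S" using v w unfolding S_def by (rule Specht_act_closed)
    have "(\<lambda>B. (evB (\<psi> v) - hat ?n v) (pinv w ` B)) \<in> low a (2 * d)"
      by (rule low_translate[OF w \<psi>(3)[OF v]])
    moreover have "(\<lambda>B. (evB (\<psi> v) - hat ?n v) (pinv w ` B)) = evB (act_poly w (\<psi> v)) - hat ?n (push (map ((`) w)) v)"
      using hat_push[OF w Nil_notin_keys_Specht[OF v[unfolded S_def]]]
      unfolding evB_act_poly[OF w] by (simp add: fun_eq_iff)
    ultimately have "evB (act_poly w (\<psi> v)) - hat ?n (push (map ((`) w)) v) \<in> low a (2 * d)" by (simp only:)
    then have "coset a (act_poly w (\<psi> v)) = coset a (\<psi> (push (map ((`) w)) v))"
      using coset_\<psi>[OF act_poly_carrier[OF w \<psi>(1)[OF v]] homogeneous_act_poly[OF permutes_inj[OF w] \<psi>(2)[OF v]] wv]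
      by blast
    then show "coset a (\<psi> (act S w v)) = act ?V w (coset a (\<psi> v))"
      using orbit_harmonics_simps(4)[OF a w] by (simp add: S_def)
  qed
qed

lemma schur_two_row: "schur (two_row n k) = schur [n - k, k]"
proof -
  have "cells (two_row n k) = cells [n - k, k]"
    unfolding cells_two_row by (auto simp: cells_def nth_Cons split: nat.splits)
  then show ?thesis by (simp add: schur_def ssyt_def)
qed

theorem theorem3p5:
  fixes a :: nat
  assumes "a \<ge> 1"
  shows "grFrob (2 * a) (orbit_harmonics (2 * a) (Pi_two_blocks a)) =
    (\<Sum>d = 0..a div 2. Polynomial.monom (schur [2 * a - 2 * d, 2 * d]) d)"
proof -
  let ?F = "\<lambda>d. Frob (2 * a) (orbit_harmonics (2 * a) (Pi_two_blocks a) d)"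
  have F: "?F d = schur [2 * a - 2 * d, 2 * d]" if "d \<le> a div 2" for d
  proof -
    have "?F d = schur (two_row (2 * a) (2 * d))"
      using assms that by (intro Frob_two_row orbit_harmonics_Specht) auto
    then show ?thesis by (simp only: schur_two_row)
  qed
  have "?F d = 0" if "d \<notin> {0..a div 2}" for d
    using that by (intro orbit_harmonics_vanishing_degree assms) simp
  then have "{d. Polynomial.monom (?F d) d \<noteq> 0} \<subseteq> {0..a div 2}"
    by (metis (mono_tags, lifting) mem_Collect_eq monom_0 monom_eq_0_iff subsetI)
  then have "grFrob (2 * a) (orbit_harmonics (2 * a) (Pi_two_blocks a)) = (\<Sum>d = 0..a div 2. Polynomial.monom (?F d) d)"
    unfolding grFrob_def by (intro Sum_any.expand_superset) simp_all
  also have "\<dots> = (\<Sum>d = 0..a div 2. Polynomial.monom (schur [2 * a - 2 * d, 2 * d]) d)"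
    by (intro sum.cong refl) (simp only: F atLeastAtMost_iff)
  finally show ?thesis .
qed

end
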